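(* Let $\Omega=[0,2\pi]^2$, let $p\ge 1$ be an integer, let $s>1$, and let $u$ be the $2\pi$-periodic (in $x$ and $y$) solution on $\Omega\times[0,T]$ of the generalized Rosenau-KdV equation $$u_t+\Delta^2u_t+\Delta u_x+(1+u^p)(u_x+u_y)=0,\qquad u(x,y,0)=u_0(x,y),$$ and assume $u\in C^{2}\big(0,T;H_p^{s+4}(\Omega)\big)$. Let $\bm U^1$ be the first step of the LCN-MP scheme (defined in the context) with $N_1=N_2=N$ and time step $\tau$, started from $\bm U^0=\bm u^0$, and let $\bm u^1\in\mathbb V_h$ be the vector of grid values of $u(\cdot,\cdot,t_1)$. Then there exists $\tau_0>0$ such that for $0<\tau\le\tau_0$, $$\|\bm u^1-\bm U^1\|_h+\|\Delta_h(\bm u^1-\bm U^1)\|_h\le C(N^{-s}+\tau^2),\qquad \|\bm u^1-\bm U^1\|_{h,\infty}\le C(N^{-s}+\tau^2),$$ where $C>0$ is independent of $N$ and $\tau$.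
   Context: Grid: $N$ even, $h=2\pi/N$, $x_j=jh$, $y_j=jh$, $0\le j\le N-1$, $t_n=n\tau$, $\tau=T/M$. $\mathbb V_h$ is the space of grid functions $U_{j_1,j_2}$ ($0\le j_1,j_2\le N-1$), extended periodically, identified with vectors $\bm U=(U_{0,0},U_{1,0},\dots,U_{N-1,0},U_{0,1},\dots,U_{N-1,N-1})^T$ (index $j_1$ runs fastest); for a function $v$, $\bm v$ denotes its vector of grid values. $\langle\bm U,\bm V\rangle_h=h^2\sum_{j_1,j_2}U_{j_1,j_2}V_{j_1,j_2}$, $\|\bm U\|_h^2=\langle \bm U,\bm U\rangle_h$, $\|\bm U\|_{h,\infty}=\max|U_{j_1,j_2}|$, $\Delta_hU_{j_1,j_2}=(U_{j_1+1,j_2}-2U_{j_1,j_2}+U_{j_1-1,j_2})/h^2+(U_{j_1,j_2+1}-2U_{j_1,j_2}+U_{j_1,j_2-1})/h^2$. Spectral differentiation matrices: with $g_k(x)=\frac1N\sum_{l=-N/2}^{N/2}\frac1{a_l}e^{\mathrm i l(x-x_k)}$, $a_l=1$ for $|l|<N/2$, $a_{\pm N/2}=2$, let $\bm D_s^x=\bm D_s^y$ be the $N\times N$ matrices with entries $g_k^{(s)}(x_j)$, $0\le j,k\le N-1$. Set $\mathbb A=\bm I_N\otimes\bm D_2^x+\bm D_2^y\otimes\bm I_N$, $\mathbb B=\bm I_N\otimes\bm D_3^x+\bm D_2^y\otimes\bm D_1^x$, $\mathbb L_h=\bm I_N\otimes\bm D_1^x+\bm D_1^y\otimes\bm I_N$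 ($\otimes$ the Kronecker product), and for $\bm W\in\mathbb V_h$, $\mathbb D(\bm W)=\mathbb B+\mathbb L_h+\frac1{p+2}\big(\mathrm{diag}(\bm W^p)\mathbb L_h+\mathbb L_h\,\mathrm{diag}(\bm W^p)\big)$, $\bm W^p$ the componentwise power. LCN-MP scheme: $\bm U^0$ given; $\bm U^1$ solves $(\bm I+\mathbb A^2)\frac{\bm U^1-\bm U^0}{\tau}+\mathbb D(\bm U^0)\frac{\bm U^1+\bm U^0}{2}=0$; for $n=1,\dots,M-1$, $\bm U^{n+1}$ solves $(\bm I+\mathbb A^2)\frac{\bm U^{n+1}-\bm U^n}{\tau}+\mathbb D\big(\tfrac{3\bm U^n-\bm U^{n-1}}{2}\big)\frac{\bm U^{n+1}+\bm U^n}{2}=0$. $H_p^s(\Omega)$ is the closure in $H^s(\Omega)$ of smooth $2\pi$-periodic functions. *)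

theory Defs
  imports "HOL-Analysis.Analysis"
begin

definition cell :: "(real \<times> real) set" where
  "cell = cbox (0, 0) (2 * pi, 2 * pi)"

definition periodic2 :: "(real \<Rightarrow> real \<Rightarrow> real) \<Rightarrow> bool" where
  "periodic2 v \<longleftrightarrow> (\<forall>x y. v (x + 2 * pi) y = v x y \<and> v x (y + 2 * pi) = v x y)"

definition fcoef :: "(real \<Rightarrow> real \<Rightarrow> real) \<Rightarrow> int \<Rightarrow> int \<Rightarrow> complex" where
  "fcoef v k1 k2 =
     integral cell (\<lambda>z. complex_of_real (v (fst z) (snd z))
                         * cis (- (of_int k1 * fst z + of_int k2 * snd z))) / complex_of_real (4 * pi\<^sup>2)"

definition hs_weight :: "real \<Rightarrow> (real \<Rightarrow> real \<Rightarrow> real) \<Rightarrow> int \<times> int \<Rightarrow> real" where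
  "hs_weight s v = (\<lambda>(k1, k2). (1 + real_of_int k1 ^ 2 + real_of_int k2 ^ 2) powr s * (cmod (fcoef v k1 k2))\<^sup>2)"

definition hs_norm :: "real \<Rightarrow> (real \<Rightarrow> real \<Rightarrow> real) \<Rightarrow> real" where
  "hs_norm s v = sqrt (infsum (hs_weight s v) UNIV)"

definition in_Hp :: "real \<Rightarrow> (real \<Rightarrow> real \<Rightarrow> real) \<Rightarrow> bool" where
  "in_Hp s v \<longleftrightarrow> periodic2 v
     \<and> (\<lambda>z. v (fst z) (snd z)) measurable_on cell
     \<and> (\<lambda>z. (v (fst z) (snd z))\<^sup>2) integrable_on cell
     \<and> hs_weight s v summable_on UNIV"

definition Hs_deriv :: "real \<Rightarrow> real \<Rightarrow> (real \<Rightarrow> real \<Rightarrow> real \<Rightarrow> real)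
                        \<Rightarrow> (real \<Rightarrow> real \<Rightarrow> real \<Rightarrow> real) \<Rightarrow> real \<Rightarrow> bool" where
  "Hs_deriv s T f f' t \<longleftrightarrow>
     ((\<lambda>t'. hs_norm s (\<lambda>x y. (f x y t' - f x y t) / (t' - t) - f' x y t)) \<longlongrightarrow> 0)
       (at t within {0..T})"

definition C2_Hp :: "real \<Rightarrow> real \<Rightarrow> (real \<Rightarrow> real \<Rightarrow> real \<Rightarrow> real) \<Rightarrow> bool" where
  "C2_Hp s T u \<longleftrightarrow> (\<exists>u1 u2. \<forall>t\<in>{0..T}.
      in_Hp s (\<lambda>x y. u x y t) \<and> in_Hp s (\<lambda>x y. u1 x y t) \<and> in_Hp s (\<lambda>x y. u2 x y t)
    \<and> Hs_deriv s T u u1 t \<and> Hs_deriv s T u1 u2 t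
    \<and> ((\<lambda>t'. hs_norm s (\<lambda>x y. u2 x y t' - u2 x y t)) \<longlongrightarrow> 0) (at t within {0..T}))"

definition pdx :: "(real \<Rightarrow> real \<Rightarrow> real \<Rightarrow> real) \<Rightarrow> real \<Rightarrow> real \<Rightarrow> real \<Rightarrow> real" where
  "pdx f = (\<lambda>x y t. deriv (\<lambda>\<xi>. f \<xi> y t) x)"
definition pdy :: "(real \<Rightarrow> real \<Rightarrow> real \<Rightarrow> real) \<Rightarrow> real \<Rightarrow> real \<Rightarrow> real \<Rightarrow> real" where
  "pdy f = (\<lambda>x y t. deriv (\<lambda>\<eta>. f x \<eta> t) y)"
definition pdt :: "(real \<Rightarrow> real \<Rightarrow> real \<Rightarrow> real) \<Rightarrow> real \<Rightarrow> real \<Rightarrow> real \<Rightarrow> real" where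
  "pdt f = (\<lambda>x y t. deriv (\<lambda>s. f x y s) t)"
definition lap :: "(real \<Rightarrow> real \<Rightarrow> real \<Rightarrow> real) \<Rightarrow> real \<Rightarrow> real \<Rightarrow> real \<Rightarrow> real" where
  "lap f = (\<lambda>x y t. pdx (pdx f) x y t + pdy (pdy f) x y t)"

definition rosenau_kdv :: "nat \<Rightarrow> real \<Rightarrow> (real \<Rightarrow> real \<Rightarrow> real \<Rightarrow> real) \<Rightarrow> bool" where
  "rosenau_kdv p T u \<longleftrightarrow> (\<forall>x y t. 0 < t \<and> t < T \<longrightarrow>
      pdt u x y t + lap (lap (pdt u)) x y t + pdx (lap u) x y t
      + (1 + (u x y t) ^ p) * (pdx u x y t + pdy u x y t) = 0)"

text \<open>A grid function \<open>U \<in> \<mathbb>V_h\<close> is \<open>U :: nat \<Rightarrow> nat \<Rightarrow> real\<close>, \<open>U j1 j2 = U_{j1,j2}\<close>,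
  only the values with \<open>j1, j2 < N\<close> are used (indices are taken mod N where needed).
  The Kronecker-product matrices acting on the vector \<open>\<bold>U\<close> (index \<open>j1\<close> fastest) are
  written out: \<open>(I_N \<otimes> M) U\<close> acts on the first index, \<open>(M \<otimes> I_N) U\<close> on the second.\<close>

type_synonym grid = "nat \<Rightarrow> nat \<Rightarrow> real"

definition hstep :: "nat \<Rightarrow> real" where
  "hstep N = 2 * pi / real N"

definition a_coef :: "nat \<Rightarrow> int \<Rightarrow> real" where
  "a_coef N l = (if \<bar>l\<bar> = int N div 2 then 2 else 1)"

text \<open>\<open>g_k^{(s)}(x_j)\<close>, with \<open>g_k(x) = (1/N) \<Sum>_{l=-N/2}^{N/2} a_l^{-1} e^{il(x - x_k)}\<close>
  (a real number; we take the real part of the complex expression).\<close>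
definition Dmat :: "nat \<Rightarrow> nat \<Rightarrow> nat \<Rightarrow> nat \<Rightarrow> real" where
  "Dmat N s j k = Re ((1 / of_nat N) * (\<Sum>l\<in>{- (int N div 2) .. int N div 2}.
       complex_of_real (1 / a_coef N l) * (\<i> * of_int l) ^ s
       * cis (real_of_int l * (real j * hstep N - real k * hstep N))))"

definition applyX :: "nat \<Rightarrow> (nat \<Rightarrow> nat \<Rightarrow> real) \<Rightarrow> grid \<Rightarrow> grid" where
  "applyX N M U = (\<lambda>j1 j2. \<Sum>k<N. M j1 k * U k j2)"

definition applyY :: "nat \<Rightarrow> (nat \<Rightarrow> nat \<Rightarrow> real) \<Rightarrow> grid \<Rightarrow> grid" where
  "applyY N M U = (\<lambda>j1 j2. \<Sum>k<N. M j2 k * U j1 k)"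

definition opA :: "nat \<Rightarrow> grid \<Rightarrow> grid" where
  "opA N U = (\<lambda>j1 j2. applyX N (Dmat N 2) U j1 j2 + applyY N (Dmat N 2) U j1 j2)"

definition opB :: "nat \<Rightarrow> grid \<Rightarrow> grid" where
  "opB N U = (\<lambda>j1 j2. applyX N (Dmat N 3) U j1 j2
                     + applyY N (Dmat N 2) (applyX N (Dmat N 1) U) j1 j2)"

definition opL :: "nat \<Rightarrow> grid \<Rightarrow> grid" where
  "opL N U = (\<lambda>j1 j2. applyX N (Dmat N 1) U j1 j2 + applyY N (Dmat N 1) U j1 j2)"

definition opD :: "nat \<Rightarrow> nat \<Rightarrow> grid \<Rightarrow> grid \<Rightarrow> grid" where
  "opD N p W V = (\<lambda>j1 j2. opB N V j1 j2 + opL N V j1 j2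
      + (1 / (real p + 2)) * ((W j1 j2) ^ p * opL N V j1 j2
                               + opL N (\<lambda>a b. (W a b) ^ p * V a b) j1 j2))"

definition lcnmp_step1 :: "nat \<Rightarrow> real \<Rightarrow> nat \<Rightarrow> grid \<Rightarrow> grid \<Rightarrow> bool" where
  "lcnmp_step1 N \<tau> p U0 U1 \<longleftrightarrow> (\<forall>j1<N. \<forall>j2<N.
      (let V = (\<lambda>a b. U1 a b - U0 a b) in (V j1 j2 + opA N (opA N V) j1 j2) / \<tau>)
      + opD N p U0 (\<lambda>a b. (U1 a b + U0 a b) / 2) j1 j2 = 0)"

definition grid_norm :: "nat \<Rightarrow> grid \<Rightarrow> real" where
  "grid_norm N U = sqrt ((hstep N)\<^sup>2 * (\<Sum>j1<N. \<Sum>j2<N. (U j1 j2)\<^sup>2))"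

definition grid_max :: "nat \<Rightarrow> grid \<Rightarrow> real" where
  "grid_max N U = Max {\<bar>U j1 j2\<bar> | j1 j2. j1 < N \<and> j2 < N}"

definition lap_h :: "nat \<Rightarrow> grid \<Rightarrow> grid" where
  "lap_h N U = (\<lambda>j1 j2.
      (U ((j1 + 1) mod N) j2 - 2 * U j1 j2 + U ((j1 + N - 1) mod N) j2) / (hstep N)\<^sup>2
    + (U j1 ((j2 + 1) mod N) - 2 * U j1 j2 + U j1 ((j2 + N - 1) mod N)) / (hstep N)\<^sup>2)"

definition grid_of :: "nat \<Rightarrow> (real \<Rightarrow> real \<Rightarrow> real \<Rightarrow> real) \<Rightarrow> real \<Rightarrow> grid" where
  "grid_of N u t = (\<lambda>j1 j2. u (real j1 * hstep N) (real j2 * hstep N) t)"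

end

theory Submission
  imports Defs
begin

text \<open>
  Inserting the exact solution into the first step leaves a residual \<open>r\<close>. The operator
  \<open>opD\<close> is skew-symmetric for every \<open>W\<close>, so pairing the error equation
  \<open>(e + A\<^sup>2 e) / \<tau> + D(U0) e / 2 = r\<close> with \<open>e\<close> bounds \<open>e\<close> and \<open>A e\<close> by \<open>\<tau>\<close> times the grid norm of
  \<open>r\<close>. In terms of the discrete Fourier coefficients \<open>A e\<close> dominates both the five-point Laplacian
  of \<open>e\<close> and the maximum of \<open>e\<close>. It therefore suffices that \<open>r = O(N powr (- s) + \<tau>)\<close>.
  Since \<open>u\<close> is \<open>C\<^sup>2\<close> in time, replacing all time levels by \<open>t = 0\<close> costs \<open>O(\<tau>)\<close>, uniformly on the
  grid; at \<open>t = 0\<close> the equation holds by continuity and only the error of spectral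
  differentiation remains. That error is carried by the frequencies beyond \<open>N / 2\<close> and is
  \<open>O(N powr (- s))\<close> in the grid norm by an aliasing estimate. The nonlinear term is differentiated in
  the form \<open>(p + 2) u\<^sup>p v = u\<^sup>p v + (u\<^sup>p\<^sup>+\<^sup>1)\<^sub>x + (u\<^sup>p\<^sup>+\<^sup>1)\<^sub>y\<close> with \<open>v = u\<^sub>x + u\<^sub>y\<close>.
\<close>

section \<open>Weighted coefficient sequences\<close>

text \<open>Since \<open>jw\<close> is quadratic in the frequency, an exponent in \<open>wl1\<close>
  counts pairs of derivatives, and in dimension two \<open>jw k powr (- a)\<close> is summable for
  \<open>a > 1\<close>. This is where \<open>s > 1\<close> comes from: square sums with exponent
  \<open>s + 4\<close> then control absolute sums with weight \<open>2\<close>, that is, four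
  derivatives pointwise, as the biharmonic term requires. The hypotheses give regularity through
  Fourier coefficients and norms of difference quotients, whereas the equation and the grid values
  are pointwise. The bridge is that a continuous periodic function with absolutely summable
  coefficients equals its Fourier series; the time derivative, known only as an element of the
  Sobolev space, is replaced by the sum of its series. From there on coefficient sequences are
  manipulated. The nonlinearity is treated in weighted absolutely summable sequences, an algebra
  under convolution, and brought back to square sums just before aliasing. Only one derivative falls
  on the power there, while the coefficients have four to spare; this pays for both
  embeddings.\<close>

text \<open>The square of the Japanese bracket of a frequency; \<open>hs_weight s\<close> carries the weight \<open>jw k powr s\<close>.\<close>

definition jw :: "int \<times> int \<Rightarrow> real" where
  "jw k = 1 + (real_of_int (fst k))\<^sup>2 + (real_of_int (snd k))\<^sup>2"

definition trig :: "int \<times> int \<Rightarrow> real \<Rightarrow> real \<Rightarrow> complex" where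
  "trig k x y = cis (real_of_int (fst k) * x + real_of_int (snd k) * y)"

text \<open>The coefficients are not tied to the integrals \<open>fcoef\<close>, so derivatives,
  products and powers become operations on sequences. Real values of \<open>f\<close> are part of
  the assertion and have to be re-established after each operation.\<close>

definition fser :: "(int \<times> int \<Rightarrow> complex) \<Rightarrow> (real \<Rightarrow> real \<Rightarrow> real) \<Rightarrow> bool" where
  "fser c f \<longleftrightarrow> (\<forall>x y. ((\<lambda>k. c k * trig k x y) has_sum complex_of_real (f x y)) UNIV)"

text \<open>Bounds for the weighted \<open>l\<^sup>1\<close> and \<open>l\<^sup>2\<close> norms of \<open>c\<close>, stated through finite sums so that summability is
  part of the assertion; in \<open>wl2\<close> the weight multiplies the squares.\<close>

definition wl1 :: "real \<Rightarrow> (int \<times> int \<Rightarrow> complex) \<Rightarrow> real \<Rightarrow> bool" where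
  "wl1 r c K \<longleftrightarrow> (\<forall>F. finite F \<longrightarrow> (\<Sum>k\<in>F. jw k powr r * cmod (c k)) \<le> K)"

definition wl2 :: "real \<Rightarrow> (int \<times> int \<Rightarrow> complex) \<Rightarrow> real \<Rightarrow> bool" where
  "wl2 r c K \<longleftrightarrow> 0 \<le> K \<and> (\<forall>F. finite F \<longrightarrow> (\<Sum>k\<in>F. jw k powr r * (cmod (c k))\<^sup>2) \<le> K\<^sup>2)"

lemma sq_powr: "0 < x \<Longrightarrow> (x\<^sup>2) powr b = x powr (2 * b)" for x b :: real
  by (simp add: power2_eq_square powr_mult flip: powr_add)

lemma powr_sq: "(x powr b)\<^sup>2 = x powr (2 * b)" for x b :: real
  by (simp add: power2_eq_square flip: powr_add)

lemma jw_ge_1: "1 \<le> jw k"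
  by (simp add: jw_def)

lemma jw_pos [simp]: "0 < jw k"
  using jw_ge_1[of k] by linarith

lemma jw_nonzero [simp]: "jw k \<noteq> 0"
  using jw_pos[of k] by linarith

lemma cmod_trig [simp]: "cmod (trig k x y) = 1"
  by (simp add: trig_def)

lemma abs_freq_le: "\<bar>real_of_int (fst k)\<bar> \<le> jw k powr (1/2)" "\<bar>real_of_int (snd k)\<bar> \<le> jw k powr (1/2)"
  by (simp_all add: powr_half_sqrt jw_def real_le_rsqrt)

lemma summable_on_int_powr:
  assumes "a > 1"
  shows "(\<lambda>k::int. (1 + (real_of_int k)\<^sup>2) powr (- a / 2)) summable_on UNIV"
proof -
  let ?f = "\<lambda>k::int. (1 + (real_of_int k)\<^sup>2) powr (- a / 2)"
  have s: "summable (\<lambda>n. (1 + (real n)\<^sup>2) powr (- a / 2))"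
  proof (rule summable_comparison_test')
    show "summable (\<lambda>n. real n powr (- a))"
      using assms by (simp add: summable_real_powr_iff)
    show "norm ((1 + (real n)\<^sup>2) powr (- a / 2)) \<le> real n powr (- a)" if "n \<ge> 1" for n
    proof -
      have "(1 + (real n)\<^sup>2) powr (- a / 2) \<le> ((real n)\<^sup>2) powr (- a / 2)"
        using that assms by (intro powr_mono2') auto
      also have "\<dots> = real n powr (- a)"
        using that by (simp add: sq_powr)
      finally show ?thesis by simp
    qed
  qed
  then have n: "(\<lambda>n. (1 + (real n)\<^sup>2) powr (- a / 2)) summable_on UNIV"
    by (intro summable_nonneg_imp_summable_on) auto
  have "?f summable_on range int"
    using n by (subst summable_on_reindex) (auto simp: o_def)
  moreover have "?f summable_on range (\<lambda>n. - int n)"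
    using n by (subst summable_on_reindex) (auto simp: o_def inj_def)
  ultimately have "?f summable_on (range int \<union> range (\<lambda>n. - int n))"
    by (rule summable_on_union)
  moreover have "range int \<union> range (\<lambda>n. - int n) = UNIV"
  proof (intro equalityI subsetI)
    fix k :: int
    show "k \<in> range int \<union> range (\<lambda>n. - int n)" by (cases k rule: int_cases2) auto
  qed auto
  ultimately show ?thesis by simp
qed

lemma summable_on_prod_nonneg:
  fixes f :: "'a \<Rightarrow> real" and g :: "'b \<Rightarrow> real"
  assumes "f summable_on UNIV" "g summable_on UNIV" "\<And>x. 0 \<le> f x" "\<And>y. 0 \<le> g y"
  shows "(\<lambda>z. f (fst z) * g (snd z)) summable_on UNIV"
proof -
  have "(\<lambda>z. f (fst z) * g (snd z)) summable_on (UNIV \<times> UNIV)"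
  proof (rule summable_on_SigmaI)
    show "((\<lambda>y. f (fst (x, y)) * g (snd (x, y))) has_sum f x * infsum g UNIV) UNIV" for x
      using assms(2) by (auto intro!: has_sum_cmult_right)
    show "(\<lambda>x. f x * infsum g UNIV) summable_on UNIV"
      using assms(1) by (rule summable_on_cmult_left)
  qed (use assms in auto)
  then show ?thesis by simp
qed

text \<open>The product of the two one-dimensional brackets is at most \<open>jw k ^ 2\<close>, so a
  product of two one-variable sums is a majorant. The threshold is \<open>1\<close> rather than
  \<open>2\<close> because \<open>jw\<close> is already quadratic.\<close>

lemma summable_on_jw_powr:
  assumes "a > 1"
  shows "(\<lambda>k. jw k powr (- a)) summable_on UNIV"
proof -
  let ?f = "\<lambda>k::int. (1 + (real_of_int k)\<^sup>2) powr (- a / 2)"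
  have s: "(\<lambda>k. ?f (fst k) * ?f (snd k)) summable_on UNIV"
    using summable_on_prod_nonneg[OF summable_on_int_powr[OF assms] summable_on_int_powr[OF assms]] by simp
  show ?thesis
  proof (rule summable_on_comparison_test[OF s])
    fix k :: "int \<times> int"
    let ?p = "(1 + (real_of_int (fst k))\<^sup>2) * (1 + (real_of_int (snd k))\<^sup>2)"
    have "?p \<le> jw k ^ 2"
      unfolding power2_eq_square[of "jw k"] by (intro mult_mono) (auto simp: jw_def)
    then have "(jw k ^ 2) powr (- a / 2) \<le> ?p powr (- a / 2)"
      using assms by (intro powr_mono2') (auto simp: add_pos_nonneg)
    then show "jw k powr - a \<le> ?f (fst k) * ?f (snd k)"
      by (simp add: powr_mult sq_powr)
  qed auto
qed

lemma wl1_nonneg: "wl1 r c K \<Longrightarrow> 0 \<le> K"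
  unfolding wl1_def by (metis finite.emptyI sum.empty)

lemma wl1_summable: "wl1 r c K \<Longrightarrow> (\<lambda>k. jw k powr r * cmod (c k)) summable_on UNIV"
  by (rule nonneg_bdd_above_summable_on) (auto simp: wl1_def bdd_above_def)

lemma summable_wl2:
  assumes "(\<lambda>k. jw k powr r * (cmod (c k))\<^sup>2) summable_on UNIV"
  shows "wl2 r c (sqrt (infsum (\<lambda>k. jw k powr r * (cmod (c k))\<^sup>2) UNIV))"
  unfolding wl2_def using assms by (auto intro!: finite_sum_le_infsum simp: infsum_nonneg)

lemma wl1_multiplier:
  assumes "wl1 (r + a) c K" "\<And>k. cmod (m k) \<le> M * jw k powr a" "0 \<le> M"
  shows "wl1 r (\<lambda>k. m k * c k) (M * K)"
  unfolding wl1_def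
proof (intro allI impI)
  fix F :: "(int \<times> int) set" assume F: "finite F"
  have "(\<Sum>k\<in>F. jw k powr r * cmod (m k * c k)) \<le> (\<Sum>k\<in>F. M * (jw k powr (r + a) * cmod (c k)))"
  proof (rule sum_mono)
    fix k
    have "jw k powr r * cmod (m k * c k) \<le> jw k powr r * ((M * jw k powr a) * cmod (c k))"
      using assms(2)[of k] unfolding norm_mult by (intro mult_left_mono mult_right_mono) auto
    then show "jw k powr r * cmod (m k * c k) \<le> M * (jw k powr (r + a) * cmod (c k))"
      by (simp add: powr_add mult_ac)
  qed
  also have "\<dots> = M * (\<Sum>k\<in>F. jw k powr (r + a) * cmod (c k))"
    by (simp add: sum_distrib_left)
  also have "\<dots> \<le> M * K"
    using assms(1,3) F by (intro mult_left_mono) (auto simp: wl1_def)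
  finally show "(\<Sum>k\<in>F. jw k powr r * cmod (m k * c k)) \<le> M * K" .
qed

lemma wl1_mono:
  assumes "wl1 r c K" "q \<le> r" "K \<le> L"
  shows "wl1 q c L"
  unfolding wl1_def
proof (intro allI impI)
  fix F :: "(int \<times> int) set" assume F: "finite F"
  have "(\<Sum>k\<in>F. jw k powr q * cmod (c k)) \<le> (\<Sum>k\<in>F. jw k powr r * cmod (c k))"
    using assms(2) by (intro sum_mono mult_right_mono powr_mono) (auto simp: jw_ge_1)
  also have "\<dots> \<le> L" using assms F by (auto simp: wl1_def intro: order_trans)
  finally show "(\<Sum>k\<in>F. jw k powr q * cmod (c k)) \<le> L" .
qed

lemma wl1_add:
  assumes "wl1 r a K" "wl1 r b L"
  shows "wl1 r (\<lambda>k. a k + b k) (K + L)"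
  unfolding wl1_def
proof (intro allI impI)
  fix F :: "(int \<times> int) set" assume F: "finite F"
  have "(\<Sum>k\<in>F. jw k powr r * cmod (a k + b k))
      \<le> (\<Sum>k\<in>F. jw k powr r * cmod (a k) + jw k powr r * cmod (b k))"
    unfolding distrib_left[symmetric]
    by (intro sum_mono mult_left_mono norm_triangle_ineq) auto
  also have "\<dots> \<le> K + L"
    using assms F by (simp add: sum.distrib wl1_def add_mono)
  finally show "(\<Sum>k\<in>F. jw k powr r * cmod (a k + b k)) \<le> K + L" .
qed

lemma wl1_abs_summable:
  assumes "wl1 r c K" "0 \<le> r"
  shows "(\<lambda>k. cmod (c k)) summable_on UNIV"
  using wl1_summable[OF wl1_mono[OF assms(1,2) order_refl]] by simp

text \<open>Cauchy-Schwarz against \<open>jw k powr (- (q - 2 * r) / 2)\<close>: a Sobolev embedding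
  on the level of coefficients. \<open>Z\<close> is obtained before \<open>c\<close> and
  \<open>K\<close> because it later has to be independent of time, of \<open>N\<close> and of the
  grid function.\<close>

lemma wl2_imp_wl1:
  assumes "q - 2 * r > 1"
  obtains Z where "0 \<le> Z" "\<And>c K. wl2 q c K \<Longrightarrow> wl1 r c (Z * K)"
proof -
  let ?a = "q - 2 * r"
  define Z where "Z = sqrt (infsum (\<lambda>k. jw k powr (- ?a)) UNIV)"
  have Z: "0 \<le> Z" by (simp add: Z_def infsum_nonneg)
  have "wl1 r c (Z * K)" if c: "wl2 q c K" for c K
    unfolding wl1_def
  proof (intro allI impI)
    fix F :: "(int \<times> int) set" assume F: "finite F"
    let ?S = "\<Sum>k\<in>F. jw k powr r * cmod (c k)"
    have eq: "?S = (\<Sum>k\<in>F. jw k powr (- ?a / 2) * (jw k powr (q / 2) * cmod (c k)))"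
    proof (intro sum.cong refl)
      fix k
      have "r = - ?a / 2 + q / 2" by (simp add: field_simps)
      then have "jw k powr r = jw k powr (- ?a / 2) * jw k powr (q / 2)"
        by (metis powr_add)
      then show "jw k powr r * cmod (c k) = jw k powr (- ?a / 2) * (jw k powr (q / 2) * cmod (c k))"
        by simp
    qed
    have "?S\<^sup>2 \<le> (\<Sum>k\<in>F. (jw k powr (- ?a / 2))\<^sup>2) * (\<Sum>k\<in>F. (jw k powr (q / 2) * cmod (c k))\<^sup>2)"
      unfolding eq
      using Cauchy_Schwarz_ineq_sum[of "\<lambda>k. jw k powr (- ?a / 2)" "\<lambda>k. jw k powr (q / 2) * cmod (c k)" F] .
    also have "(\<Sum>k\<in>F. (jw k powr (- ?a / 2))\<^sup>2) = (\<Sum>k\<in>F. jw k powr (- ?a))"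
      unfolding powr_sq by (intro sum.cong refl arg_cong[of _ _ "(powr) _"]) (simp add: field_simps)
    also have "(\<Sum>k\<in>F. (jw k powr (q / 2) * cmod (c k))\<^sup>2) = (\<Sum>k\<in>F. jw k powr q * (cmod (c k))\<^sup>2)"
      unfolding power_mult_distrib powr_sq by simp
    also have "(\<Sum>k\<in>F. jw k powr (- ?a)) * (\<Sum>k\<in>F. jw k powr q * (cmod (c k))\<^sup>2) \<le> Z\<^sup>2 * K\<^sup>2"
    proof (rule mult_mono)
      show "(\<Sum>k\<in>F. jw k powr (- ?a)) \<le> Z\<^sup>2"
        using summable_on_jw_powr[OF assms] F
        by (simp add: Z_def infsum_nonneg finite_sum_le_infsum)
    qed (use c F in \<open>auto simp: wl2_def intro!: sum_nonneg\<close>)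
    also have "\<dots> = (Z * K)\<^sup>2" by (simp add: power_mult_distrib)
    finally show "(\<Sum>k\<in>F. jw k powr r * cmod (c k)) \<le> Z * K"
      by (rule power2_le_imp_le) (use c Z in \<open>auto simp: wl2_def\<close>)
  qed
  with Z that show ?thesis by blast
qed

text \<open>Each single weighted coefficient is at most \<open>K\<close>, so one factor of the
  square is replaced by \<open>K\<close>. This is the way back from the convolution algebra to the
  square sums that aliasing needs.\<close>

lemma wl1_imp_wl2:
  assumes "wl1 r c K"
  shows "wl2 (2 * r) c K"
  unfolding wl2_def
proof (intro conjI allI impI)
  show K: "0 \<le> K" using assms by (rule wl1_nonneg)
  fix F :: "(int \<times> int) set" assume F: "finite F"
  have "(\<Sum>k\<in>F. jw k powr (2 * r) * (cmod (c k))\<^sup>2) = (\<Sum>k\<in>F. (jw k powr r * cmod (c k)) * (jw k powr r * cmod (c k)))"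
    by (intro sum.cong refl) (simp add: power2_eq_square mult_ac flip: powr_add)
  also have "\<dots> \<le> (\<Sum>k\<in>F. (jw k powr r * cmod (c k)) * K)"
  proof (intro sum_mono mult_left_mono)
    fix k
    show "jw k powr r * cmod (c k) \<le> K"
      using assms[unfolded wl1_def, rule_format, of "{k}"] by simp
  qed auto
  also have "\<dots> \<le> K * K"
    unfolding sum_distrib_right[symmetric] using assms F K by (intro mult_right_mono) (auto simp: wl1_def)
  finally show "(\<Sum>k\<in>F. jw k powr (2 * r) * (cmod (c k))\<^sup>2) \<le> K\<^sup>2"
    by (simp add: power2_eq_square)
qed

lemma wl2_multiplier:
  assumes "wl2 (r + 2 * a) c K" "\<And>k. cmod (m k) \<le> M * jw k powr a" "0 \<le> M"
  shows "wl2 r (\<lambda>k. m k * c k) (M * K)"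
  unfolding wl2_def
proof (intro conjI allI impI)
  show "0 \<le> M * K" using assms by (simp add: wl2_def)
  fix F :: "(int \<times> int) set" assume F: "finite F"
  have "(\<Sum>k\<in>F. jw k powr r * (cmod (m k * c k))\<^sup>2) \<le> (\<Sum>k\<in>F. M\<^sup>2 * (jw k powr (r + 2 * a) * (cmod (c k))\<^sup>2))"
  proof (rule sum_mono)
    fix k
    have "(cmod (m k))\<^sup>2 \<le> (M * jw k powr a)\<^sup>2"
      using assms(2)[of k] by (intro power_mono) auto
    also have "\<dots> = M\<^sup>2 * jw k powr (2 * a)"
      by (simp add: power_mult_distrib powr_sq)
    finally have "jw k powr r * ((cmod (m k))\<^sup>2 * (cmod (c k))\<^sup>2) \<le> jw k powr r * ((M\<^sup>2 * jw k powr (2 * a)) * (cmod (c k))\<^sup>2)"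
      by (intro mult_left_mono mult_right_mono) auto
    then show "jw k powr r * (cmod (m k * c k))\<^sup>2 \<le> M\<^sup>2 * (jw k powr (r + 2 * a) * (cmod (c k))\<^sup>2)"
      by (simp add: powr_add norm_mult power_mult_distrib mult_ac)
  qed
  also have "\<dots> = M\<^sup>2 * (\<Sum>k\<in>F. jw k powr (r + 2 * a) * (cmod (c k))\<^sup>2)"
    by (simp add: sum_distrib_left)
  also have "\<dots> \<le> M\<^sup>2 * K\<^sup>2"
    using assms(1) F by (intro mult_left_mono) (auto simp: wl2_def)
  finally show "(\<Sum>k\<in>F. jw k powr r * (cmod (m k * c k))\<^sup>2) \<le> (M * K)\<^sup>2"
    by (simp add: power_mult_distrib)
qed

lemma wl1_has_sum_bound:
  assumes "wl1 0 c K" "((\<lambda>k. c k * e k) has_sum z) UNIV" "\<And>k. cmod (e k) \<le> 1"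
  shows "cmod z \<le> K"
proof -
  have "(sum (\<lambda>k. c k * e k) \<longlongrightarrow> z) (finite_subsets_at_top UNIV)"
    using assms(2) by (simp add: has_sum_def)
  then have "((\<lambda>F. cmod (sum (\<lambda>k. c k * e k) F)) \<longlongrightarrow> cmod z) (finite_subsets_at_top UNIV)"
    by (rule tendsto_norm)
  moreover have "eventually (\<lambda>F. cmod (sum (\<lambda>k. c k * e k) F) \<le> K) (finite_subsets_at_top UNIV)"
  proof (rule eventually_finite_subsets_at_top_weakI)
    fix F :: "(int \<times> int) set" assume F: "finite F"
    have "cmod (sum (\<lambda>k. c k * e k) F) \<le> (\<Sum>k\<in>F. cmod (c k * e k))" by (rule norm_sum)
    also have "\<dots> \<le> (\<Sum>k\<in>F. jw k powr 0 * cmod (c k))"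
      using assms(3) by (intro sum_mono) (simp add: norm_mult mult_left_le)
    also have "\<dots> \<le> K" using assms(1) F by (auto simp: wl1_def)
    finally show "cmod (sum (\<lambda>k. c k * e k) F) \<le> K" .
  qed
  ultimately show ?thesis
    by (rule tendsto_upperbound) simp
qed

section \<open>Fourier series of continuous functions\<close>

lemma continuous_on_trig [continuous_intros]:
  "continuous_on S f \<Longrightarrow> continuous_on S g \<Longrightarrow> continuous_on S (\<lambda>z. trig k (f z) (g z))"
  unfolding trig_def by (intro continuous_intros)

lemma trig_mult: "trig j x y * trig k x y = trig (j + k) x y"
  by (simp add: trig_def cis_mult algebra_simps)

lemma trig_zero [simp]: "trig 0 x y = 1"
  by (simp add: trig_def)

lemma integrable_cell: "continuous_on cell f \<Longrightarrow> f integrable_on cell"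
  for f :: "real \<times> real \<Rightarrow> 'a::banach"
  unfolding cell_def by (rule integrable_continuous)

lemma integral_cis:
  "integral (cbox 0 (2 * pi)) (\<lambda>x. cis (real_of_int m * x)) = (if m = 0 then of_real (2 * pi) else 0)"
proof (cases "m = 0")
  case False
  have "((\<lambda>x. cis (real_of_int m * x)) has_integral
      (cis (real_of_int m * (2 * pi)) / (\<i> * of_int m) - cis (real_of_int m * 0) / (\<i> * of_int m))) {0..2 * pi}"
    using False
    by (intro fundamental_theorem_of_calculus)
       (auto intro!: derivative_eq_intros simp: has_vector_derivative_def scaleR_conv_of_real field_simps)
  moreover have "cis (real_of_int m * (2 * pi)) = 1"
    using cis_multiple_2pi[of "real_of_int m"] by (simp add: mult_ac)
  ultimately show ?thesis using False by (simp add: integral_unique)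
qed (simp add: scaleR_conv_of_real)

lemma integral_trig:
  "integral cell (\<lambda>z. trig k (fst z) (snd z)) = (if k = 0 then of_real (4 * pi\<^sup>2) else 0)"
proof -
  have "integral cell (\<lambda>z. trig k (fst z) (snd z))
      = integral (cbox 0 (2 * pi)) (\<lambda>x. integral (cbox 0 (2 * pi)) (\<lambda>y. trig k x y))"
    unfolding cell_def by (subst integral_prod_continuous) (auto intro!: continuous_intros)
  also have "\<dots> = integral (cbox 0 (2 * pi)) (\<lambda>x. cis (real_of_int (fst k) * x))
      * integral (cbox 0 (2 * pi)) (\<lambda>y. cis (real_of_int (snd k) * y))"
    by (simp add: trig_def flip: cis_mult)
  finally show ?thesis
    unfolding integral_cis by (auto simp: prod_eq_iff power2_eq_square)
qed

text \<open>The cosine shifts one frequency component by one in either direction, so every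
  coefficient of the product is a combination of three coefficients of \<open>G\<close>.
  Orthogonality to all exponentials thus survives multiplication by powers of the bump.\<close>

lemma integral_trig_step:
  fixes G :: "real \<times> real \<Rightarrow> real"
  assumes "continuous_on cell G"
    and "\<And>k. integral cell (\<lambda>z. complex_of_real (G z) * trig k (fst z) (snd z)) = 0"
  shows "integral cell (\<lambda>z. complex_of_real (G z * (1 + cos (fst z - a))) * trig k (fst z) (snd z)) = 0"
    and "integral cell (\<lambda>z. complex_of_real (G z * (1 + cos (snd z - a))) * trig k (fst z) (snd z)) = 0"
proof -
  let ?g = "\<lambda>k z. complex_of_real (G z) * trig k (fst z) (snd z)"
  have int: "?g k integrable_on cell" for k
    by (intro integrable_cell continuous_intros assms)
  have *: "integral cell (\<lambda>z. ?g k z + (cis (- a) / 2 * ?g (k + e) z + cis a / 2 * ?g (k - e) z)) = 0" for e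
  proof -
    have "((\<lambda>z. ?g k z + (cis (- a) / 2 * ?g (k + e) z + cis a / 2 * ?g (k - e) z)) has_integral
       0 + (cis (- a) / 2 * 0 + cis a / 2 * 0)) cell"
      by (intro has_integral_add has_integral_mult_right) (metis int assms(2) integrable_integral)+
    then show ?thesis by (simp add: integral_unique)
  qed
  have cos: "complex_of_real (cos t) = (cis t + cis (- t)) / 2" for t
    by (simp add: complex_eq_iff)
  have "complex_of_real (G z * (1 + cos (fst z - a))) * trig k (fst z) (snd z)
      = ?g k z + (cis (- a) / 2 * ?g (k + (1, 0)) z + cis a / 2 * ?g (k - (1, 0)) z)" for z
    unfolding trig_def of_real_mult of_real_add cos
    by (simp add: field_simps cis_mult)
  then show "integral cell (\<lambda>z. complex_of_real (G z * (1 + cos (fst z - a))) * trig k (fst z) (snd z)) = 0"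
    using * by simp
  have "complex_of_real (G z * (1 + cos (snd z - a))) * trig k (fst z) (snd z)
      = ?g k z + (cis (- a) / 2 * ?g (k + (0, 1)) z + cis a / 2 * ?g (k - (0, 1)) z)" for z
    unfolding trig_def of_real_mult of_real_add cos
    by (simp add: field_simps cis_mult)
  then show "integral cell (\<lambda>z. complex_of_real (G z * (1 + cos (snd z - a))) * trig k (fst z) (snd z)) = 0"
    using * by simp
qed

text \<open>Beyond \<open>pi\<close> the argument is reflected. The upper limit keeps
  \<open>t\<close> at distance \<open>d\<close> from the neighbouring period, where the cosine peaks
  again.\<close>

lemma cos_le_away:
  assumes "0 < d" "d \<le> \<bar>t\<bar>" "\<bar>t\<bar> \<le> 2 * pi - d"
  shows "cos t \<le> cos d"
proof (cases "\<bar>t\<bar> \<le> pi")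
  case True
  then have "cos \<bar>t\<bar> \<le> cos d" using assms by (intro cos_monotone_0_pi_le) auto
  then show ?thesis by simp
next
  case False
  then have "cos (2 * pi - \<bar>t\<bar>) \<le> cos d" using assms by (intro cos_monotone_0_pi_le) auto
  then show ?thesis by (simp add: cos_diff)
qed

text \<open>The powers of a trigonometric bump concentrate at its peak, so a function that is orthogonal
  to all of them cannot be positive there.\<close>

lemma fourier_unique_interior:
  fixes w :: "real \<times> real \<Rightarrow> real"
  assumes cont: "continuous_on cell w"
    and zero: "\<And>k. integral cell (\<lambda>z. complex_of_real (w z) * trig k (fst z) (snd z)) = 0"
    and z0: "z0 \<in> box (0, 0) (2 * pi, 2 * pi)"
  shows "w z0 \<le> 0"
proof (rule ccontr)
  assume "\<not> w z0 \<le> 0"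
  define a where "a = w z0"
  have a: "a > 0" using \<open>\<not> w z0 \<le> 0\<close> by (simp add: a_def)
  define x0 y0 where "x0 = fst z0" and "y0 = snd z0"
  have z0_eq: "z0 = (x0, y0)" by (simp add: x0_def y0_def)
  have x0: "0 < x0" "x0 < 2 * pi" and y0: "0 < y0" "y0 < 2 * pi"
    using z0 by (auto simp: box_def Basis_prod_def z0_eq)
  have z0c: "z0 \<in> cell"
    using x0 y0 by (auto simp: cell_def z0_eq mem_box Basis_prod_def)
  obtain e where e: "e > 0" "\<And>z. z \<in> cell \<Longrightarrow> dist z z0 < e \<Longrightarrow> w z > a / 2"
  proof -
    obtain e where "e > 0" "\<forall>z\<in>cell. dist z z0 < e \<longrightarrow> dist (w z) (w z0) < a / 2"
      using cont[unfolded continuous_on_iff] z0c a half_gt_zero by blast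
    moreover from this have "w z > a / 2" if "z \<in> cell" "dist z z0 < e" for z
    proof -
      have "\<bar>w z - a\<bar> < a / 2" using calculation(2) that by (simp add: dist_real_def a_def)
      then show ?thesis by linarith
    qed
    ultimately show ?thesis using that by blast
  qed
  \<comment> \<open>\<open>e / 2\<close> because the distance is estimated by the sum of two
    coordinate distances; the other terms keep coordinate differences within the cell at most
    \<open>2 * pi - d\<close>, away from the periodic copies of the peak.\<close>
  define d where "d = min (e / 2) (min x0 (min (2 * pi - x0) (min y0 (2 * pi - y0))))"
  have d: "0 < d" "d \<le> e / 2" "d \<le> x0" "d \<le> 2 * pi - x0" "d \<le> y0" "d \<le> 2 * pi - y0"
  proof -
    show "0 < d" unfolding d_def min_less_iff_conj using e(1) x0 y0 by simp
    show "d \<le> e / 2" "d \<le> x0" unfolding d_def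
      by (rule min.cobounded1, intro min.coboundedI2 min.cobounded1)
    show "d \<le> 2 * pi - x0" unfolding d_def by (rule min.coboundedI2, rule min.coboundedI2, rule min.cobounded1)
    show "d \<le> y0" unfolding d_def
      by (rule min.coboundedI2, rule min.coboundedI2, rule min.coboundedI2, rule min.cobounded1)
    show "d \<le> 2 * pi - y0" unfolding d_def
      by (rule min.coboundedI2, rule min.coboundedI2, rule min.coboundedI2, rule min.cobounded2)
  qed
  define q where "q z = (1 + cos (fst z - x0)) / 2 * ((1 + cos (snd z - y0)) / 2)" for z :: "real \<times> real"
  define \<rho> where "\<rho> = (1 + cos d) / 2"
  have cosd: "cos d < 1"
    using cos_monotone_0_pi[of 0 d] d x0 by auto
  have cos1: "0 \<le> 1 + cos t" for t :: real
    using add_left_mono[OF cos_ge_minus_one[of t], of 1] by simp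
  have \<rho>: "0 \<le> \<rho>" "\<rho> < 1"
  proof -
    show "0 \<le> \<rho>" unfolding \<rho>_def using cos1[of d] by simp
    show "\<rho> < 1" unfolding \<rho>_def using cosd by (simp add: field_simps)
  qed
  have half: "0 \<le> (1 + cos t) / 2" "(1 + cos t) / 2 \<le> 1" for t :: real
  proof -
    show "0 \<le> (1 + cos t) / 2" using cos1[of t] by simp
    show "(1 + cos t) / 2 \<le> 1" by simp
  qed
  have q0: "0 \<le> q z" for z unfolding q_def by (intro mult_nonneg_nonneg half)
  have q_away: "q z \<le> \<rho>" if "z \<in> cell" "d \<le> \<bar>fst z - x0\<bar> \<or> d \<le> \<bar>snd z - y0\<bar>" for z
  proof -
    have z: "0 \<le> fst z" "fst z \<le> 2 * pi" "0 \<le> snd z" "snd z \<le> 2 * pi"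
      using that(1) by (cases z; auto simp: cell_def mem_box Basis_prod_def)+
    show ?thesis using that(2)
    proof
      assume "d \<le> \<bar>fst z - x0\<bar>"
      then have "cos (fst z - x0) \<le> cos d" using d z by (intro cos_le_away) auto
      then have "(1 + cos (fst z - x0)) / 2 * ((1 + cos (snd z - y0)) / 2) \<le> \<rho> * 1"
        using half \<rho> by (intro mult_mono) (auto simp: \<rho>_def)
      then show ?thesis by (simp add: q_def)
    next
      assume "d \<le> \<bar>snd z - y0\<bar>"
      then have "cos (snd z - y0) \<le> cos d" using d z by (intro cos_le_away) auto
      then have "(1 + cos (fst z - x0)) / 2 * ((1 + cos (snd z - y0)) / 2) \<le> 1 * \<rho>"
        using half \<rho> by (intro mult_mono) (auto simp: \<rho>_def)
      then show ?thesis by (simp add: q_def)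
    qed
  qed
  \<comment> \<open>A level strictly between the bound \<open>\<rho>\<close> away from the peak and
    the peak value \<open>1\<close>, so that \<open>\<rho> / \<rho>'\<close> decays geometrically in
    \<open>n\<close>.\<close>
  define \<rho>' where "\<rho>' = (1 + \<rho>) / 2"
  have \<rho>': "\<rho> < \<rho>'" "0 < \<rho>'" "\<rho>' < 1" using \<rho> by (auto simp: \<rho>'_def)
  obtain e' where e': "e' > 0" "\<And>z. dist z z0 < e' \<Longrightarrow> q z > \<rho>'"
  proof -
    have "continuous_on UNIV q" unfolding q_def by (intro continuous_intros) auto
    moreover have "q z0 = 1" by (simp add: q_def z0_eq)
    ultimately obtain e' where "e' > 0" "\<forall>z. dist z z0 < e' \<longrightarrow> dist (q z) 1 < 1 - \<rho>'"
      unfolding continuous_on_iff using \<rho>' by (metis UNIV_I diff_gt_0_iff_gt)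
    moreover from this have "q z > \<rho>'" if "dist z z0 < e'" for z
    proof -
      have "\<bar>q z - 1\<bar> < 1 - \<rho>'" using calculation(2)[rule_format, OF that] by (simp add: dist_real_def)
      then show ?thesis by linarith
    qed
    ultimately show ?thesis using that by blast
  qed
  define b where "b = min (d / 2) (e' / 3)"
  have b: "0 < b" "b \<le> d / 2" "b \<le> e' / 3" using d e' by (auto simp: b_def)
  let ?S = "cbox (x0 - b, y0 - b) (x0 + b, y0 + b)"
  have dist_le: "dist z z0 \<le> \<bar>fst z - x0\<bar> + \<bar>snd z - y0\<bar>" for z
    using sqrt_sum_squares_le_sum_abs by (cases z) (auto simp: dist_Pair_Pair z0_eq dist_real_def)
  have S_mem: "\<bar>fst z - x0\<bar> \<le> b" "\<bar>snd z - y0\<bar> \<le> b" if "z \<in> ?S" for z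
    using that by (cases z; auto simp: mem_box Basis_prod_def)+
  have S_cell: "?S \<subseteq> cell"
    using b d by (auto simp: cell_def mem_box Basis_prod_def)
  obtain M where M: "\<And>z. z \<in> cell \<Longrightarrow> \<bar>w z\<bar> \<le> M"
  proof -
    have "bounded (w ` cell)"
      by (intro compact_imp_bounded compact_continuous_image cont) (simp add: cell_def)
    then show ?thesis using that by (auto simp: bounded_iff)
  qed
  have M0: "0 \<le> M" using M[OF z0c] by linarith
  have zero_n: "continuous_on cell (\<lambda>z. w z * q z ^ n) \<and>
      (\<forall>k. integral cell (\<lambda>z. complex_of_real (w z * q z ^ n) * trig k (fst z) (snd z)) = 0)" for n
  proof (induction n)
    case 0
    then show ?case using cont zero by simp
  next
    case (Suc n)
    let ?G = "\<lambda>z. w z * q z ^ n"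
    let ?H = "\<lambda>z. ?G z * (1 + cos (fst z - x0))"
    have cG: "continuous_on cell ?G" and zG: "\<And>k. integral cell (\<lambda>z. complex_of_real (?G z) * trig k (fst z) (snd z)) = 0"
      using Suc by auto
    have cH: "continuous_on cell ?H" by (rule continuous_on_mult[OF cG]) (intro continuous_intros)
    note zH = integral_trig_step(2)[OF cH integral_trig_step(1)[OF cG zG]]
    have eq: "w z * q z ^ Suc n = (1 / 4) * (?H z * (1 + cos (snd z - y0)))" for z
      by (simp add: q_def field_simps)
    show ?case
    proof (intro conjI allI)
      show "continuous_on cell (\<lambda>z. w z * q z ^ Suc n)"
        unfolding eq by (rule continuous_on_mult[OF continuous_on_const continuous_on_mult[OF cH]]) (intro continuous_intros)
      fix k
      have "integral cell (\<lambda>z. complex_of_real (w z * q z ^ Suc n) * trig k (fst z) (snd z))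
         = integral cell (\<lambda>z. complex_of_real (1/4) * (complex_of_real (?H z * (1 + cos (snd z - y0))) * trig k (fst z) (snd z)))"
        unfolding eq by (simp only: of_real_mult mult.assoc)
      also have "\<dots> = 0" by (simp only: integral_mult_right zH mult_zero_right)
      finally show "integral cell (\<lambda>z. complex_of_real (w z * q z ^ Suc n) * trig k (fst z) (snd z)) = 0" .
    qed
  qed
  \<comment> \<open>The integrand has integral zero, but it is at least
    \<open>a / 2 * \<rho>' ^ n\<close> on a square of area \<open>4 * b\<^sup>2\<close>, nonnegative
    elsewhere near the peak, and at least \<open>- (M * \<rho> ^ n)\<close> on the rest.\<close>
  have ineq: "a / 2 * \<rho>' ^ n * (4 * b\<^sup>2) \<le> M * \<rho> ^ n * (4 * pi\<^sup>2)" for n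
  proof -
    have c: "continuous_on cell (\<lambda>z. w z * q z ^ n)" using zero_n by blast
    have "(\<lambda>z. complex_of_real (w z * q z ^ n)) integrable_on cell"
      by (intro integrable_cell continuous_intros c)
    from integral_linear[OF this bounded_linear_Re]
    have "integral cell (\<lambda>z. w z * q z ^ n) = Re (integral cell (\<lambda>z. complex_of_real (w z * q z ^ n)))"
      by (simp add: o_def)
    also have "\<dots> = 0" using zero_n[of n] by (metis (no_types, lifting) integral_cong mult.right_neutral trig_zero zero_complex.simps(1))
    finally have 1: "((\<lambda>z. w z * q z ^ n) has_integral 0) cell"
      using integrable_cell[OF c] by (metis integrable_integral)
    have 2: "((\<lambda>z. (if z \<in> ?S then a / 2 * \<rho>' ^ n else 0) - M * \<rho> ^ n)
        has_integral (a / 2 * \<rho>' ^ n * (4 * b\<^sup>2) - M * \<rho> ^ n * (4 * pi\<^sup>2))) cell"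
    proof (rule has_integral_diff)
      have "((\<lambda>z. a / 2 * \<rho>' ^ n) has_integral measure lborel ?S *\<^sub>R (a / 2 * \<rho>' ^ n)) ?S"
        by (rule has_integral_const)
      moreover have "measure lborel ?S = 4 * b\<^sup>2"
        using b by (simp add: content_Pair power2_eq_square)
      ultimately show "((\<lambda>z. if z \<in> ?S then a / 2 * \<rho>' ^ n else 0) has_integral a / 2 * \<rho>' ^ n * (4 * b\<^sup>2)) cell"
        by (subst has_integral_restrict[OF S_cell]) (simp add: mult_ac)
      have "((\<lambda>z. M * \<rho> ^ n) has_integral measure lborel cell *\<^sub>R (M * \<rho> ^ n)) cell"
        unfolding cell_def by (rule has_integral_const)
      moreover have "measure lborel cell = 4 * pi\<^sup>2"
        by (simp add: cell_def content_Pair power2_eq_square)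
      ultimately show "((\<lambda>z. M * \<rho> ^ n) has_integral M * \<rho> ^ n * (4 * pi\<^sup>2)) cell"
        by (simp add: mult_ac)
    qed
    have "a / 2 * \<rho>' ^ n * (4 * b\<^sup>2) - M * \<rho> ^ n * (4 * pi\<^sup>2) \<le> 0"
    proof (rule has_integral_le[OF 2 1])
      fix z assume z: "z \<in> cell"
      show "(if z \<in> ?S then a / 2 * \<rho>' ^ n else 0) - M * \<rho> ^ n \<le> w z * q z ^ n"
      proof (cases "z \<in> ?S")
        case True
        note S_mem[OF True]
        then have *: "dist z z0 < e" "dist z z0 < e'"
          using dist_le[of z] b d e' e(1) by linarith+
        have "a / 2 * \<rho>' ^ n \<le> w z * q z ^ n"
          using e(2)[OF z *(1)] e'(2)[OF *(2)] a \<rho>' by (intro mult_mono power_mono) auto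
        then show ?thesis using True M0 \<rho> by (smt (verit) mult_nonneg_nonneg zero_le_power)
      next
        case False
        have "- (M * \<rho> ^ n) \<le> w z * q z ^ n"
        proof (cases "d \<le> \<bar>fst z - x0\<bar> \<or> d \<le> \<bar>snd z - y0\<bar>")
          case True
          have "\<bar>w z * q z ^ n\<bar> \<le> M * \<rho> ^ n"
            unfolding abs_mult using q_away[OF z True] M[OF z] M0 q0[of z]
            by (intro mult_mono) (auto intro: power_mono)
          then show ?thesis by linarith
        next
          case False
          then have "dist z z0 < e" using dist_le[of z] d by linarith
          then have "0 \<le> w z" using e(2)[OF z] a by fastforce
          then have "0 \<le> w z * q z ^ n" using q0 by simp
          then show ?thesis using M0 \<rho> by (smt (verit) mult_nonneg_nonneg zero_le_power)
        qed
        then show ?thesis using False by simp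
      qed
    qed
    then show ?thesis by simp
  qed
  have "\<rho> / \<rho>' < 1" using \<rho>' by simp
  moreover have "0 < a / 2 * (4 * b\<^sup>2) / (M * (4 * pi\<^sup>2) + 1)"
    using a b M0 by (auto intro!: divide_pos_pos add_nonneg_pos)
  ultimately obtain n where "(\<rho> / \<rho>') ^ n < a / 2 * (4 * b\<^sup>2) / (M * (4 * pi\<^sup>2) + 1)"
    using real_arch_pow_inv by blast
  then have "\<rho> ^ n * (M * (4 * pi\<^sup>2) + 1) < a / 2 * (4 * b\<^sup>2) * \<rho>' ^ n"
    using \<rho>' M0 by (simp add: power_divide pos_less_divide_eq add_nonneg_pos divide_less_eq mult_ac)
  moreover have "M * \<rho> ^ n * (4 * pi\<^sup>2) \<le> \<rho> ^ n * (M * (4 * pi\<^sup>2) + 1)"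
    using \<rho> by (simp add: algebra_simps)
  ultimately show False using ineq[of n] by (simp add: mult_ac)
qed

text \<open>Interior points follow from the bump argument for \<open>w\<close> and for
  \<open>- w\<close>; the boundary of the cell, where the periodic copies of a bump interfere,
  follows by continuity.\<close>

lemma fourier_unique_real:
  fixes w :: "real \<times> real \<Rightarrow> real"
  assumes cont: "continuous_on cell w"
    and zero: "\<And>k. integral cell (\<lambda>z. complex_of_real (w z) * trig k (fst z) (snd z)) = 0"
    and z: "z \<in> cell"
  shows "w z = 0"
proof -
  have ne: "box (0::real, 0::real) (2 * pi, 2 * pi) \<noteq> {}"
    by (auto simp: box_ne_empty Basis_prod_def)
  have "w z' = 0" if "z' \<in> box (0, 0) (2 * pi, 2 * pi)" for z'
  proof (rule antisym)
    show "w z' \<le> 0" using fourier_unique_interior[OF cont zero that] .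
    have c: "continuous_on cell (\<lambda>z. - w z)" by (intro continuous_intros cont)
    have "- w z' \<le> 0"
      by (rule fourier_unique_interior[OF c _ that]) (simp add: zero)
    then show "0 \<le> w z'" by simp
  qed
  then show ?thesis
    using continuous_constant_on_closure[of "box (0,0) (2 * pi, 2 * pi)" w 0 z] cont z ne
    by (simp add: cell_def closure_box)
qed

text \<open>The relations range over all frequencies, hence are stable under conjugation and pass to
  the real part. The imaginary part is the real part of \<open>- \<i> * w\<close>.\<close>

lemma fourier_unique:
  fixes w :: "real \<times> real \<Rightarrow> complex"
  assumes cont: "continuous_on cell w"
    and zero: "\<And>k. integral cell (\<lambda>z. w z * trig k (fst z) (snd z)) = 0"
    and z: "z \<in> cell"
  shows "w z = 0"
proof -
  have Re0: "Re (v z) = 0" if c: "continuous_on cell v"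
    and v: "\<And>k. integral cell (\<lambda>z. v z * trig k (fst z) (snd z)) = 0" for v
  proof (rule fourier_unique_real[OF _ _ z])
    show "continuous_on cell (\<lambda>z. Re (v z))" by (intro continuous_intros c)
    fix k
    have i1: "((\<lambda>z. v z * trig k (fst z) (snd z)) has_integral 0) cell" for k
    proof -
      have "(\<lambda>z. v z * trig k (fst z) (snd z)) integrable_on cell"
        by (intro integrable_cell continuous_intros c)
      then show ?thesis using v[of k] by (metis integrable_integral)
    qed
    have "cnj (integral cell (\<lambda>z. v z * trig (- k) (fst z) (snd z))) = integral cell (\<lambda>z. cnj (v z * trig (- k) (fst z) (snd z)))"
      by (rule integral_cnj)
    moreover have "cnj (trig (- k) x y) = trig k x y" for x y
      by (simp add: trig_def cis_cnj add.commute)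
    ultimately have "integral cell (\<lambda>z. cnj (v z) * trig k (fst z) (snd z)) = 0"
      by (simp add: v)
    moreover have "(\<lambda>z. cnj (v z) * trig k (fst z) (snd z)) integrable_on cell"
      by (intro integrable_cell continuous_intros c)
    ultimately have i2: "((\<lambda>z. cnj (v z) * trig k (fst z) (snd z)) has_integral 0) cell"
      by (metis integrable_integral)
    have "((\<lambda>z. (1/2) * (v z * trig k (fst z) (snd z) + cnj (v z) * trig k (fst z) (snd z))) has_integral (1/2) * (0 + 0)) cell"
      by (intro has_integral_mult_right has_integral_add i1 i2)
    moreover have "(1/2) * (v z * trig k (fst z) (snd z) + cnj (v z) * trig k (fst z) (snd z))
        = complex_of_real (Re (v z)) * trig k (fst z) (snd z)" for z
      by (simp add: complex_add_cnj flip: distrib_right)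
    ultimately show "integral cell (\<lambda>z. complex_of_real (Re (v z)) * trig k (fst z) (snd z)) = 0"
      by (simp add: integral_unique)
  qed
  have "Re (w z) = 0" by (rule Re0[OF cont zero])
  moreover have "Re (- \<i> * w z) = 0"
  proof (rule Re0[of "\<lambda>z. - \<i> * w z"])
    show "continuous_on cell (\<lambda>z. - \<i> * w z)" by (intro continuous_intros cont)
    show "integral cell (\<lambda>z. - \<i> * w z * trig k (fst z) (snd z)) = 0" for k
      unfolding mult.assoc integral_mult_right zero by simp
  qed
  ultimately show ?thesis by (simp add: complex_eq_iff)
qed

section \<open>Periodic extension and pointwise convergence of Fourier series\<close>

lemma periodic2_int:
  assumes "periodic2 v"
  shows "v (x + 2 * pi * real_of_int m) (y + 2 * pi * real_of_int n) = v x y"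
proof -
  have nx: "v (x + 2 * pi * real j) y = v x y" for x y j
  proof (induction j)
    case (Suc j)
    have "v (x + 2 * pi * real (Suc j)) y = v ((x + 2 * pi * real j) + 2 * pi) y"
      by (simp add: algebra_simps)
    also have "\<dots> = v (x + 2 * pi * real j) y" using assms by (simp only: periodic2_def)
    finally show ?case using Suc by simp
  qed simp
  have ny: "v x (y + 2 * pi * real j) = v x y" for x y j
  proof (induction j)
    case (Suc j)
    have "v x (y + 2 * pi * real (Suc j)) = v x ((y + 2 * pi * real j) + 2 * pi)"
      by (simp add: algebra_simps)
    also have "\<dots> = v x (y + 2 * pi * real j)" using assms by (simp only: periodic2_def)
    finally show ?case using Suc by simp
  qed simp
  have x: "v (x + 2 * pi * real_of_int m) y = v x y" for x y
  proof (cases m rule: int_cases2)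
    case (nonpos j)
    then show ?thesis using nx[of "x - 2 * pi * real j" j y] by simp
  qed (simp add: nx)
  have y: "v x (y + 2 * pi * real_of_int n) = v x y" for x y
  proof (cases n rule: int_cases2)
    case (nonpos j)
    then show ?thesis using ny[of x "y - 2 * pi * real j" j] by simp
  qed (simp add: ny)
  show ?thesis by (simp add: x y)
qed

lemma trig_periodic: "trig k (x + 2 * pi * real_of_int m) (y + 2 * pi * real_of_int n) = trig k x y"
proof -
  have "trig k (x + 2 * pi * real_of_int m) (y + 2 * pi * real_of_int n)
      = cis (real_of_int (fst k) * x + real_of_int (snd k) * y) * cis (2 * pi * real_of_int (fst k * m + snd k * n))"
    by (simp add: trig_def cis_mult algebra_simps)
  also have "cis (2 * pi * real_of_int (fst k * m + snd k * n)) = 1"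
    by (rule cis_multiple_2pi) (rule Ints_of_int)
  finally show ?thesis by (simp add: trig_def)
qed

lemma periodic_representative:
  fixes x :: real
  obtains m :: int and x' where "x = x' + 2 * pi * real_of_int m" "0 \<le> x'" "x' \<le> 2 * pi"
proof
  define m where "m = \<lfloor>x / (2 * pi)\<rfloor>"
  have "real_of_int m \<le> x / (2 * pi)" "x / (2 * pi) \<le> real_of_int m + 1"
    unfolding m_def by linarith+
  then show "0 \<le> x - 2 * pi * real_of_int m" "x - 2 * pi * real_of_int m \<le> 2 * pi"
    by (simp_all add: field_simps)
  show "x = (x - 2 * pi * real_of_int m) + 2 * pi * real_of_int m" by simp
qed

text \<open>Absolute convergence makes the sum \<open>S\<close> of the series continuous and permits
  termwise integration, so \<open>S\<close> has the coefficients of \<open>v\<close>. Uniqueness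
  identifies the two on the cell, periodicity elsewhere.\<close>

lemma fourier_series:
  assumes per: "periodic2 v"
    and cont: "continuous_on UNIV (\<lambda>z. v (fst z) (snd z))"
    and sum: "(\<lambda>k. cmod (fcoef v (fst k) (snd k))) summable_on UNIV"
  shows "fser (\<lambda>k. fcoef v (fst k) (snd k)) v"
proof -
  define c where "c k = fcoef v (fst k) (snd k)" for k
  have c_sum: "(\<lambda>k. cmod (c k)) summable_on UNIV" using sum by (simp add: c_def)
  define S where "S z = (\<Sum>\<^sub>\<infinity>k. c k * trig k (fst z) (snd z))" for z
  have hs: "((\<lambda>k. c k * trig k (fst z) (snd z)) has_sum S z) UNIV" for z
  proof -
    have "(\<lambda>k. c k * trig k (fst z) (snd z)) summable_on UNIV"
      by (rule abs_summable_summable) (simp add: norm_mult c_sum)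
    then show ?thesis unfolding S_def by (rule has_sum_infsum)
  qed
  have ul: "uniform_limit cell (\<lambda>F z. \<Sum>k\<in>F. c k * trig k (fst z) (snd z) * trig j (fst z) (snd z))
      (\<lambda>z. S z * trig j (fst z) (snd z)) (finite_subsets_at_top UNIV)" for j
  proof (rule Weierstrass_m_test_general'[OF _ _ c_sum])
    show "((\<lambda>k. c k * trig k (fst z) (snd z) * trig j (fst z) (snd z)) has_sum S z * trig j (fst z) (snd z)) UNIV" for z
      by (intro has_sum_cmult_left hs)
  qed (simp add: norm_mult)
  have contS: "continuous_on cell S"
  proof -
    have "continuous_on cell (\<lambda>z. S z * trig 0 (fst z) (snd z))"
      by (rule uniform_limit_theorem[OF _ ul[of 0]]) (auto intro!: always_eventually continuous_intros)
    then show ?thesis by simp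
  qed
  have contv: "continuous_on cell (\<lambda>z. v (fst z) (snd z))"
    using cont continuous_on_subset by blast
  \<comment> \<open>Testing with \<open>trig j\<close> selects the coefficient at
    \<open>- j\<close>, since \<open>fcoef\<close> integrates against the conjugate exponential. A
    partial sum containing that mode already has the limiting integral.\<close>
  have intS: "integral cell (\<lambda>z. S z * trig j (fst z) (snd z)) = of_real (4 * pi\<^sup>2) * c (- j)" for j
  proof -
    let ?f = "\<lambda>F z. \<Sum>k\<in>F. c k * trig k (fst z) (snd z) * trig j (fst z) (snd z)"
    have cf: "continuous_on (cbox (0, 0) (2 * pi, 2 * pi)) (?f F)" for F
      by (intro continuous_intros)
    obtain I J where I: "\<And>F. (?f F has_integral I F) cell"
      and J: "((\<lambda>z. S z * trig j (fst z) (snd z)) has_integral J) cell"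
      and IJ: "(I \<longlongrightarrow> J) (finite_subsets_at_top UNIV)"
      unfolding cell_def
      by (rule uniform_limit_integral_cbox[OF ul[of j, unfolded cell_def] cf finite_subsets_at_top_neq_bot]) blast
    have IF: "I F = of_real (4 * pi\<^sup>2) * c (- j)" if F: "finite F" "- j \<in> F" for F
    proof -
      have "I F = integral cell (?f F)" by (rule integral_unique[OF I, symmetric])
      also have "\<dots> = (\<Sum>k\<in>F. integral cell (\<lambda>z. c k * trig (k + j) (fst z) (snd z)))"
        unfolding mult.assoc trig_mult
        by (intro integral_sum F) (intro integrable_cell continuous_intros)
      also have "\<dots> = (\<Sum>k\<in>F. if k = - j then of_real (4 * pi\<^sup>2) * c k else 0)"
        unfolding integral_mult_right integral_trig
        by (intro sum.cong refl) (simp add: eq_neg_iff_add_eq_0)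
      also have "\<dots> = of_real (4 * pi\<^sup>2) * c (- j)"
        using F by (simp add: sum.delta)
      finally show ?thesis .
    qed
    have "eventually (\<lambda>F. I F = of_real (4 * pi\<^sup>2) * c (- j)) (finite_subsets_at_top UNIV)"
      unfolding eventually_finite_subsets_at_top
      by (intro exI[of _ "{- j}"]) (simp add: IF del: of_real_mult of_real_power)
    then have "(I \<longlongrightarrow> of_real (4 * pi\<^sup>2) * c (- j)) (finite_subsets_at_top UNIV)"
      by (rule tendsto_eventually)
    then have "J = of_real (4 * pi\<^sup>2) * c (- j)"
      using IJ tendsto_unique finite_subsets_at_top_neq_bot by blast
    with J show ?thesis by (simp add: integral_unique)
  qed
  have intv: "integral cell (\<lambda>z. complex_of_real (v (fst z) (snd z)) * trig j (fst z) (snd z))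
      = of_real (4 * pi\<^sup>2) * c (- j)" for j
    by (simp add: c_def fcoef_def trig_def add.commute)
  have eq: "complex_of_real (v (fst z) (snd z)) = S z" if "z \<in> cell" for z
  proof -
    have "complex_of_real (v (fst z) (snd z)) - S z = 0"
    proof (rule fourier_unique[OF _ _ that])
      show "continuous_on cell (\<lambda>z. complex_of_real (v (fst z) (snd z)) - S z)"
        by (intro continuous_intros contS contv)
      fix j
      have "integral cell (\<lambda>z. complex_of_real (v (fst z) (snd z)) * trig j (fst z) (snd z) - S z * trig j (fst z) (snd z)) = 0"
        by (subst integral_diff) (auto simp: intS intv intro!: integrable_cell continuous_intros contS contv)
      then show "integral cell (\<lambda>z. (complex_of_real (v (fst z) (snd z)) - S z) * trig j (fst z) (snd z)) = 0"
        by (simp add: left_diff_distrib)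
    qed
    then show ?thesis by simp
  qed
  have "((\<lambda>k. c k * trig k x y) has_sum complex_of_real (v x y)) UNIV" for x y
  proof -
    obtain m x' where x: "x = x' + 2 * pi * real_of_int m" "0 \<le> x'" "x' \<le> 2 * pi"
      by (rule periodic_representative)
    obtain n y' where y: "y = y' + 2 * pi * real_of_int n" "0 \<le> y'" "y' \<le> 2 * pi"
      by (rule periodic_representative)
    have "(x', y') \<in> cell" using x y by (auto simp: cell_def mem_box Basis_prod_def)
    from eq[OF this] hs[of "(x', y')"] show ?thesis
      unfolding x(1) y(1) periodic2_int[OF per] trig_periodic by simp
  qed
  then show ?thesis by (simp add: fser_def c_def)
qed

section \<open>Termwise differentiation and products\<close>

text \<open>An enumeration of the frequencies turns the unconditional sum into a series, to which
  termwise differentiation applies with the majorant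
  \<open>\<bar>real_of_int (fst k)\<bar> * cmod (c k)\<close>.\<close>

lemma trig_series_has_derivative_Re:
  assumes c0: "(\<lambda>k. cmod (c k)) summable_on UNIV"
    and c1: "(\<lambda>k. \<bar>real_of_int (fst k)\<bar> * cmod (c k)) summable_on UNIV"
  shows "((\<lambda>\<xi>. Re (\<Sum>\<^sub>\<infinity>k. c k * trig k \<xi> y)) has_real_derivative
           Re (\<Sum>\<^sub>\<infinity>k. \<i> * of_int (fst k) * c k * trig k x y)) (at x)"
proof -
  define b where "b = from_nat_into (UNIV :: (int \<times> int) set)"
  have b: "bij_betw b UNIV UNIV"
    unfolding b_def by (rule bij_betw_from_nat_into) (auto simp: finite_prod infinite_UNIV_int)
  define f where "f n \<xi> = Re (c (b n) * trig (b n) \<xi> y)" for n \<xi>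
  define f' where "f' n \<xi> = Re (\<i> * of_int (fst (b n)) * c (b n) * trig (b n) \<xi> y)" for n \<xi>
  have s0: "((\<lambda>k. c k * trig k \<xi> y) has_sum (\<Sum>\<^sub>\<infinity>k. c k * trig k \<xi> y)) UNIV" for \<xi>
    by (rule has_sum_infsum, rule abs_summable_summable) (simp add: norm_mult c0)
  have s1: "((\<lambda>k. \<i> * of_int (fst k) * c k * trig k \<xi> y) has_sum (\<Sum>\<^sub>\<infinity>k. \<i> * of_int (fst k) * c k * trig k \<xi> y)) UNIV" for \<xi>
    by (rule has_sum_infsum, rule abs_summable_summable) (simp add: norm_mult c1)
  have sums0: "(\<lambda>n. f n \<xi>) sums Re (\<Sum>\<^sub>\<infinity>k. c k * trig k \<xi> y)" for \<xi>
    unfolding f_def by (intro sums_Re has_sum_imp_sums)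
      (use has_sum_reindex_bij_betw[OF b, of "\<lambda>k. c k * trig k \<xi> y"] s0[of \<xi>] in simp)
  have sums1: "(\<lambda>n. f' n \<xi>) sums Re (\<Sum>\<^sub>\<infinity>k. \<i> * of_int (fst k) * c k * trig k \<xi> y)" for \<xi>
    unfolding f'_def by (intro sums_Re has_sum_imp_sums)
      (use has_sum_reindex_bij_betw[OF b, of "\<lambda>k. \<i> * of_int (fst k) * c k * trig k \<xi> y"] s1[of \<xi>] in simp)
  have der: "(f n has_field_derivative f' n \<xi>) (at \<xi> within UNIV)" for n \<xi>
  proof -
    have eq: "f n = (\<lambda>\<xi>. Re (c (b n)) * cos (real_of_int (fst (b n)) * \<xi> + real_of_int (snd (b n)) * y)
        - Im (c (b n)) * sin (real_of_int (fst (b n)) * \<xi> + real_of_int (snd (b n)) * y))"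
      by (simp add: f_def trig_def fun_eq_iff)
    show ?thesis unfolding eq f'_def
      by (auto intro!: derivative_eq_intros simp: trig_def algebra_simps)
  qed
  have "uniformly_convergent_on UNIV (\<lambda>n \<xi>. \<Sum>i<n. f' i \<xi>)"
  proof (rule Weierstrass_m_test')
    show "summable (\<lambda>n. \<bar>real_of_int (fst (b n))\<bar> * cmod (c (b n)))"
      using summable_on_reindex_bij_betw[OF b, of "\<lambda>k. \<bar>real_of_int (fst k)\<bar> * cmod (c k)"] c1
      by (intro summable_on_imp_summable) simp
    fix n \<xi>
    have "norm (f' n \<xi>) \<le> cmod (\<i> * of_int (fst (b n)) * c (b n) * trig (b n) \<xi> y)"
      unfolding f'_def real_norm_def by (rule abs_Re_le_cmod)
    then show "norm (f' n \<xi>) \<le> \<bar>real_of_int (fst (b n))\<bar> * cmod (c (b n))"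
      by (simp add: norm_mult)
  qed
  from has_field_derivative_series'(2)[OF convex_UNIV der this UNIV_I sums_summable[OF sums0]]
  have "((\<lambda>\<xi>. \<Sum>n. f n \<xi>) has_field_derivative (\<Sum>n. f' n x)) (at x)"
    by simp
  then show ?thesis
    using sums_unique[OF sums0] sums_unique[OF sums1] by simp
qed

text \<open>The weight \<open>1/2\<close> is exactly one derivative. The sequence \<open>c\<close>
  carries no symmetry of its own, so reality of the differentiated series has to be derived from
  reality of \<open>f\<close>.\<close>

lemma fser_dx:
  assumes f: "fser c f" and c: "wl1 (1/2) c K"
  shows "((\<lambda>\<xi>. f \<xi> y) has_real_derivative deriv (\<lambda>\<xi>. f \<xi> y) x) (at x)"
    and "fser (\<lambda>k. \<i> * of_int (fst k) * c k) (\<lambda>x y. deriv (\<lambda>\<xi>. f \<xi> y) x)"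
proof -
  have c0: "(\<lambda>k. cmod (c k)) summable_on UNIV"
    by (rule wl1_abs_summable[OF c]) simp
  have c1: "(\<lambda>k. \<bar>real_of_int (fst k)\<bar> * cmod (c k)) summable_on UNIV"
    by (rule summable_on_comparison_test[OF wl1_summable[OF c]])
       (auto intro!: mult_right_mono abs_freq_le)
  define g where "g x y = (\<Sum>\<^sub>\<infinity>k. \<i> * of_int (fst k) * c k * trig k x y)" for x y
  have g: "((\<lambda>k. \<i> * of_int (fst k) * c k * trig k x y) has_sum g x y) UNIV" for x y
    unfolding g_def by (rule has_sum_infsum, rule abs_summable_summable) (simp add: norm_mult c1)
  have fs: "(\<Sum>\<^sub>\<infinity>k. c k * trig k x y) = complex_of_real (f x y)" for x y
    using f by (simp add: fser_def infsumI)
  have D: "((\<lambda>\<xi>. f \<xi> y) has_real_derivative Re (g x y)) (at x)" for x y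
    using trig_series_has_derivative_Re[OF c0 c1, of y x] by (simp add: fs g_def)
  \<comment> \<open>The differentiation lemma for \<open>- \<i> * c\<close>: the real part of that
    series vanishes identically because \<open>f\<close> is real, and its derivative is
    \<open>Im (g x y)\<close>.\<close>
  have "Im (g x y) = 0" for x y
  proof -
    have "(\<Sum>\<^sub>\<infinity>k. - \<i> * c k * trig k x y) = - \<i> * complex_of_real (f x y)" for x y
      using fs[of x y] by (simp add: mult.assoc infsum_cmult_right' infsum_uminus)
    moreover have "(\<Sum>\<^sub>\<infinity>k. \<i> * of_int (fst k) * (- \<i> * c k) * trig k x y) = - \<i> * g x y"
    proof -
      have "((\<lambda>k. - \<i> * (\<i> * of_int (fst k) * c k * trig k x y)) has_sum - \<i> * g x y) UNIV"
        by (intro has_sum_cmult_right g)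
      then show ?thesis by (intro infsumI) (simp add: mult_ac)
    qed
    moreover have "((\<lambda>\<xi>. Re (\<Sum>\<^sub>\<infinity>k. - \<i> * c k * trig k \<xi> y)) has_real_derivative
           Re (\<Sum>\<^sub>\<infinity>k. \<i> * of_int (fst k) * (- \<i> * c k) * trig k x y)) (at x)"
      by (rule trig_series_has_derivative_Re) (simp_all add: norm_mult c0 c1)
    ultimately have "((\<lambda>\<xi>. 0) has_real_derivative Im (g x y)) (at x)" by simp
    then show ?thesis by (metis DERIV_const DERIV_unique)
  qed
  then have g_real: "g x y = complex_of_real (deriv (\<lambda>\<xi>. f \<xi> y) x)" for x y
    using DERIV_imp_deriv[OF D[of y x]] by (simp add: complex_eq_iff)
  show "((\<lambda>\<xi>. f \<xi> y) has_real_derivative deriv (\<lambda>\<xi>. f \<xi> y) x) (at x)"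
    using D[of y x] g_real[of x y] by simp
  show "fser (\<lambda>k. \<i> * of_int (fst k) * c k) (\<lambda>x y. deriv (\<lambda>\<xi>. f \<xi> y) x)"
    using g g_real by (simp add: fser_def)
qed

lemma jw_swap: "jw (prod.swap k) = jw k"
  by (simp add: jw_def)

lemma fser_swap: "fser c f \<Longrightarrow> fser (\<lambda>k. c (prod.swap k)) (\<lambda>x y. f y x)"
  unfolding fser_def
proof (intro allI)
  fix x y
  assume "\<forall>x y. ((\<lambda>k. c k * trig k x y) has_sum complex_of_real (f x y)) UNIV"
  then have "((\<lambda>k. c k * trig k y x) has_sum complex_of_real (f y x)) UNIV" by blast
  moreover have "bij_betw prod.swap (UNIV :: (int \<times> int) set) UNIV" by simp
  ultimately have "((\<lambda>k. c (prod.swap k) * trig (prod.swap k) y x) has_sum complex_of_real (f y x)) UNIV"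
    using has_sum_reindex_bij_betw[of prod.swap UNIV UNIV "\<lambda>k. c k * trig k y x"] by simp
  then show "((\<lambda>k. c (prod.swap k) * trig k x y) has_sum complex_of_real (f y x)) UNIV"
    by (simp add: trig_def add.commute)
qed

lemma wl1_swap: "wl1 r c K \<Longrightarrow> wl1 r (\<lambda>k. c (prod.swap k)) K"
  unfolding wl1_def
proof (intro allI impI)
  fix F :: "(int \<times> int) set"
  assume *: "\<forall>F. finite F \<longrightarrow> (\<Sum>k\<in>F. jw k powr r * cmod (c k)) \<le> K" "finite F"
  have "(\<Sum>k\<in>F. jw k powr r * cmod (c (prod.swap k))) = (\<Sum>k\<in>prod.swap ` F. jw k powr r * cmod (c k))"
    by (subst sum.reindex) (auto simp: jw_swap)
  then show "(\<Sum>k\<in>F. jw k powr r * cmod (c (prod.swap k))) \<le> K" using * by simp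
qed

lemma fser_dy:
  assumes f: "fser c f" and c: "wl1 (1/2) c K"
  shows "((\<lambda>\<eta>. f x \<eta>) has_real_derivative deriv (\<lambda>\<eta>. f x \<eta>) y) (at y)"
    and "fser (\<lambda>k. \<i> * of_int (snd k) * c k) (\<lambda>x y. deriv (\<lambda>\<eta>. f x \<eta>) y)"
  using fser_dx(1)[OF fser_swap[OF f] wl1_swap[OF c], of x y]
    fser_swap[OF fser_dx(2)[OF fser_swap[OF f] wl1_swap[OF c]]] by simp_all

section \<open>Sums, products and powers of Fourier series\<close>

lemma fser_add: "fser a f \<Longrightarrow> fser b g \<Longrightarrow> fser (\<lambda>k. a k + b k) (\<lambda>x y. f x y + g x y)"
  by (simp add: fser_def distrib_right has_sum_add)

lemma fser_cmult: "fser c f \<Longrightarrow> fser (\<lambda>k. of_real r * c k) (\<lambda>x y. r * f x y)"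
  by (simp add: fser_def mult.assoc has_sum_cmult_right)

lemma fser_bound: "fser c f \<Longrightarrow> wl1 0 c K \<Longrightarrow> \<bar>f x y\<bar> \<le> K"
  using wl1_has_sum_bound[of c K "\<lambda>k. trig k x y" "complex_of_real (f x y)"] by (simp add: fser_def)

text \<open>A Peetre-type inequality; it makes the weighted absolutely summable sequences an algebra
  under convolution. The factor \<open>2\<close> stems from expanding the square of a sum and
  reappears as \<open>2 powr r\<close> in \<open>fser_mult\<close>.\<close>

lemma jw_add_le: "jw (j + l) \<le> 2 * (jw j * jw l)"
proof -
  obtain a b c d where [simp]: "j = (a, b)" "l = (c, d)" by (metis prod.exhaust)
  have *: "(u + v)\<^sup>2 \<le> 2 * u\<^sup>2 + 2 * v\<^sup>2" for u v :: real
    using sum_squares_bound[of u v] by (simp add: power2_sum)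
  have "jw (j + l) \<le> 2 * (1 + (real_of_int a)\<^sup>2 + (real_of_int b)\<^sup>2 + ((real_of_int c)\<^sup>2 + (real_of_int d)\<^sup>2))"
    using *[of a c] *[of b d] by (simp add: jw_def)
  also have "\<dots> \<le> 2 * (jw j * jw l)"
    by (simp add: jw_def algebra_simps)
  finally show ?thesis .
qed

lemma wl1_product_bound:
  assumes "wl1 r a A" "wl1 r b B"
  shows "infsum (\<lambda>z. jw (fst z) powr r * cmod (a (fst z)) * (jw (snd z) powr r * cmod (b (snd z)))) UNIV \<le> A * B"
    and "(\<lambda>z. jw (fst z) powr r * cmod (a (fst z)) * (jw (snd z) powr r * cmod (b (snd z)))) summable_on UNIV"
proof -
  show *: "(\<lambda>z. jw (fst z) powr r * cmod (a (fst z)) * (jw (snd z) powr r * cmod (b (snd z)))) summable_on UNIV"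
    by (rule summable_on_prod_nonneg[OF wl1_summable[OF assms(1)] wl1_summable[OF assms(2)]]) auto
  show "infsum (\<lambda>z. jw (fst z) powr r * cmod (a (fst z)) * (jw (snd z) powr r * cmod (b (snd z)))) UNIV \<le> A * B"
  proof (rule infsum_le_finite_sums[OF *])
    fix F :: "((int \<times> int) \<times> (int \<times> int)) set" assume F: "finite F"
    have "(\<Sum>z\<in>F. jw (fst z) powr r * cmod (a (fst z)) * (jw (snd z) powr r * cmod (b (snd z))))
      \<le> (\<Sum>z\<in>fst ` F \<times> snd ` F. jw (fst z) powr r * cmod (a (fst z)) * (jw (snd z) powr r * cmod (b (snd z))))"
      using F by (intro sum_mono2) (auto simp: image_iff, force+)
    also have "\<dots> = (\<Sum>j\<in>fst ` F. jw j powr r * cmod (a j)) * (\<Sum>l\<in>snd ` F. jw l powr r * cmod (b l))"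
      by (simp add: sum_product sum.cartesian_product case_prod_unfold)
    also have "\<dots> \<le> A * B"
      using F assms wl1_nonneg[OF assms(1)] by (intro mult_mono) (auto simp: wl1_def intro: sum_nonneg)
    finally show "(\<Sum>z\<in>F. jw (fst z) powr r * cmod (a (fst z)) * (jw (snd z) powr r * cmod (b (snd z)))) \<le> A * B" .
  qed
qed

text \<open>Multiplication becomes convolution. Joint summability over all pairs of frequencies,
  weighted as in \<open>G\<close>, justifies regrouping by the total frequency and bounds the result
  at the same time.\<close>

lemma fser_mult:
  assumes f: "fser a f" "wl1 r a A" and g: "fser b g" "wl1 r b B" and r: "0 \<le> r"
  obtains c where "fser c (\<lambda>x y. f x y * g x y)" "wl1 r c (2 powr r * A * B)"
proof -
  define G where "G z = jw (fst z) powr r * cmod (a (fst z)) * (jw (snd z) powr r * cmod (b (snd z)))" for z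
  have G: "G summable_on UNIV" "infsum G UNIV \<le> A * B"
    unfolding G_def using wl1_product_bound[OF f(2) g(2)] by auto
  \<comment> \<open>\<open>\<phi>\<close> sends (total frequency, first frequency) to the pair of
    frequencies, so that inner sums run along the diagonals of the convolution.\<close>
  define \<phi> where "\<phi> z = (snd z, fst z - snd z)" for z :: "(int \<times> int) \<times> (int \<times> int)"
  have \<phi>: "bij_betw \<phi> UNIV UNIV"
    by (rule bij_betw_byWitness[where f' = "\<lambda>z. (fst z + snd z, fst z)"]) (auto simp: \<phi>_def)
  define c where "c k = (\<Sum>\<^sub>\<infinity>j. a j * b (k - j))" for k
  have one: "1 \<le> jw k powr r" for k using jw_ge_1 r by (simp add: ge_one_powr_ge_zero)
  have le_G: "cmod (a (fst z)) * cmod (b (snd z)) \<le> G z" for z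
  proof -
    have "1 * cmod (a (fst z)) * (1 * cmod (b (snd z))) \<le> G z"
      unfolding G_def using one by (intro mult_mono) auto
    then show ?thesis by simp
  qed
  have abs: "(\<lambda>z. cmod (a (fst z) * b (snd z))) summable_on UNIV"
    by (rule summable_on_comparison_test[OF G(1)]) (auto simp: norm_mult le_G)
  have abs': "(\<lambda>z. cmod (a (snd z) * b (fst z - snd z))) summable_on UNIV"
    using summable_on_reindex_bij_betw[OF \<phi>, of "\<lambda>z. cmod (a (fst z) * b (snd z))"] abs by (simp add: \<phi>_def)
  have c: "((\<lambda>j. a j * b (k - j)) has_sum c k) UNIV" for k
  proof -
    have "(\<lambda>(k, j). a j * b (k - j)) summable_on (UNIV \<times> UNIV)"
      using abs_summable_summable[OF abs'] by (simp add: case_prod_unfold)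
    from summable_on_SigmaD1[OF this UNIV_I] show ?thesis
      unfolding c_def by (rule has_sum_infsum)
  qed
  have "fser c (\<lambda>x y. f x y * g x y)"
    unfolding fser_def
  proof (intro allI)
    fix x y
    have 1: "((\<lambda>z. (a (fst z) * trig (fst z) x y) * (b (snd z) * trig (snd z) x y)) has_sum
        complex_of_real (f x y) * complex_of_real (g x y)) (UNIV \<times> UNIV)"
    proof (rule has_sum_SigmaI)
      show "((\<lambda>l. (a (fst (j, l)) * trig (fst (j, l)) x y) * (b (snd (j, l)) * trig (snd (j, l)) x y)) has_sum
         a j * trig j x y * complex_of_real (g x y)) UNIV" for j
        using g(1) by (auto simp: fser_def intro!: has_sum_cmult_right)
      show "((\<lambda>j. a j * trig j x y * complex_of_real (g x y)) has_sum complex_of_real (f x y) * complex_of_real (g x y)) UNIV"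
        using f(1) by (intro has_sum_cmult_left) (simp add: fser_def)
      show "(\<lambda>z. (a (fst z) * trig (fst z) x y) * (b (snd z) * trig (snd z) x y)) summable_on (UNIV \<times> UNIV)"
        by (rule abs_summable_summable) (use abs in \<open>simp add: norm_mult\<close>)
    qed
    have "((\<lambda>z. (a (fst (\<phi> z)) * trig (fst (\<phi> z)) x y) * (b (snd (\<phi> z)) * trig (snd (\<phi> z)) x y)) has_sum
        complex_of_real (f x y) * complex_of_real (g x y)) UNIV"
      using has_sum_reindex_bij_betw[OF \<phi>, of "\<lambda>z. (a (fst z) * trig (fst z) x y) * (b (snd z) * trig (snd z) x y)"] 1 by simp
    moreover have "(a (fst (\<phi> z)) * trig (fst (\<phi> z)) x y) * (b (snd (\<phi> z)) * trig (snd (\<phi> z)) x y)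
        = a (snd z) * b (fst z - snd z) * trig (fst z) x y" for z
      using trig_mult[of "snd z" x y "fst z - snd z"] by (simp add: \<phi>_def mult_ac)
    ultimately have 2: "((\<lambda>z. a (snd z) * b (fst z - snd z) * trig (fst z) x y) has_sum
        complex_of_real (f x y) * complex_of_real (g x y)) (UNIV \<times> UNIV)" by simp
    have "((\<lambda>k. c k * trig k x y) has_sum complex_of_real (f x y) * complex_of_real (g x y)) UNIV"
      by (rule has_sum_SigmaD[OF 2]) (auto intro!: has_sum_cmult_left c)
    then show "((\<lambda>k. c k * trig k x y) has_sum complex_of_real (f x y * g x y)) UNIV" by simp
  qed
  moreover have "wl1 r c (2 powr r * A * B)"
    unfolding wl1_def
  proof (intro allI impI)
    fix F :: "(int \<times> int) set" assume F: "finite F"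
    define H where "H k = (\<Sum>\<^sub>\<infinity>j. G (j, k - j))" for k
    have G': "((\<lambda>z. G (\<phi> z)) has_sum infsum G UNIV) (UNIV \<times> UNIV)"
      using has_sum_reindex_bij_betw[OF \<phi>, of G] G(1) by simp
    have Hk: "((\<lambda>j. G (j, k - j)) has_sum H k) UNIV" for k
    proof -
      have "(\<lambda>(k, j). G (j, k - j)) summable_on (UNIV \<times> UNIV)"
        using has_sum_imp_summable[OF G'] by (simp add: case_prod_unfold \<phi>_def)
      from summable_on_SigmaD1[OF this UNIV_I] show ?thesis
        unfolding H_def by (rule has_sum_infsum)
    qed
    \<comment> \<open>The diagonal sums of \<open>G\<close> have the same total as \<open>G\<close>,
      and \<open>2 powr r * H k\<close> dominates the weighted convolution at
      \<open>k\<close>.\<close>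
    have H: "(H has_sum infsum G UNIV) UNIV"
      by (rule has_sum_SigmaD[OF G']) (use Hk in \<open>simp add: \<phi>_def\<close>)
    have G0: "0 \<le> G z" for z by (simp add: G_def)
    have H0: "0 \<le> H k" for k unfolding H_def by (intro infsum_nonneg G0)
    have "jw k powr r * cmod (c k) \<le> 2 powr r * H k" for k
    proof -
      have "cmod (of_real (jw k powr r) * c k) \<le> 2 powr r * H k"
      proof (rule norm_infsum_le)
        show "((\<lambda>j. of_real (jw k powr r) * (a j * b (k - j))) has_sum of_real (jw k powr r) * c k) UNIV"
          by (intro has_sum_cmult_right c)
        show "((\<lambda>j. 2 powr r * G (j, k - j)) has_sum 2 powr r * H k) UNIV"
          by (intro has_sum_cmult_right Hk)
        fix j
        have "jw k \<le> 2 * (jw j * jw (k - j))" using jw_add_le[of j "k - j"] by simp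
        then have "jw k powr r \<le> (2 * (jw j * jw (k - j))) powr r"
          using r by (intro powr_mono2) (auto simp: less_imp_le)
        also have "\<dots> = 2 powr r * (jw j powr r * jw (k - j) powr r)"
          by (simp add: powr_mult less_imp_le)
        finally have "jw k powr r * (cmod (a j) * cmod (b (k - j)))
           \<le> 2 powr r * (jw j powr r * jw (k - j) powr r) * (cmod (a j) * cmod (b (k - j)))"
          by (intro mult_right_mono) auto
        then show "cmod (of_real (jw k powr r) * (a j * b (k - j))) \<le> 2 powr r * G (j, k - j)"
          by (simp add: norm_mult G_def mult_ac)
      qed
      then show ?thesis by (simp add: norm_mult)
    qed
    then have "(\<Sum>k\<in>F. jw k powr r * cmod (c k)) \<le> (\<Sum>k\<in>F. 2 powr r * H k)"
      by (rule sum_mono)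
    also have "\<dots> \<le> 2 powr r * infsum G UNIV"
      unfolding sum_distrib_left[symmetric]
      by (intro mult_left_mono finite_sum_le_has_sum[OF H F]) (auto simp: H0)
    also have "\<dots> \<le> 2 powr r * (A * B)" using G(2) by (intro mult_left_mono) auto
    finally show "(\<Sum>k\<in>F. jw k powr r * cmod (c k)) \<le> 2 powr r * A * B" by (simp add: mult.assoc)
  qed
  ultimately show ?thesis using that by blast
qed

text \<open>Starting at exponent one makes \<open>f\<close> itself the base case; the exponents used
  later are \<open>p\<close> and \<open>p + 1\<close> with \<open>p\<close> positive.\<close>

lemma fser_power:
  assumes f: "fser a f" "wl1 r a A" and r: "0 \<le> r"
  obtains c C where "fser c (\<lambda>x y. f x y ^ Suc n)" "wl1 r c C"
proof -
  have "\<exists>c C. fser c (\<lambda>x y. f x y ^ Suc n) \<and> wl1 r c C"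
  proof (induction n)
    case 0
    then show ?case using f by auto
  next
    case (Suc n)
    then obtain c C where c: "fser c (\<lambda>x y. f x y ^ Suc n)" "wl1 r c C" by blast
    show ?case
    proof (rule fser_mult[OF f c r])
      fix d assume "fser d (\<lambda>x y. f x y * f x y ^ Suc n)" "wl1 r d (2 powr r * A * C)"
      then show ?thesis by auto
    qed
  qed
  then show ?thesis using that by blast
qed

section \<open>Symbols of the difference operators\<close>

lemma has_sum_finite_sum:
  fixes f :: "'a \<Rightarrow> 'b \<Rightarrow> 'c :: topological_comm_monoid_add"
  assumes "finite J" "\<And>j. j \<in> J \<Longrightarrow> (f j has_sum s j) A"
  shows "((\<lambda>k. \<Sum>j\<in>J. f j k) has_sum (\<Sum>j\<in>J. s j)) A"
  using assms by (induction J) (auto intro!: has_sum_add)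

lemma cis_grid_dvd:
  assumes "N > 0" "int N dvd d"
  shows "cis (real_of_int d * (real j * hstep N)) = 1"
proof -
  obtain q where q: "d = int N * q" using assms(2) by blast
  have "real_of_int d * (real j * hstep N) = 2 * pi * real_of_int (q * int j)"
    using assms(1) by (simp add: q hstep_def)
  then show ?thesis by (simp only:) (rule cis_multiple_2pi, rule Ints_of_int)
qed

lemma cis_grid_cong:
  assumes "N > 0" "int N dvd l - m"
  shows "cis (real_of_int l * (real j * hstep N)) = cis (real_of_int m * (real j * hstep N))"
proof -
  have "cis (real_of_int l * (real j * hstep N))
      = cis (real_of_int m * (real j * hstep N)) * cis (real_of_int (l - m) * (real j * hstep N))"
    by (simp add: cis_mult algebra_simps)
  then show ?thesis using cis_grid_dvd[OF assms] by simp
qed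

lemma sum_cis_grid:
  assumes N: "N > 0"
  shows "(\<Sum>j<N. cis (real_of_int m * (real j * hstep N))) = (if int N dvd m then of_nat N else 0)"
proof (cases "int N dvd m")
  case True
  then show ?thesis using cis_grid_dvd[OF N True] by simp
next
  case False
  define z where "z = cis (real_of_int m * hstep N)"
  have pow: "cis (real_of_int m * (real j * hstep N)) = z ^ j" for j
    unfolding z_def Complex.DeMoivre by (rule arg_cong[of _ _ cis]) simp
  have "z ^ N = cis (2 * pi * real_of_int m)"
    unfolding z_def Complex.DeMoivre by (rule arg_cong[of _ _ cis]) (use N in \<open>simp add: hstep_def\<close>)
  also have "\<dots> = 1" by (rule cis_multiple_2pi) (rule Ints_of_int)
  finally have "z ^ N = 1" .
  moreover have "z \<noteq> 1"
  proof
    assume "z = 1"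
    then have "cos (real_of_int m * hstep N) = 1" by (simp add: z_def complex_eq_iff)
    then obtain q :: int where "real_of_int m * hstep N = real_of_int q * 2 * pi"
      using cos_one_2pi_int by blast
    then have "real_of_int m = real_of_int (int N * q)"
      using N by (simp add: hstep_def field_simps)
    then show False using False by (metis dvd_triv_left of_int_eq_iff)
  qed
  ultimately show ?thesis
    unfolding pow using False geometric_sum[of z N] by simp
qed

text \<open>The eigenvalue of \<open>Dmat N s\<close> on the mode \<open>m\<close>: both \<open>l = N / 2\<close> and \<open>l = - N / 2\<close> contribute with weight
  one half when \<open>m\<close> is congruent to \<open>N / 2\<close>, so it vanishes there for odd \<open>s\<close>.\<close>

definition lam :: "nat \<Rightarrow> nat \<Rightarrow> int \<Rightarrow> complex" where
  "lam N s m = (\<Sum>l | l \<in> {- (int N div 2)..int N div 2} \<and> int N dvd m - l.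
     complex_of_real (1 / a_coef N l) * (\<i> * of_int l) ^ s)"

text \<open>The index range and \<open>a_coef\<close> are symmetric, and negating \<open>l\<close>
  conjugates each summand; hence the real part taken in \<open>Dmat\<close> discards
  nothing.\<close>

lemma complex_of_real_Dmat:
  "complex_of_real (Dmat N s j k) = (1 / of_nat N) * (\<Sum>l\<in>{- (int N div 2) .. int N div 2}.
       complex_of_real (1 / a_coef N l) * (\<i> * of_int l) ^ s
       * cis (real_of_int l * (real j * hstep N - real k * hstep N)))" (is "_ = ?X")
proof -
  have "cnj ?X = ?X"
    unfolding complex_cnj_mult cnj_sum
    by (rule arg_cong2[of _ _ _ _ "(*)"], simp, rule sum.reindex_bij_witness[of _ uminus uminus])
       (auto simp: a_coef_def cis_cnj)
  then have "?X \<in> \<real>" unfolding Reals_cnj_iff .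
  then have "complex_of_real (Re ?X) = ?X" by (rule of_real_Re)
  then show ?thesis unfolding Dmat_def .
qed

text \<open>Negating \<open>l\<close> exchanges the two grid points at the price of the sign of
  \<open>(\<i> * of_int l) ^ s\<close>. All symmetry and skew-symmetry in the energy estimate comes
  from here.\<close>

lemma Dmat_transpose: "Dmat N s k j = (- 1) ^ s * Dmat N s j k"
proof -
  let ?I = "{- (int N div 2)..int N div 2}"
  define t where "t j k l = complex_of_real (1 / a_coef N l) * (\<i> * of_int l) ^ s
       * cis (real_of_int l * (real j * hstep N - real k * hstep N))" for j k l
  have D: "complex_of_real (Dmat N s j k) = (1 / of_nat N) * (\<Sum>l\<in>?I. t j k l)" for j k
    unfolding t_def by (rule complex_of_real_Dmat)
  have t: "(- 1) ^ s * t j k (- l) = t k j l" for l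
  proof -
    have "(- 1) ^ s * t j k (- l) = complex_of_real (1 / a_coef N (- l)) * ((- 1) ^ s * (\<i> * of_int (- l)) ^ s)
       * cis (real_of_int (- l) * (real j * hstep N - real k * hstep N))"
      unfolding t_def by (simp only: mult_ac)
    moreover have "(- 1) ^ s * (\<i> * complex_of_int (- l)) ^ s = (\<i> * complex_of_int l) ^ s"
      unfolding power_mult_distrib[symmetric] by simp
    moreover have "real_of_int (- l) * (real j * hstep N - real k * hstep N) = real_of_int l * (real k * hstep N - real j * hstep N)"
      by (simp add: algebra_simps)
    moreover have "a_coef N (- l) = a_coef N l" by (simp add: a_coef_def)
    ultimately show ?thesis unfolding t_def[of k j] by (simp only:)
  qed
  have "(\<Sum>l\<in>?I. t k j l) = (\<Sum>l\<in>?I. (- 1) ^ s * t j k l)"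
    by (rule sum.reindex_bij_witness[of _ uminus uminus]) (auto simp: t)
  then have "complex_of_real (Dmat N s k j) = complex_of_real ((- 1) ^ s * Dmat N s j k)"
    unfolding of_real_mult D by (simp add: sum_distrib_left mult_ac)
  then show ?thesis by (simp only: of_real_eq_iff)
qed

text \<open>Valid for every integer \<open>m\<close>, resolved or not: summation over the grid keeps
  the \<open>l\<close> congruent to \<open>m\<close>, and these give the same exponential on the
  grid.\<close>

lemma Dmat_eigen:
  assumes N: "N > 0"
  shows "(\<Sum>k<N. complex_of_real (Dmat N s j k) * cis (real_of_int m * (real k * hstep N)))
       = lam N s m * cis (real_of_int m * (real j * hstep N))"
proof -
  let ?I = "{- (int N div 2)..int N div 2}"
  let ?\<alpha> = "\<lambda>l. complex_of_real (1 / a_coef N l) * (\<i> * of_int l) ^ s"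
  have "(\<Sum>k<N. complex_of_real (Dmat N s j k) * cis (real_of_int m * (real k * hstep N)))
      = (\<Sum>k<N. \<Sum>l\<in>?I. (1 / of_nat N) * ?\<alpha> l * (cis (real_of_int l * (real j * hstep N))
            * cis (real_of_int (m - l) * (real k * hstep N))))"
    unfolding complex_of_real_Dmat sum_distrib_left sum_distrib_right
    by (intro sum.cong refl) (simp add: mult.assoc cis_mult, simp add: algebra_simps)
  also have "\<dots> = (\<Sum>l\<in>?I. (1 / of_nat N) * ?\<alpha> l * (cis (real_of_int l * (real j * hstep N))
            * (\<Sum>k<N. cis (real_of_int (m - l) * (real k * hstep N)))))"
    by (subst sum.swap) (simp only: sum_distrib_left)
  also have "\<dots> = (\<Sum>l\<in>?I. if int N dvd m - l then ?\<alpha> l * cis (real_of_int m * (real j * hstep N)) else 0)"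
    unfolding sum_cis_grid[OF N]
    using N cis_grid_cong[OF N, of m _ j] by (intro sum.cong refl) auto
  also have "\<dots> = lam N s m * cis (real_of_int m * (real j * hstep N))"
    unfolding lam_def sum_distrib_right by (intro sum.mono_neutral_cong_right) auto
  finally show ?thesis .
qed

lemma lam_cong: "int N dvd m - m' \<Longrightarrow> lam N s m = lam N s m'"
proof -
  assume d: "int N dvd m - m'"
  have "int N dvd m - l \<longleftrightarrow> int N dvd m' - l" for l
  proof -
    have "m - l = (m - m') + (m' - l)" by simp
    then show ?thesis using d by (metis dvd_add_right_iff)
  qed
  then show ?thesis by (simp add: lam_def)
qed

text \<open>In the strict range \<open>m\<close> is the only admissible representative of its class,
  so differentiation is exact; at \<open>N / 2\<close> both ends of the range would
  contribute.\<close>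

lemma lam_exact:
  assumes "even N" "2 * \<bar>m\<bar> < int N"
  shows "lam N s m = (\<i> * of_int m) ^ s"
proof -
  have "{l. l \<in> {- (int N div 2)..int N div 2} \<and> int N dvd m - l} = {m}"
  proof (intro equalityI subsetI)
    fix l assume "l \<in> {l. l \<in> {- (int N div 2)..int N div 2} \<and> int N dvd m - l}"
    then have l: "- (int N div 2) \<le> l" "l \<le> int N div 2" "int N dvd m - l" by auto
    have "\<bar>m - l\<bar> < int N" using assms l by linarith
    then have "m - l = 0" using l(3) dvd_imp_le_int[of "m - l" "int N"] by (cases "m - l = 0") auto
    then show "l \<in> {m}" by simp
  qed (use assms in auto)
  moreover have "a_coef N m = 1" using assms by (auto simp: a_coef_def)
  ultimately show ?thesis by (simp add: lam_def)
qed

lemma lam_half: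
  assumes "even N" "N > 0"
  shows "lam N s (- (int N div 2)) = ((\<i> * of_int (int N div 2)) ^ s + (\<i> * of_int (- (int N div 2))) ^ s) / 2"
proof -
  define n where "n = int N div 2"
  have N: "int N = 2 * n" "n > 0" using assms by (auto simp: n_def)
  have "{l. l \<in> {- n..n} \<and> 2 * n dvd - n - l} = {n, - n}"
  proof (intro equalityI subsetI)
    fix l assume "l \<in> {l. l \<in> {- n..n} \<and> 2 * n dvd - n - l}"
    then have l: "- n \<le> l" "l \<le> n" "2 * n dvd - n - l" by auto
    then obtain q where q: "- n - l = 2 * n * q" by blast
    have "n * (2 * q) \<le> n * 0" "n * (- 2) \<le> n * (2 * q)" using q l by (auto simp: mult_ac)
    then have "2 * q \<le> 0" "- 2 \<le> 2 * q" using N(2) by (simp_all only: mult_le_cancel_left_pos)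
    then have "q = 0 \<or> q = -1" by auto
    then show "l \<in> {n, - n}" using q by auto
  qed (use N in auto)
  then show ?thesis
    unfolding lam_def n_def[symmetric] N(1) using N by (simp add: a_coef_def n_def[symmetric] add_divide_distrib)
qed

lemma centred_residue:
  assumes "even N" "N > 0"
  obtains m' q :: int where "m = m' + int N * q" "- (int N div 2) \<le> m'" "m' < int N div 2"
proof
  define n where "n = int N div 2"
  have N: "int N = 2 * n" "n > 0" using assms by (auto simp: n_def)
  show "m = ((m + n) mod int N - n) + int N * ((m + n) div int N)"
    by (simp add: algebra_simps)
  have "0 \<le> (m + n) mod int N" "(m + n) mod int N < int N" using assms(2) by auto
  then show "- (int N div 2) \<le> (m + n) mod int N - n" "(m + n) mod int N - n < int N div 2"
    using N by (auto simp: n_def[symmetric])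
qed

lemma lam_centred_bound:
  assumes "even N" "N > 0" "- (int N div 2) \<le> m" "m < int N div 2"
  shows "cmod (lam N s m) \<le> \<bar>real_of_int m\<bar> ^ s"
proof (cases "m = - (int N div 2)")
  case True
  let ?a = "(\<i> * of_int (int N div 2)) ^ s :: complex" and ?b = "(\<i> * of_int (- (int N div 2))) ^ s :: complex"
  have "cmod (?a + ?b) \<le> cmod ?a + cmod ?b" by (rule norm_triangle_ineq)
  also have "\<dots> = 2 * \<bar>real_of_int m\<bar> ^ s" by (simp add: True norm_power norm_mult)
  finally have "cmod ((?a + ?b) / 2) \<le> \<bar>real_of_int m\<bar> ^ s" by (simp add: norm_divide)
  then show ?thesis unfolding True lam_half[OF assms(1,2)] by simp
next
  case False
  then have "2 * \<bar>m\<bar> < int N" using assms by linarith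
  then show ?thesis by (simp add: lam_exact assms(1) norm_power norm_mult)
qed

text \<open>Aliasing only lowers frequencies: the centred residue is at most
  \<open>\<bar>m\<bar>\<close> in modulus. Discrete symbols are thus dominated by the continuous
  ones at all frequencies, uniformly in \<open>N\<close>.\<close>

lemma lam_bound:
  assumes "even N" "N > 0"
  shows "cmod (lam N s m) \<le> \<bar>real_of_int m\<bar> ^ s"
proof -
  obtain m' q where m: "m = m' + int N * q" "- (int N div 2) \<le> m'" "m' < int N div 2"
    by (rule centred_residue[OF assms])
  have "lam N s m = lam N s m'" using m(1) by (intro lam_cong) simp
  then have "cmod (lam N s m) \<le> \<bar>real_of_int m'\<bar> ^ s"
    using lam_centred_bound[OF assms m(2,3)] by simp
  also have "\<dots> \<le> \<bar>real_of_int m\<bar> ^ s"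
  proof (rule power_mono)
    have "\<bar>m'\<bar> \<le> \<bar>m\<bar>"
    proof (cases "q = 0")
      case False
      have "int N * 1 \<le> int N * \<bar>q\<bar>" using False by (intro mult_left_mono) auto
      then have "int N \<le> \<bar>int N * q\<bar>" by (simp add: abs_mult)
      then show ?thesis using m assms by linarith
    qed (use m in simp)
    then show "\<bar>real_of_int m'\<bar> \<le> \<bar>real_of_int m\<bar>" by linarith
  qed simp
  finally show ?thesis .
qed

text \<open>For even order the two endpoint contributions agree, so the formula persists at
  \<open>- (N / 2)\<close>. The discrete Laplacian therefore loses no strength on any mode, as the
  norm comparisons require.\<close>

lemma lam_2:
  assumes "even N" "N > 0" "- (int N div 2) \<le> m" "m < int N div 2"
  shows "lam N 2 m = - (of_int m)\<^sup>2"
proof (cases "m = - (int N div 2)")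
  case True
  then show ?thesis unfolding True lam_half[OF assms(1,2)] by (simp add: power_mult_distrib)
next
  case False
  then have "2 * \<bar>m\<bar> < int N" using assms by linarith
  then show ?thesis by (simp add: lam_exact assms(1) power_mult_distrib)
qed

section \<open>Grid functions represented by series over all frequencies\<close>

definition ge :: "nat \<Rightarrow> int \<times> int \<Rightarrow> nat \<Rightarrow> nat \<Rightarrow> complex" where
  "ge N k a b = trig k (real a * hstep N) (real b * hstep N)"

text \<open>Frequencies congruent modulo \<open>N\<close> coincide on the grid, so the coefficients in \<open>rep N c V\<close> are not unique.\<close>

definition rep :: "nat \<Rightarrow> (int \<times> int \<Rightarrow> complex) \<Rightarrow> grid \<Rightarrow> bool" where
  "rep N c V \<longleftrightarrow> (\<forall>a<N. \<forall>b<N. ((\<lambda>k. c k * ge N k a b) has_sum complex_of_real (V a b)) UNIV)"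

lemma ge_split: "ge N k a b = cis (real_of_int (fst k) * (real a * hstep N)) * cis (real_of_int (snd k) * (real b * hstep N))"
  by (simp add: ge_def trig_def cis_mult)

lemma cmod_ge [simp]: "cmod (ge N k a b) = 1"
  by (simp add: ge_def)

lemma fser_rep: "fser c f \<Longrightarrow> rep N c (\<lambda>a b. f (real a * hstep N) (real b * hstep N))"
  by (simp add: fser_def rep_def ge_def)

lemma rep_cong: "rep N c V \<Longrightarrow> (\<And>a b. a < N \<Longrightarrow> b < N \<Longrightarrow> V a b = W a b) \<Longrightarrow> rep N c W"
  by (simp add: rep_def)

lemma rep_add: "rep N c V \<Longrightarrow> rep N d W \<Longrightarrow> rep N (\<lambda>k. c k + d k) (\<lambda>a b. V a b + W a b)"
  by (simp add: rep_def distrib_right has_sum_add)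

lemma rep_cmult: "rep N c V \<Longrightarrow> rep N (\<lambda>k. of_real r * c k) (\<lambda>a b. r * V a b)"
  by (simp add: rep_def mult.assoc has_sum_cmult_right)

lemma rep_diff: "rep N c V \<Longrightarrow> rep N d W \<Longrightarrow> rep N (\<lambda>k. c k - d k) (\<lambda>a b. V a b - W a b)"
  using rep_add[of N c V "\<lambda>k. of_real (- 1) * d k" "\<lambda>a b. - 1 * W a b"] rep_cmult[of N d W "- 1"] by simp

lemma rep_bound:
  assumes "rep N c V" "wl1 0 c K" "a < N" "b < N"
  shows "\<bar>V a b\<bar> \<le> K"
  using wl1_has_sum_bound[OF assms(2), of "\<lambda>k. ge N k a b" "complex_of_real (V a b)"] assms
  by (simp add: rep_def)

text \<open>Each exponential is an eigenvector, and frequencies are not folded back to one period.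
  Coefficients of a smooth function thus keep weighted bounds under the discrete operators.\<close>

lemma rep_applyX:
  assumes N: "N > 0" and V: "rep N c V"
  shows "rep N (\<lambda>k. lam N s (fst k) * c k) (applyX N (Dmat N s) V)"
  unfolding rep_def
proof (intro allI impI)
  fix a b assume ab: "a < N" "b < N"
  have "((\<lambda>k. \<Sum>j<N. of_real (Dmat N s a j) * (c k * ge N k j b)) has_sum
      (\<Sum>j<N. of_real (Dmat N s a j) * of_real (V j b))) UNIV"
    using V ab by (intro has_sum_finite_sum has_sum_cmult_right) (auto simp: rep_def)
  moreover have "(\<Sum>j<N. of_real (Dmat N s a j) * (c k * ge N k j b)) = lam N s (fst k) * c k * ge N k a b" for k
  proof -
    have "(\<Sum>j<N. of_real (Dmat N s a j) * (c k * ge N k j b))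
       = c k * cis (real_of_int (snd k) * (real b * hstep N))
         * (\<Sum>j<N. complex_of_real (Dmat N s a j) * cis (real_of_int (fst k) * (real j * hstep N)))"
      unfolding ge_split sum_distrib_left by (intro sum.cong refl) (simp add: mult_ac)
    then show ?thesis unfolding Dmat_eigen[OF N] ge_split by (simp add: mult_ac)
  qed
  ultimately show "((\<lambda>k. lam N s (fst k) * c k * ge N k a b) has_sum complex_of_real (applyX N (Dmat N s) V a b)) UNIV"
    by (simp add: applyX_def)
qed

lemma rep_applyY:
  assumes N: "N > 0" and V: "rep N c V"
  shows "rep N (\<lambda>k. lam N s (snd k) * c k) (applyY N (Dmat N s) V)"
  unfolding rep_def
proof (intro allI impI)
  fix a b assume ab: "a < N" "b < N"
  have "((\<lambda>k. \<Sum>j<N. of_real (Dmat N s b j) * (c k * ge N k a j)) has_sum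
      (\<Sum>j<N. of_real (Dmat N s b j) * of_real (V a j))) UNIV"
    using V ab by (intro has_sum_finite_sum has_sum_cmult_right) (auto simp: rep_def)
  moreover have "(\<Sum>j<N. of_real (Dmat N s b j) * (c k * ge N k a j)) = lam N s (snd k) * c k * ge N k a b" for k
  proof -
    have "(\<Sum>j<N. of_real (Dmat N s b j) * (c k * ge N k a j))
       = c k * cis (real_of_int (fst k) * (real a * hstep N))
         * (\<Sum>j<N. complex_of_real (Dmat N s b j) * cis (real_of_int (snd k) * (real j * hstep N)))"
      unfolding ge_split sum_distrib_left by (intro sum.cong refl) (simp add: mult_ac)
    then show ?thesis unfolding Dmat_eigen[OF N] ge_split by (simp add: mult_ac)
  qed
  ultimately show "((\<lambda>k. lam N s (snd k) * c k * ge N k a b) has_sum complex_of_real (applyY N (Dmat N s) V a b)) UNIV"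
    by (simp add: applyY_def)
qed

definition symA :: "nat \<Rightarrow> int \<times> int \<Rightarrow> complex" where
  "symA N k = lam N 2 (fst k) + lam N 2 (snd k)"

definition symB :: "nat \<Rightarrow> int \<times> int \<Rightarrow> complex" where
  "symB N k = lam N 3 (fst k) + lam N 2 (snd k) * lam N 1 (fst k)"

definition symL :: "nat \<Rightarrow> int \<times> int \<Rightarrow> complex" where
  "symL N k = lam N 1 (fst k) + lam N 1 (snd k)"

lemma rep_opA: "N > 0 \<Longrightarrow> rep N c V \<Longrightarrow> rep N (\<lambda>k. symA N k * c k) (opA N V)"
  unfolding opA_def symA_def distrib_right by (intro rep_add rep_applyX rep_applyY)

lemma rep_opB: "N > 0 \<Longrightarrow> rep N c V \<Longrightarrow> rep N (\<lambda>k. symB N k * c k) (opB N V)"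
  unfolding opB_def symB_def distrib_right mult.assoc by (intro rep_add rep_applyX rep_applyY)

lemma rep_opL: "N > 0 \<Longrightarrow> rep N c V \<Longrightarrow> rep N (\<lambda>k. symL N k * c k) (opL N V)"
  unfolding opL_def symL_def distrib_right by (intro rep_add rep_applyX rep_applyY)

section \<open>Discrete Fourier transform and aliasing\<close>

text \<open>One representative of each residue class: \<open>N / 2\<close> and
  \<open>- (N / 2)\<close> agree on the grid, and only the latter is kept.\<close>

definition freq :: "nat \<Rightarrow> (int \<times> int) set" where
  "freq N = {- (int N div 2)..<int N div 2} \<times> {- (int N div 2)..<int N div 2}"

lemma finite_freq [simp]: "finite (freq N)"
  by (simp add: freq_def)

lemma ge_orthogonal:
  assumes N: "N > 0"
  shows "(\<Sum>a<N. \<Sum>b<N. ge N k a b * cnj (ge N l a b))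
       = (if int N dvd fst k - fst l \<and> int N dvd snd k - snd l then (of_nat N)\<^sup>2 else 0)"
proof -
  have "ge N k a b * cnj (ge N l a b) = cis (real_of_int (fst k - fst l) * (real a * hstep N))
      * cis (real_of_int (snd k - snd l) * (real b * hstep N))" for a b
    by (simp add: ge_split cis_cnj cis_mult algebra_simps)
  then have "(\<Sum>a<N. \<Sum>b<N. ge N k a b * cnj (ge N l a b))
     = (\<Sum>a<N. cis (real_of_int (fst k - fst l) * (real a * hstep N)))
      * (\<Sum>b<N. cis (real_of_int (snd k - snd l) * (real b * hstep N)))"
    by (simp only: sum_product)
  then show ?thesis
    unfolding sum_cis_grid[OF N] by (auto simp: power2_eq_square)
qed

lemma ge_orthogonal_freq:
  assumes N: "N > 0" "even N" and kl: "k \<in> freq N" "l \<in> freq N"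
  shows "(\<Sum>a<N. \<Sum>b<N. ge N k a b * cnj (ge N l a b)) = (if k = l then (of_nat N)\<^sup>2 else 0)"
proof -
  have eq: "i = j" if "int N dvd i - j" "i \<in> {- (int N div 2)..<int N div 2}" "j \<in> {- (int N div 2)..<int N div 2}" for i j
  proof -
    have "\<bar>i - j\<bar> < int N" using that N by auto
    then show ?thesis using dvd_imp_le_int[of "i - j" "int N"] that(1) by (cases "i - j = 0") auto
  qed
  show ?thesis
    unfolding ge_orthogonal[OF N(1)] using kl eq by (auto simp: freq_def prod_eq_iff mem_Times_iff)
qed

text \<open>The dual orthogonality, needed for inversion. Shifting the range to start at zero leaves
  a geometric sum in which grid index and frequency have exchanged roles.\<close>

lemma sum_cis_freq:
  assumes N: "N > 0" "even N" and a: "a < N" "a' < N"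
  shows "(\<Sum>m\<in>{- (int N div 2)..<int N div 2}. cis (real_of_int m * (real a * hstep N)) * cnj (cis (real_of_int m * (real a' * hstep N))))
    = (if a = a' then of_nat N else 0)"
proof -
  define n where "n = int N div 2"
  have n: "int N = 2 * n" using N by (simp add: n_def)
  have "(\<Sum>m\<in>{- n..<n}. cis (real_of_int m * (real a * hstep N)) * cnj (cis (real_of_int m * (real a' * hstep N))))
     = (\<Sum>m\<in>{- n..<n}. cis (real_of_int m * (real_of_int (int a - int a') * hstep N)))"
    by (intro sum.cong refl) (simp add: cis_cnj cis_mult algebra_simps)
  also have "\<dots> = (\<Sum>j<N. cis (real_of_int (int j - n) * (real_of_int (int a - int a') * hstep N)))"
    by (rule sum.reindex_bij_witness[of _ "\<lambda>j. int j - n" "\<lambda>m. nat (m + n)"]) (use n in \<open>auto simp: nat_less_iff\<close>)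
  also have "\<dots> = cis (real_of_int (- n) * (real_of_int (int a - int a') * hstep N))
      * (\<Sum>j<N. cis (real_of_int (int a - int a') * (real j * hstep N)))"
    unfolding sum_distrib_left by (intro sum.cong refl) (simp add: cis_mult algebra_simps)
  also have "\<dots> = (if a = a' then of_nat N else 0)"
  proof (cases "a = a'")
    case False
    have "\<not> int N dvd int a - int a'"
      using dvd_imp_le_int[of "int a - int a'" "int N"] a False by auto
    then show ?thesis unfolding sum_cis_grid[OF N(1)] using False by simp
  qed (simp add: sum_cis_grid[OF N(1)])
  finally show ?thesis by (simp add: n_def)
qed

definition dft :: "nat \<Rightarrow> grid \<Rightarrow> int \<times> int \<Rightarrow> complex" where
  "dft N V k = (if k \<in> freq N
     then (\<Sum>a<N. \<Sum>b<N. of_real (V a b) * cnj (ge N k a b)) / (of_nat N)\<^sup>2 else 0)"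

text \<open>Discrete Fourier inversion. It represents the error, about which no smoothness is known,
  by coefficients supported on one period.\<close>

lemma rep_dft:
  assumes N: "N > 0" "even N"
  shows "rep N (dft N V) V"
  unfolding rep_def
proof (intro allI impI)
  fix a b assume ab: "a < N" "b < N"
  let ?I = "{- (int N div 2)..<int N div 2}"
  let ?e = "\<lambda>m a. cis (real_of_int m * (real a * hstep N))"
  have "(\<Sum>k\<in>freq N. dft N V k * ge N k a b)
     = (\<Sum>k\<in>freq N. \<Sum>a'<N. \<Sum>b'<N. of_real (V a' b') / (of_nat N)\<^sup>2 * (cnj (ge N k a' b') * ge N k a b))"
    by (intro sum.cong refl) (simp add: dft_def sum_divide_distrib sum_distrib_right mult.assoc)
  also have "\<dots> = (\<Sum>a'<N. \<Sum>b'<N. \<Sum>k\<in>freq N. of_real (V a' b') / (of_nat N)\<^sup>2 * (cnj (ge N k a' b') * ge N k a b))"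
    by (subst sum.swap, intro sum.cong refl, subst sum.swap, rule refl)
  also have "\<dots> = (\<Sum>a'<N. \<Sum>b'<N. of_real (V a' b') / (of_nat N)\<^sup>2 * ((if a = a' then of_nat N else 0) * (if b = b' then of_nat N else 0)))"
  proof (intro sum.cong refl)
    fix a' b' assume a'b': "a' \<in> {..<N}" "b' \<in> {..<N}"
    have "(\<Sum>k\<in>freq N. cnj (ge N k a' b') * ge N k a b)
       = (\<Sum>k\<in>?I \<times> ?I. (?e (fst k) a * cnj (?e (fst k) a')) * (?e (snd k) b * cnj (?e (snd k) b')))"
      unfolding freq_def by (intro sum.cong refl) (simp add: ge_split mult_ac)
    also have "\<dots> = (\<Sum>m\<in>?I. ?e m a * cnj (?e m a')) * (\<Sum>m\<in>?I. ?e m b * cnj (?e m b'))"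
      unfolding sum_product sum.cartesian_product by (simp add: case_prod_unfold)
    also have "\<dots> = (if a = a' then of_nat N else 0) * (if b = b' then of_nat N else 0)"
      using sum_cis_freq[OF N] ab a'b' by simp
    finally show "(\<Sum>k\<in>freq N. of_real (V a' b') / (of_nat N)\<^sup>2 * (cnj (ge N k a' b') * ge N k a b))
       = of_real (V a' b') / (of_nat N)\<^sup>2 * ((if a = a' then of_nat N else 0) * (if b = b' then of_nat N else 0))"
      unfolding sum_distrib_left[symmetric] by (simp only:)
  qed
  also have "\<dots> = (\<Sum>a'<N. \<Sum>b'<N. if b = b' then (if a = a' then of_real (V a' b') else 0) else 0)"
    using N by (intro sum.cong refl) (auto simp: power2_eq_square)
  also have "\<dots> = of_real (V a b)" using ab by (simp add: sum.delta')
  finally show "((\<lambda>k. dft N V k * ge N k a b) has_sum complex_of_real (V a b)) UNIV"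
    by (intro has_sum_finite_neutralI[of "freq N"]) (auto simp: dft_def)
qed

text \<open>Stated for any coefficients supported on \<open>freq N\<close>, so that it applies
  directly to a symbol times \<open>dft\<close> without computing the transform of
  \<open>opA N e\<close>.\<close>

lemma parseval:
  assumes N: "N > 0" "even N" and V: "rep N c V" and c: "\<And>k. k \<notin> freq N \<Longrightarrow> c k = 0"
  shows "(\<Sum>a<N. \<Sum>b<N. (V a b)\<^sup>2) = (real N)\<^sup>2 * (\<Sum>k\<in>freq N. (cmod (c k))\<^sup>2)"
proof -
  have V_eq: "complex_of_real (V a b) = (\<Sum>k\<in>freq N. c k * ge N k a b)" if "a < N" "b < N" for a b
  proof -
    have "((\<lambda>k. c k * ge N k a b) has_sum (\<Sum>k\<in>freq N. c k * ge N k a b)) UNIV"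
      by (intro has_sum_finite_neutralI[of "freq N"]) (auto simp: c)
    moreover have "((\<lambda>k. c k * ge N k a b) has_sum complex_of_real (V a b)) UNIV"
      using V that by (simp add: rep_def)
    ultimately show ?thesis by (rule has_sum_unique[symmetric])
  qed
  have "complex_of_real (\<Sum>a<N. \<Sum>b<N. (V a b)\<^sup>2) = (\<Sum>a<N. \<Sum>b<N. complex_of_real (V a b) * cnj (complex_of_real (V a b)))"
    by (simp add: power2_eq_square)
  also have "\<dots> = (\<Sum>a<N. \<Sum>b<N. \<Sum>k\<in>freq N. \<Sum>l\<in>freq N. c k * cnj (c l) * (ge N k a b * cnj (ge N l a b)))"
    by (intro sum.cong refl) (simp add: V_eq sum_product mult_ac)
  also have "\<dots> = (\<Sum>a<N. \<Sum>k\<in>freq N. \<Sum>b<N. \<Sum>l\<in>freq N. c k * cnj (c l) * (ge N k a b * cnj (ge N l a b)))"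
    by (intro sum.cong refl sum.swap)
  also have "\<dots> = (\<Sum>k\<in>freq N. \<Sum>a<N. \<Sum>l\<in>freq N. \<Sum>b<N. c k * cnj (c l) * (ge N k a b * cnj (ge N l a b)))"
    by (subst sum.swap) (intro sum.cong refl sum.swap)
  also have "\<dots> = (\<Sum>k\<in>freq N. \<Sum>l\<in>freq N. \<Sum>a<N. \<Sum>b<N. c k * cnj (c l) * (ge N k a b * cnj (ge N l a b)))"
    by (intro sum.cong refl sum.swap)
  also have "\<dots> = (\<Sum>k\<in>freq N. \<Sum>l\<in>freq N. c k * cnj (c l) * (if k = l then (of_nat N)\<^sup>2 else 0))"
    unfolding sum_distrib_left[symmetric] using ge_orthogonal_freq[OF N] by (intro sum.cong refl) simp
  also have "\<dots> = (\<Sum>k\<in>freq N. c k * cnj (c k) * (of_nat N)\<^sup>2)"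
    by (intro sum.cong refl) (simp add: if_distrib sum.delta' cong: if_cong)
  also have "\<dots> = complex_of_real ((real N)\<^sup>2 * (\<Sum>k\<in>freq N. (cmod (c k))\<^sup>2))"
    unfolding complex_norm_square[symmetric] by (simp add: sum_distrib_left mult_ac)
  finally show ?thesis by (simp only: of_real_eq_iff)
qed

text \<open>Here \<open>(q1, q2)\<close> indexes the period containing the frequency. The residue
  has modulus at most \<open>N / 2\<close>, whence
  \<open>N * \<bar>q\<bar> \<le> 2 * \<bar>k\<bar>\<close> in each variable; being far supplies the
  constant part of \<open>jw (q1, q2)\<close>. The two bounds, each with factor \<open>4\<close>,
  add up to the \<open>8\<close>.\<close>

lemma jw_aliased_le:
  assumes N: "N > 0" "even N" and k: "k1 = m1 + int N * q1" "k2 = m2 + int N * q2"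
    and m: "(m1, m2) \<in> freq N" and far: "\<not> (2 * \<bar>k1\<bar> < int N \<and> 2 * \<bar>k2\<bar> < int N)"
  shows "(real N)\<^sup>2 / 8 * jw (q1, q2) \<le> jw (k1, k2)"
proof -
  have one: "int N * \<bar>q\<bar> \<le> 2 * \<bar>n + int N * q\<bar>" if "n \<in> {- (int N div 2)..<int N div 2}" for n q
  proof (cases "q = 0")
    case False
    have p: "\<bar>int N * q\<bar> = int N * \<bar>q\<bar>" by (simp add: abs_mult)
    have "int N * 1 \<le> int N * \<bar>q\<bar>" using False by (intro mult_left_mono) auto
    then have "int N \<le> \<bar>int N * q\<bar>" by (simp add: p)
    moreover have "2 * \<bar>n\<bar> \<le> int N" using that by auto
    moreover have "M \<le> \<bar>p\<bar> \<Longrightarrow> 2 * \<bar>i\<bar> \<le> M \<Longrightarrow> \<bar>p\<bar> \<le> 2 * \<bar>i + p\<bar>" for M p i :: int by (smt (verit))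
    ultimately have "\<bar>int N * q\<bar> \<le> 2 * \<bar>n + int N * q\<bar>" by blast
    then show ?thesis by (simp only: p)
  qed simp
  have sq: "(real N)\<^sup>2 * (real_of_int q)\<^sup>2 \<le> 4 * (real_of_int (n + int N * q))\<^sup>2" if "n \<in> {- (int N div 2)..<int N div 2}" for n q
  proof -
    have "real_of_int (int N * \<bar>q\<bar>) \<le> real_of_int (2 * \<bar>n + int N * q\<bar>)"
      using one[OF that] by (simp only: of_int_le_iff)
    then have "(real_of_int (int N * \<bar>q\<bar>))\<^sup>2 \<le> (real_of_int (2 * \<bar>n + int N * q\<bar>))\<^sup>2"
      by (intro power_mono) auto
    then show ?thesis by (simp add: power_mult_distrib)
  qed
  have s: "(real N)\<^sup>2 * ((real_of_int q1)\<^sup>2 + (real_of_int q2)\<^sup>2) \<le> 4 * ((real_of_int k1)\<^sup>2 + (real_of_int k2)\<^sup>2)"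
    using sq[of m1 q1] sq[of m2 q2] m k by (simp add: freq_def distrib_left)
  have f: "(real N)\<^sup>2 \<le> 4 * ((real_of_int k1)\<^sup>2 + (real_of_int k2)\<^sup>2)"
  proof -
    have "real N \<le> 2 * \<bar>real_of_int k1\<bar> \<or> real N \<le> 2 * \<bar>real_of_int k2\<bar>" using far by linarith
    then have "(real N)\<^sup>2 \<le> (2 * \<bar>real_of_int k1\<bar>)\<^sup>2 \<or> (real N)\<^sup>2 \<le> (2 * \<bar>real_of_int k2\<bar>)\<^sup>2"
      by (meson of_nat_0_le_iff power_mono)
    then show ?thesis by (auto simp: power_mult_distrib intro: order_trans)
  qed
  have "(real N)\<^sup>2 / 8 * jw (q1, q2) = ((real N)\<^sup>2 + (real N)\<^sup>2 * ((real_of_int q1)\<^sup>2 + (real_of_int q2)\<^sup>2)) / 8"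
    by (simp add: jw_def algebra_simps)
  also have "\<dots> \<le> (real_of_int k1)\<^sup>2 + (real_of_int k2)\<^sup>2" using add_mono[OF f s] by simp
  also have "\<dots> \<le> jw (k1, k2)" by (simp add: jw_def)
  finally show ?thesis .
qed

text \<open>Testing the grid function against itself turns its square sum into a pairing of the aliased
  coefficients with an \<open>N\<close>-periodic sequence; on the high frequencies the weights
  \<open>jw k powr - s\<close> of one period sum up to \<open>O(N powr (- 2 * s))\<close>.\<close>

lemma aliasing:
  assumes s: "s > 1"
  obtains C where "0 \<le> C"
    "\<And>N d V K. \<lbrakk>N > 0; even N; rep N d V; wl2 s d K;
       \<And>k. 2 * \<bar>fst k\<bar> < int N \<Longrightarrow> 2 * \<bar>snd k\<bar> < int N \<Longrightarrow> d k = 0\<rbrakk>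
       \<Longrightarrow> grid_norm N V \<le> C * K * real N powr (- s)"
proof -
  define Z where "Z = infsum (\<lambda>k. jw k powr (- s)) UNIV"
  have Z0: "0 \<le> Z" by (simp add: Z_def infsum_nonneg)
  \<comment> \<open>\<open>2 * pi\<close> is \<open>hstep N * real N\<close>; the rest is
    \<open>sqrt (B * Z)\<close> below with the power of \<open>N\<close> removed.\<close>
  define C where "C = 2 * pi * (8 powr (s / 2) * sqrt Z)"
  have C0: "0 \<le> C" using Z0 by (simp add: C_def)
  have main: "grid_norm N V \<le> C * K * real N powr (- s)"
    if N: "N > 0" "even N" and V: "rep N d V" and d: "wl2 s d K"
      and d0: "\<And>k. 2 * \<bar>fst k\<bar> < int N \<Longrightarrow> 2 * \<bar>snd k\<bar> < int N \<Longrightarrow> d k = 0" for N d V K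
  proof -
    define E where "E = (\<Sum>a<N. \<Sum>b<N. (V a b)\<^sup>2)"
    have E0: "0 \<le> E" unfolding E_def by (intro sum_nonneg) auto
    \<comment> \<open>On \<open>freq N\<close> this is \<open>dft N V\<close> up to conjugation and
      the factor \<open>(real N)\<^sup>2\<close>, but it continues periodically to all frequencies,
      where the coefficients \<open>d\<close> live.\<close>
    define X where "X k = (\<Sum>a<N. \<Sum>b<N. complex_of_real (V a b) * ge N k a b)" for k
    have K0: "0 \<le> K" using d by (simp add: wl2_def)
    have XE: "(\<Sum>k\<in>freq N. (cmod (X k))\<^sup>2) = (real N)\<^sup>2 * E"
    proof -
      have X: "(cmod (X k))\<^sup>2 = (real N)\<^sup>2 * ((real N)\<^sup>2 * (cmod (dft N V k))\<^sup>2)" if "k \<in> freq N" for k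
      proof -
        have "cnj (X k) = (of_nat N)\<^sup>2 * dft N V k"
          using that N by (simp add: X_def dft_def)
        then have "cmod (X k) = (real N)\<^sup>2 * cmod (dft N V k)"
          by (metis complex_mod_cnj norm_mult norm_of_nat norm_power)
        then show ?thesis by (simp add: power2_eq_square)
      qed
      have "(\<Sum>k\<in>freq N. (cmod (X k))\<^sup>2) = (real N)\<^sup>2 * ((real N)\<^sup>2 * (\<Sum>k\<in>freq N. (cmod (dft N V k))\<^sup>2))"
        unfolding sum_distrib_left by (intro sum.cong refl X)
      also have "(real N)\<^sup>2 * (\<Sum>k\<in>freq N. (cmod (dft N V k))\<^sup>2) = E"
        unfolding E_def by (rule parseval[OF N rep_dft[OF N], symmetric]) (simp add: dft_def)
      finally show ?thesis .
    qed
    have hs: "((\<lambda>k. d k * X k) has_sum complex_of_real E) UNIV"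
    proof -
      have "((\<lambda>k. \<Sum>a<N. \<Sum>b<N. complex_of_real (V a b) * (d k * ge N k a b)) has_sum
          (\<Sum>a<N. \<Sum>b<N. complex_of_real (V a b) * complex_of_real (V a b))) UNIV"
        using V by (intro has_sum_finite_sum has_sum_cmult_right) (auto simp: rep_def)
      moreover have "(\<Sum>a<N. \<Sum>b<N. complex_of_real (V a b) * (d k * ge N k a b)) = d k * X k" for k
        unfolding X_def sum_distrib_left by (intro sum.cong refl) (simp add: mult_ac)
      ultimately show ?thesis by (simp add: E_def power2_eq_square)
    qed
    define B where "B = ((real N)\<^sup>2 / 8) powr (- s)"
    define far where "far = {k. \<not> (2 * \<bar>fst k\<bar> < int N \<and> 2 * \<bar>snd k\<bar> < int N)}"
    define n where "n = int N div 2"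
    define q where "q k = ((fst k + n) div int N, (snd k + n) div int N)" for k :: "int \<times> int"
    define m where "m k = ((fst k + n) mod int N - n, (snd k + n) mod int N - n)" for k :: "int \<times> int"
    have Nn: "int N = 2 * n" using N by (simp add: n_def)
    have k_eq: "fst k = fst (m k) + int N * fst (q k)" "snd k = snd (m k) + int N * snd (q k)" for k
      by (simp_all add: m_def q_def algebra_simps)
    have n0: "0 < 2 * n" using N Nn by linarith
    have m_freq: "m k \<in> freq N" for k
      using pos_mod_bound[OF n0, of "fst k + n"] pos_mod_bound[OF n0, of "snd k + n"]
        pos_mod_sign[OF n0, of "fst k + n"] pos_mod_sign[OF n0, of "snd k + n"]
      unfolding m_def freq_def n_def[symmetric] by (auto simp: Nn)
    have Xper: "X k = X (m k)" for k
    proof -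
      have "ge N k a b = ge N (m k) a b" for a b
        unfolding ge_split
        using cis_grid_cong[OF N(1), of "fst k" "fst (m k)" a] cis_grid_cong[OF N(1), of "snd k" "snd (m k)" b]
          k_eq[of k] by (metis add_diff_cancel_left' dvd_triv_left)
      then show ?thesis by (simp add: X_def)
    qed
    \<comment> \<open>Each frequency splits into its period index \<open>q k\<close> and its residue
      \<open>m k\<close>. The weight is bounded through \<open>q k\<close> and \<open>X\<close>
      depends only on \<open>m k\<close>, so the sum is at most a lattice sum times a Parseval
      sum.\<close>
    have wsum: "(\<Sum>k\<in>S. jw k powr (- s) * (cmod (X k))\<^sup>2) \<le> B * Z * ((real N)\<^sup>2 * E)"
      if S: "finite S" "S \<subseteq> far" for S
    proof -
      have "(\<Sum>k\<in>S. jw k powr (- s) * (cmod (X k))\<^sup>2) \<le> (\<Sum>k\<in>S. (B * jw (q k) powr (- s)) * (cmod (X (m k)))\<^sup>2)"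
      proof (rule sum_mono)
        fix k assume k: "k \<in> S"
        have "(real N)\<^sup>2 / 8 * jw (fst (q k), snd (q k)) \<le> jw (fst k, snd k)"
        proof (rule jw_aliased_le[OF N k_eq])
          show "(fst (m k), snd (m k)) \<in> freq N" using m_freq by simp
          show "\<not> (2 * \<bar>fst k\<bar> < int N \<and> 2 * \<bar>snd k\<bar> < int N)" using k S by (auto simp: far_def)
        qed
        then have "jw k powr (- s) \<le> ((real N)\<^sup>2 / 8 * jw (q k)) powr (- s)"
          using N s by (intro powr_mono2') auto
        also have "\<dots> = B * jw (q k) powr (- s)"
          unfolding B_def by (rule powr_mult)
        finally show "jw k powr (- s) * (cmod (X k))\<^sup>2 \<le> (B * jw (q k) powr (- s)) * (cmod (X (m k)))\<^sup>2"
          unfolding Xper[of k] by (intro mult_right_mono) auto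
      qed
      also have "\<dots> = (\<Sum>z\<in>(\<lambda>k. (q k, m k)) ` S. (B * jw (fst z) powr (- s)) * (cmod (X (snd z)))\<^sup>2)"
      proof (subst sum.reindex)
        show "inj_on (\<lambda>k. (q k, m k)) S"
          by (rule inj_onI) (metis k_eq prod.inject prod.collapse)
      qed simp
      also have "\<dots> \<le> (\<Sum>z\<in>q ` S \<times> freq N. (B * jw (fst z) powr (- s)) * (cmod (X (snd z)))\<^sup>2)"
        using S m_freq by (intro sum_mono2) (auto simp: B_def)
      also have "\<dots> = (\<Sum>j\<in>q ` S. B * jw j powr (- s)) * (\<Sum>k\<in>freq N. (cmod (X k))\<^sup>2)"
        unfolding sum_product sum.cartesian_product by (simp add: case_prod_unfold)
      also have "\<dots> = B * (\<Sum>j\<in>q ` S. jw j powr (- s)) * ((real N)\<^sup>2 * E)"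
        unfolding XE sum_distrib_left ..
      also have "\<dots> \<le> B * Z * ((real N)\<^sup>2 * E)"
      proof (intro mult_right_mono mult_left_mono)
        show "(\<Sum>j\<in>q ` S. jw j powr (- s)) \<le> Z"
          unfolding Z_def using summable_on_jw_powr[OF s] S by (intro finite_sum_le_infsum) auto
      qed (use E0 in \<open>auto simp: B_def\<close>)
      finally show ?thesis .
    qed
    have fin: "cmod (\<Sum>k\<in>S. d k * X k) \<le> K * sqrt (B * Z * ((real N)\<^sup>2 * E))" if S: "finite S" for S
    proof -
      let ?S = "S \<inter> far"
      have "cmod (\<Sum>k\<in>S. d k * X k) = cmod (\<Sum>k\<in>?S. d k * X k)"
        by (rule arg_cong[of _ _ cmod], rule sum.mono_neutral_right) (use S d0 in \<open>auto simp: far_def\<close>)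
      also have "\<dots> \<le> (\<Sum>k\<in>?S. (jw k powr (s / 2) * cmod (d k)) * (jw k powr (- s / 2) * cmod (X k)))"
      proof (rule sum_norm_le)
        fix k
        have "jw k powr (s / 2) * jw k powr (- s / 2) = 1" by (simp flip: powr_add)
        then show "cmod (d k * X k) \<le> (jw k powr (s / 2) * cmod (d k)) * (jw k powr (- s / 2) * cmod (X k))"
          by (metis (no_types, opaque_lifting) mult.commute mult.left_commute mult.right_neutral norm_mult order_refl)
      qed
      also have "\<dots> \<le> K * sqrt (B * Z * ((real N)\<^sup>2 * E))"
      proof (rule power2_le_imp_le)
        have "(\<Sum>k\<in>?S. (jw k powr (s / 2) * cmod (d k)) * (jw k powr (- s / 2) * cmod (X k)))\<^sup>2
          \<le> (\<Sum>k\<in>?S. (jw k powr (s / 2) * cmod (d k))\<^sup>2) * (\<Sum>k\<in>?S. (jw k powr (- s / 2) * cmod (X k))\<^sup>2)"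
          using Cauchy_Schwarz_ineq_sum[of "\<lambda>k. jw k powr (s / 2) * cmod (d k)" "\<lambda>k. jw k powr (- s / 2) * cmod (X k)" ?S] .
        also have "(\<Sum>k\<in>?S. (jw k powr (s / 2) * cmod (d k))\<^sup>2) = (\<Sum>k\<in>?S. jw k powr s * (cmod (d k))\<^sup>2)"
          unfolding power_mult_distrib powr_sq by simp
        also have "(\<Sum>k\<in>?S. (jw k powr (- s / 2) * cmod (X k))\<^sup>2) = (\<Sum>k\<in>?S. jw k powr (- s) * (cmod (X k))\<^sup>2)"
          unfolding power_mult_distrib powr_sq by simp
        also have "(\<Sum>k\<in>?S. jw k powr s * (cmod (d k))\<^sup>2) * (\<Sum>k\<in>?S. jw k powr (- s) * (cmod (X k))\<^sup>2)
           \<le> K\<^sup>2 * (B * Z * ((real N)\<^sup>2 * E))"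
          using d S wsum[of ?S] by (intro mult_mono) (auto simp: wl2_def intro!: sum_nonneg)
        also have "\<dots> = (K * sqrt (B * Z * ((real N)\<^sup>2 * E)))\<^sup>2"
          using Z0 E0 by (simp add: power_mult_distrib B_def)
        finally show "(\<Sum>k\<in>?S. (jw k powr (s / 2) * cmod (d k)) * (jw k powr (- s / 2) * cmod (X k)))\<^sup>2
          \<le> (K * sqrt (B * Z * ((real N)\<^sup>2 * E)))\<^sup>2" .
      qed (use K0 Z0 E0 in \<open>simp add: B_def\<close>)
      finally show ?thesis .
    qed
    have "cmod (complex_of_real E) \<le> K * sqrt (B * Z * ((real N)\<^sup>2 * E))"
    proof (rule tendsto_upperbound)
      show "((\<lambda>S. cmod (\<Sum>k\<in>S. d k * X k)) \<longlongrightarrow> cmod (complex_of_real E)) (finite_subsets_at_top UNIV)"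
        using hs unfolding has_sum_def by (rule tendsto_norm)
      show "\<forall>\<^sub>F S in finite_subsets_at_top UNIV. cmod (\<Sum>k\<in>S. d k * X k) \<le> K * sqrt (B * Z * ((real N)\<^sup>2 * E))"
        by (rule eventually_finite_subsets_at_top_weakI) (rule fin)
    qed simp
    then have "sqrt E * sqrt E \<le> (K * (sqrt (B * Z) * real N)) * sqrt E"
      using E0 by (simp add: real_sqrt_mult mult_ac)
    then have sE: "sqrt E \<le> K * (sqrt (B * Z) * real N)"
    proof (cases "sqrt E = 0")
      case True
      then show ?thesis using K0 Z0 by (simp add: B_def)
    next
      case False
      then have "0 < sqrt E" using E0 by (simp add: order_less_le)
      then show ?thesis using \<open>sqrt E * sqrt E \<le> _\<close> by (simp only: mult_le_cancel_right_pos)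
    qed
    have sB: "sqrt B = 8 powr (s / 2) * real N powr (- s)"
    proof -
      have "sqrt B = ((real N)\<^sup>2 / 8) powr (- s / 2)"
        unfolding B_def powr_half_sqrt[OF powr_ge_zero, symmetric] powr_powr by simp
      also have "\<dots> = ((real N)\<^sup>2) powr (- s / 2) / 8 powr (- s / 2)"
        by (rule powr_divide)
      also have "\<dots> = real N powr (- s) * 8 powr (s / 2)"
        using N sq_powr[of "real N" "- s / 2"] by (simp add: powr_minus_divide)
      finally show ?thesis by simp
    qed
    have "grid_norm N V = hstep N * sqrt E"
      using N by (simp add: grid_norm_def E_def real_sqrt_mult hstep_def)
    also have "\<dots> \<le> hstep N * (K * (sqrt (B * Z) * real N))"
      using sE by (intro mult_left_mono) (auto simp: hstep_def)
    also have "\<dots> = C * K * real N powr (- s)"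
      using N by (simp add: hstep_def C_def real_sqrt_mult sB)
    finally show ?thesis .
  qed
  show ?thesis
  proof (rule that[OF C0])
    fix N d V K
    assume "N > 0" "even N" "rep N d V" "wl2 s d K"
      "\<And>k. 2 * \<bar>fst k\<bar> < int N \<Longrightarrow> 2 * \<bar>snd k\<bar> < int N \<Longrightarrow> d k = 0"
    then show "grid_norm N V \<le> C * K * real N powr (- s)" by (rule main)
  qed
qed

section \<open>Energy estimate and discrete norms\<close>

text \<open>The factor h^2 of the discrete inner product is omitted and restored only in
  \<open>grid_norm_ip\<close>, so the symmetry relations carry no scaling.\<close>

definition ip :: "nat \<Rightarrow> grid \<Rightarrow> grid \<Rightarrow> real" where
  "ip N U V = (\<Sum>a<N. \<Sum>b<N. U a b * V a b)"

lemma ip_commute: "ip N U V = ip N V U"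
  by (simp add: ip_def mult.commute)

lemma ip_add_left: "ip N (\<lambda>a b. U a b + V a b) W = ip N U W + ip N V W"
  by (simp add: ip_def sum.distrib distrib_right)

lemma ip_cmult_left: "ip N (\<lambda>a b. r * U a b) W = r * ip N U W"
  by (simp add: ip_def sum_distrib_left mult.assoc)

lemma ip_add_right: "ip N W (\<lambda>a b. U a b + V a b) = ip N W U + ip N W V"
  by (simp add: ip_def sum.distrib distrib_left)

lemma ip_cmult_right: "ip N W (\<lambda>a b. r * U a b) = r * ip N W U"
  unfolding ip_commute[of N W] by (rule ip_cmult_left)

lemma ip_cong: "(\<And>a b. a < N \<Longrightarrow> b < N \<Longrightarrow> U a b = U' a b) \<Longrightarrow> ip N U V = ip N U' V"
  by (simp add: ip_def)

lemma ip_self_nonneg: "0 \<le> ip N U U"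
  unfolding ip_def by (intro sum_nonneg) auto

lemma ip_self: "ip N U U = (\<Sum>a<N. \<Sum>b<N. (U a b)\<^sup>2)"
  by (simp add: ip_def power2_eq_square)

lemma ip_pairs: "ip N U V = (\<Sum>z\<in>{..<N} \<times> {..<N}. U (fst z) (snd z) * V (fst z) (snd z))"
  by (simp add: ip_def sum.cartesian_product case_prod_unfold)

lemma grid_norm_ip: "grid_norm N U = hstep N * sqrt (ip N U U)"
  by (simp add: grid_norm_def ip_self real_sqrt_mult hstep_def)

lemma ip_Cauchy_Schwarz: "ip N U V \<le> sqrt (ip N U U) * sqrt (ip N V V)"
proof -
  have "(ip N U V)\<^sup>2 \<le> ip N U U * ip N V V"
    unfolding ip_pairs
    using Cauchy_Schwarz_ineq_sum[of "\<lambda>z. U (fst z) (snd z)" "\<lambda>z. V (fst z) (snd z)" "{..<N} \<times> {..<N}"]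
    by (simp add: power2_eq_square)
  then show ?thesis
    using real_le_rsqrt by (simp add: real_sqrt_mult[symmetric])
qed

lemma ip_applyX: "ip N (applyX N (Dmat N s) U) V = (- 1) ^ s * ip N U (applyX N (Dmat N s) V)"
proof -
  have "ip N (applyX N (Dmat N s) U) V = (\<Sum>a<N. \<Sum>b<N. \<Sum>k<N. Dmat N s a k * U k b * V a b)"
    by (simp add: ip_def applyX_def sum_distrib_right)
  also have "\<dots> = (\<Sum>a<N. \<Sum>k<N. \<Sum>b<N. Dmat N s a k * U k b * V a b)"
    by (intro sum.cong refl sum.swap)
  also have "\<dots> = (\<Sum>k<N. \<Sum>b<N. \<Sum>a<N. Dmat N s a k * U k b * V a b)"
    by (subst sum.swap) (intro sum.cong refl sum.swap)
  also have "\<dots> = (\<Sum>k<N. \<Sum>b<N. \<Sum>a<N. (- 1) ^ s * (U k b * (Dmat N s k a * V a b)))"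
    by (intro sum.cong refl) (subst Dmat_transpose, simp)
  also have "\<dots> = (- 1) ^ s * ip N U (applyX N (Dmat N s) V)"
    by (simp add: ip_def applyX_def sum_distrib_left)
  finally show ?thesis .
qed

lemma ip_applyY: "ip N (applyY N (Dmat N s) U) V = (- 1) ^ s * ip N U (applyY N (Dmat N s) V)"
proof -
  have "ip N (applyY N (Dmat N s) U) V = (\<Sum>a<N. \<Sum>b<N. \<Sum>k<N. Dmat N s b k * U a k * V a b)"
    by (simp add: ip_def applyY_def sum_distrib_right)
  also have "\<dots> = (\<Sum>a<N. \<Sum>k<N. \<Sum>b<N. Dmat N s b k * U a k * V a b)"
    by (intro sum.cong refl sum.swap)
  also have "\<dots> = (\<Sum>a<N. \<Sum>k<N. \<Sum>b<N. (- 1) ^ s * (U a k * (Dmat N s k b * V a b)))"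
    by (intro sum.cong refl) (subst Dmat_transpose, simp)
  also have "\<dots> = (- 1) ^ s * ip N U (applyY N (Dmat N s) V)"
    by (simp add: ip_def applyY_def sum_distrib_left)
  finally show ?thesis .
qed

lemma applyX_applyY: "applyX N P (applyY N Q V) = applyY N Q (applyX N P V)"
proof (intro ext)
  fix a b
  have "(\<Sum>k<N. \<Sum>l<N. P a k * (Q b l * V k l)) = (\<Sum>l<N. \<Sum>k<N. Q b l * (P a k * V k l))"
    by (subst sum.swap) (simp add: mult.left_commute)
  then show "applyX N P (applyY N Q V) a b = applyY N Q (applyX N P V) a b"
    by (simp add: applyX_def applyY_def sum_distrib_left)
qed

lemma ip_opA: "ip N (opA N U) V = ip N U (opA N V)"
  unfolding opA_def ip_add_left ip_add_right ip_applyX ip_applyY by simp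

lemma ip_opL: "ip N (opL N U) V = - ip N U (opL N V)"
  unfolding opL_def ip_add_left ip_add_right ip_applyX ip_applyY by simp

text \<open>The third-order part is skew by itself. The mixed part is a symmetric matrix times a
  skew one, acting on different indices; these commute, so the product is skew as well.\<close>

lemma ip_opB_self: "ip N (opB N V) V = 0"
proof -
  let ?X = "applyX N (Dmat N 1)" and ?Y = "applyY N (Dmat N 2)"
  have "ip N (applyX N (Dmat N 3) V) V = - ip N V (applyX N (Dmat N 3) V)"
    by (simp add: ip_applyX)
  then have "ip N (applyX N (Dmat N 3) V) V = 0" by (simp add: ip_commute)
  moreover have "ip N (?Y (?X V)) V = - ip N V (?Y (?X V))"
    unfolding ip_applyY ip_applyX applyX_applyY[symmetric] by simp
  then have "ip N (?Y (?X V)) V = 0" by (simp add: ip_commute)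
  ultimately show ?thesis unfolding opB_def ip_add_left by simp
qed

text \<open>Multiplication by \<open>W ^ p\<close> is symmetric and \<open>opL\<close> is skew, so
  the two halves of the symmetrised nonlinear term are negative transposes of each other and cancel
  in the quadratic form.\<close>

lemma ip_opD_self: "ip N (opD N p W V) V = 0"
proof -
  let ?WV = "\<lambda>a b. W a b ^ p * V a b"
  have "ip N (opL N V) V = - ip N (opL N V) V" using ip_opL[of N V V] by (simp add: ip_commute)
  then have L: "ip N (opL N V) V = 0" by simp
  have "ip N (\<lambda>a b. W a b ^ p * opL N V a b) V = ip N (opL N V) ?WV"
    by (simp add: ip_def mult_ac)
  also have "\<dots> = - ip N (opL N ?WV) V" using ip_opL[of N V ?WV] by (simp add: ip_commute)
  finally have "ip N (\<lambda>a b. W a b ^ p * opL N V a b) V + ip N (opL N ?WV) V = 0" by simp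
  then show ?thesis
    unfolding opD_def ip_add_left ip_cmult_left using L ip_opB_self by simp
qed

lemma applyX_diff: "applyX N P (\<lambda>a b. U a b - V a b) = (\<lambda>a b. applyX N P U a b - applyX N P V a b)"
  by (simp add: applyX_def right_diff_distrib sum_subtractf)

lemma applyY_diff: "applyY N P (\<lambda>a b. U a b - V a b) = (\<lambda>a b. applyY N P U a b - applyY N P V a b)"
  by (simp add: applyY_def right_diff_distrib sum_subtractf)

lemma applyX_cmult: "applyX N P (\<lambda>a b. r * U a b) = (\<lambda>a b. r * applyX N P U a b)"
  by (simp add: applyX_def sum_distrib_left mult.left_commute)

lemma applyY_cmult: "applyY N P (\<lambda>a b. r * U a b) = (\<lambda>a b. r * applyY N P U a b)"
  by (simp add: applyY_def sum_distrib_left mult.left_commute)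

lemma opA_diff: "opA N (\<lambda>a b. U a b - V a b) = (\<lambda>a b. opA N U a b - opA N V a b)"
  by (simp add: opA_def applyX_diff applyY_diff algebra_simps)

lemma opB_diff: "opB N (\<lambda>a b. U a b - V a b) = (\<lambda>a b. opB N U a b - opB N V a b)"
  by (simp add: opB_def applyX_diff applyY_diff algebra_simps)

lemma opL_diff: "opL N (\<lambda>a b. U a b - V a b) = (\<lambda>a b. opL N U a b - opL N V a b)"
  by (simp add: opL_def applyX_diff applyY_diff algebra_simps)

lemma opA_cmult: "opA N (\<lambda>a b. r * U a b) = (\<lambda>a b. r * opA N U a b)"
  by (simp add: opA_def applyX_cmult applyY_cmult algebra_simps)

lemma opB_cmult: "opB N (\<lambda>a b. r * U a b) = (\<lambda>a b. r * opB N U a b)"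
  by (simp add: opB_def applyX_cmult applyY_cmult algebra_simps)

lemma opL_cmult: "opL N (\<lambda>a b. r * U a b) = (\<lambda>a b. r * opL N U a b)"
  by (simp add: opL_def applyX_cmult applyY_cmult algebra_simps)

lemma opD_diff: "opD N p W (\<lambda>a b. U a b - V a b) = (\<lambda>a b. opD N p W U a b - opD N p W V a b)"
  by (simp add: opD_def opB_diff opL_diff right_diff_distrib algebra_simps)

lemma opD_cmult: "opD N p W (\<lambda>a b. r * U a b) = (\<lambda>a b. r * opD N p W U a b)"
proof -
  have "(\<lambda>a b. W a b ^ p * (r * U a b)) = (\<lambda>a b. r * (W a b ^ p * U a b))"
    by (simp add: mult.left_commute)
  then show ?thesis
    by (simp add: opD_def opB_cmult opL_cmult algebra_simps)
qed

lemma energy_estimate: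
  assumes \<tau>: "0 < \<tau>"
    and eq: "\<And>a b. a < N \<Longrightarrow> b < N \<Longrightarrow> (e a b + opA N (opA N e) a b) / \<tau> + opD N p W (\<lambda>a b. e a b / 2) a b = r a b"
  shows "sqrt (ip N e e + ip N (opA N e) (opA N e)) \<le> \<tau> * sqrt (ip N r r)"
proof -
  define S where "S = ip N e e + ip N (opA N e) (opA N e)"
  have S: "ip N e e \<le> S" "0 \<le> S" using ip_self_nonneg[of N e] ip_self_nonneg[of N "opA N e"] by (auto simp: S_def)
  have "opD N p W (\<lambda>a b. e a b / 2) = (\<lambda>a b. 1 / 2 * opD N p W e a b)"
    using opD_cmult[of N p W "1 / 2" e] by simp
  then have "ip N r e = ip N (\<lambda>a b. (1 / \<tau>) * (e a b + opA N (opA N e) a b) + 1 / 2 * opD N p W e a b) e"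
    using eq by (intro ip_cong) simp
  \<comment> \<open>Symmetry of \<open>opA\<close> turns its square into the squared norm of
    \<open>opA N e\<close>; the contribution of \<open>opD\<close> vanishes.\<close>
  also have "\<dots> = (1 / \<tau>) * S"
    unfolding ip_add_left ip_cmult_left ip_opD_self S_def ip_opA[of N "opA N e"] by simp
  finally have "S = \<tau> * ip N r e" using \<tau> by simp
  also have "\<dots> \<le> \<tau> * (sqrt (ip N r r) * sqrt (ip N e e))"
    using \<tau> by (intro mult_left_mono ip_Cauchy_Schwarz) auto
  also have "\<dots> \<le> \<tau> * (sqrt (ip N r r) * sqrt S)"
    using \<tau> S ip_self_nonneg by (intro mult_left_mono) auto
  finally have *: "sqrt S * sqrt S \<le> (\<tau> * sqrt (ip N r r)) * sqrt S" using S by (simp add: mult.assoc)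
  show ?thesis
  proof (cases "S = 0")
    case True
    then show ?thesis using \<tau> ip_self_nonneg by (simp add: S_def)
  next
    case False
    then have "0 < sqrt S" using S by simp
    with * show ?thesis unfolding S_def[symmetric] by (simp only: mult_le_cancel_right_pos)
  qed
qed

lemma grid_norm_L2: "grid_norm N U = hstep N * L2_set (\<lambda>z. U (fst z) (snd z)) ({..<N} \<times> {..<N})"
  by (simp add: grid_norm_ip ip_pairs L2_set_def power2_eq_square)

lemma grid_norm_triangle: "grid_norm N (\<lambda>a b. U a b + V a b) \<le> grid_norm N U + grid_norm N V"
  unfolding grid_norm_L2 distrib_left[symmetric]
  by (intro mult_left_mono L2_set_triangle_ineq) (simp add: hstep_def)

lemma grid_norm_nonneg: "0 \<le> grid_norm N U"
  by (simp add: grid_norm_ip ip_self_nonneg hstep_def)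

lemma grid_norm_mono:
  assumes "\<And>a b. a < N \<Longrightarrow> b < N \<Longrightarrow> \<bar>U a b\<bar> \<le> \<bar>V a b\<bar>"
  shows "grid_norm N U \<le> grid_norm N V"
  unfolding grid_norm_def using assms
  by (intro real_sqrt_le_mono mult_left_mono sum_mono) (auto simp: abs_le_square_iff)

lemma grid_norm_cmult: "grid_norm N (\<lambda>a b. r * U a b) = \<bar>r\<bar> * grid_norm N U"
  unfolding grid_norm_ip ip_cmult_left ip_cmult_right
  by (simp add: real_sqrt_mult flip: mult.assoc)

lemma grid_norm_le:
  assumes "N > 0" "0 \<le> K" "\<And>a b. a < N \<Longrightarrow> b < N \<Longrightarrow> \<bar>U a b\<bar> \<le> K"
  shows "grid_norm N U \<le> 2 * pi * K"
proof -
  have "grid_norm N U \<le> grid_norm N (\<lambda>a b. K)" by (rule grid_norm_mono) (use assms in auto)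
  also have "\<dots> = sqrt ((2 * pi * K)\<^sup>2)"
    unfolding grid_norm_def using assms(1) by (simp add: hstep_def power2_eq_square)
  also have "\<dots> = 2 * pi * K" using assms(2) by simp
  finally show ?thesis .
qed

lemma grid_norm_bounded_mult:
  assumes "0 \<le> G" "\<And>a b. a < N \<Longrightarrow> b < N \<Longrightarrow> \<bar>g a b\<bar> \<le> G"
  shows "grid_norm N (\<lambda>a b. g a b * U a b) \<le> G * grid_norm N U"
proof -
  have "grid_norm N (\<lambda>a b. g a b * U a b) \<le> grid_norm N (\<lambda>a b. G * U a b)"
    using assms by (intro grid_norm_mono) (auto simp: abs_mult intro: mult_right_mono)
  then show ?thesis using assms(1) by (simp add: grid_norm_cmult)
qed

section \<open>Five-point Laplacian and discrete Sobolev inequality\<close>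

lemma cis_grid_mod:
  assumes "N > 0"
  shows "cis (real_of_int m * (real (a mod N) * hstep N)) = cis (real_of_int m * (real a * hstep N))"
proof -
  have "real a = real (a mod N + N * (a div N))" by simp
  then have a: "real a = real (a mod N) + real N * real (a div N)" by (simp only: of_nat_add of_nat_mult)
  have "cis (real_of_int m * (real a * hstep N))
     = cis (real_of_int m * (real (a mod N) * hstep N)) * cis (2 * pi * real_of_int (m * int (a div N)))"
    unfolding a cis_mult by (rule arg_cong[of _ _ cis]) (use assms in \<open>simp add: hstep_def field_simps\<close>)
  also have "cis (2 * pi * real_of_int (m * int (a div N))) = 1"
    by (rule cis_multiple_2pi) (rule Ints_of_int)
  finally show ?thesis by simp
qed

text \<open>The eigenvalue of the periodic second difference, equal to -4 sin^2(m h / 2) / h^2; in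
  that form \<open>\<bar>sin x\<bar> \<le> \<bar>x\<bar>\<close> bounds it.\<close>

definition symH :: "nat \<Rightarrow> int \<Rightarrow> real" where
  "symH N m = (2 * cos (real_of_int m * hstep N) - 2) / (hstep N)\<^sup>2"

lemma symH_bound: "N > 0 \<Longrightarrow> \<bar>symH N m\<bar> \<le> (real_of_int m)\<^sup>2"
proof -
  assume N: "N > 0"
  let ?t = "real_of_int m * hstep N"
  have h: "0 < (hstep N)\<^sup>2" using N by (simp add: hstep_def)
  have "cos ?t = 1 - 2 * (sin (?t / 2))\<^sup>2" using cos_double_sin[of "?t / 2"] by simp
  then have "\<bar>2 * cos ?t - 2\<bar> = 4 * (sin (?t / 2))\<^sup>2" by simp
  also have "\<dots> \<le> 4 * (?t / 2)\<^sup>2"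
    using abs_sin_x_le_abs_x[of "?t / 2"] unfolding abs_le_square_iff by (intro mult_left_mono) auto
  also have "\<dots> = (real_of_int m)\<^sup>2 * (hstep N)\<^sup>2" by (simp add: power_mult_distrib power_divide)
  finally show ?thesis
    using h by (simp add: symH_def abs_divide pos_divide_le_eq)
qed

text \<open>The wrap-around of indices is invisible to grid exponentials, so passing to a neighbour
  multiplies a mode by a fixed phase; the two phases and the centre add up to
  \<open>symH\<close>.\<close>

lemma rep_lap_h:
  assumes N: "N > 0" and V: "rep N c V"
  shows "rep N (\<lambda>k. of_real (symH N (fst k) + symH N (snd k)) * c k) (lap_h N V)"
proof -
  let ?h = "hstep N"
  have mod: "x mod N < N" for x using N by simp
  have next_: "cis (real_of_int m * (real ((a + 1) mod N) * ?h)) = cis (real_of_int m * ?h) * cis (real_of_int m * (real a * ?h))"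
    and prev: "cis (real_of_int m * (real ((a + N - 1) mod N) * ?h)) = cis (- (real_of_int m * ?h)) * cis (real_of_int m * (real a * ?h))"
    if "a < N" for m a
  proof -
    show "cis (real_of_int m * (real ((a + 1) mod N) * ?h)) = cis (real_of_int m * ?h) * cis (real_of_int m * (real a * ?h))"
      unfolding cis_grid_mod[OF N] by (simp add: cis_mult algebra_simps)
    have "real (a + N - 1) = real a + real N - 1" using N by (simp add: of_nat_diff)
    then have "cis (real_of_int m * (real (a + N - 1) * ?h))
        = cis (- (real_of_int m * ?h)) * cis (real_of_int m * (real (a + N) * ?h))"
      by (simp add: cis_mult algebra_simps)
    moreover have "cis (real_of_int m * (real (a + N) * ?h)) = cis (real_of_int m * (real a * ?h))"
      using cis_grid_mod[OF N, of m "a + N"] cis_grid_mod[OF N, of m a] by simp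
    ultimately show "cis (real_of_int m * (real ((a + N - 1) mod N) * ?h)) = cis (- (real_of_int m * ?h)) * cis (real_of_int m * (real a * ?h))"
      unfolding cis_grid_mod[OF N] by simp
  qed
  have X: "rep N (\<lambda>k. of_real (symH N (fst k)) * c k)
      (\<lambda>a b. (1 / ?h\<^sup>2) * (V ((a + 1) mod N) b + (- 2) * V a b + V ((a + N - 1) mod N) b))"
  proof -
    have 1: "rep N (\<lambda>k. cis (real_of_int (fst k) * ?h) * c k) (\<lambda>a b. V ((a + 1) mod N) b)"
      unfolding rep_def
    proof (intro allI impI)
      fix a b assume "a < N" "b < N"
      then show "((\<lambda>k. cis (real_of_int (fst k) * ?h) * c k * ge N k a b) has_sum complex_of_real (V ((a + 1) mod N) b)) UNIV"
        using V[unfolded rep_def, rule_format, of "(a + 1) mod N" b] mod next_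
        by (simp add: ge_split mult_ac)
    qed
    have 2: "rep N (\<lambda>k. cis (- (real_of_int (fst k) * ?h)) * c k) (\<lambda>a b. V ((a + N - 1) mod N) b)"
      unfolding rep_def
    proof (intro allI impI)
      fix a b assume "a < N" "b < N"
      then show "((\<lambda>k. cis (- (real_of_int (fst k) * ?h)) * c k * ge N k a b) has_sum complex_of_real (V ((a + N - 1) mod N) b)) UNIV"
        using V[unfolded rep_def, rule_format, of "(a + N - 1) mod N" b] mod prev
        by (simp add: ge_split mult_ac)
    qed
    have "rep N (\<lambda>k. of_real (1 / ?h\<^sup>2) * (cis (real_of_int (fst k) * ?h) * c k + of_real (- 2) * c k + cis (- (real_of_int (fst k) * ?h)) * c k))
      (\<lambda>a b. (1 / ?h\<^sup>2) * (V ((a + 1) mod N) b + (- 2) * V a b + V ((a + N - 1) mod N) b))"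
      by (intro rep_cmult rep_add 1 2 V)
    moreover have "of_real (1 / ?h\<^sup>2) * (cis (real_of_int (fst k) * ?h) * c k + of_real (- 2) * c k + cis (- (real_of_int (fst k) * ?h)) * c k)
        = of_real (symH N (fst k)) * c k" for k
    proof -
      have "of_real (1 / ?h\<^sup>2) * (cis (real_of_int (fst k) * ?h) + of_real (- 2) + cis (- (real_of_int (fst k) * ?h))) = complex_of_real (symH N (fst k))"
        by (simp add: symH_def complex_eq_iff)
      then show ?thesis by (metis (no_types, opaque_lifting) distrib_right mult.assoc)
    qed
    ultimately show ?thesis by simp
  qed
  have Y: "rep N (\<lambda>k. of_real (symH N (snd k)) * c k)
      (\<lambda>a b. (1 / ?h\<^sup>2) * (V a ((b + 1) mod N) + (- 2) * V a b + V a ((b + N - 1) mod N)))"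
  proof -
    have 1: "rep N (\<lambda>k. cis (real_of_int (snd k) * ?h) * c k) (\<lambda>a b. V a ((b + 1) mod N))"
      unfolding rep_def
    proof (intro allI impI)
      fix a b assume "a < N" "b < N"
      then show "((\<lambda>k. cis (real_of_int (snd k) * ?h) * c k * ge N k a b) has_sum complex_of_real (V a ((b + 1) mod N))) UNIV"
        using V[unfolded rep_def, rule_format, of a "(b + 1) mod N"] mod next_
        by (simp add: ge_split mult_ac)
    qed
    have 2: "rep N (\<lambda>k. cis (- (real_of_int (snd k) * ?h)) * c k) (\<lambda>a b. V a ((b + N - 1) mod N))"
      unfolding rep_def
    proof (intro allI impI)
      fix a b assume "a < N" "b < N"
      then show "((\<lambda>k. cis (- (real_of_int (snd k) * ?h)) * c k * ge N k a b) has_sum complex_of_real (V a ((b + N - 1) mod N))) UNIV"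
        using V[unfolded rep_def, rule_format, of a "(b + N - 1) mod N"] mod prev
        by (simp add: ge_split mult_ac)
    qed
    have "rep N (\<lambda>k. of_real (1 / ?h\<^sup>2) * (cis (real_of_int (snd k) * ?h) * c k + of_real (- 2) * c k + cis (- (real_of_int (snd k) * ?h)) * c k))
      (\<lambda>a b. (1 / ?h\<^sup>2) * (V a ((b + 1) mod N) + (- 2) * V a b + V a ((b + N - 1) mod N)))"
      by (intro rep_cmult rep_add 1 2 V)
    moreover have "of_real (1 / ?h\<^sup>2) * (cis (real_of_int (snd k) * ?h) * c k + of_real (- 2) * c k + cis (- (real_of_int (snd k) * ?h)) * c k)
        = of_real (symH N (snd k)) * c k" for k
    proof -
      have "of_real (1 / ?h\<^sup>2) * (cis (real_of_int (snd k) * ?h) + of_real (- 2) + cis (- (real_of_int (snd k) * ?h))) = complex_of_real (symH N (snd k))"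
        by (simp add: symH_def complex_eq_iff)
      then show ?thesis by (metis (no_types, opaque_lifting) distrib_right mult.assoc)
    qed
    ultimately show ?thesis by simp
  qed
  show ?thesis
    unfolding of_real_add distrib_right
    by (rule rep_cong[OF rep_add[OF X Y]]) (simp add: lap_h_def add_divide_distrib diff_divide_distrib)
qed

text \<open>Both eigenvalues are nonpositive reals, so nothing cancels in \<open>symA\<close> and
  its modulus is the full squared length of the frequency.\<close>

lemma symA_freq:
  assumes "even N" "N > 0" "k \<in> freq N"
  shows "cmod (symA N k) = (real_of_int (fst k))\<^sup>2 + (real_of_int (snd k))\<^sup>2"
proof -
  have "symA N k = complex_of_real (- ((real_of_int (fst k))\<^sup>2 + (real_of_int (snd k))\<^sup>2))"
    using assms by (auto simp: symA_def freq_def lam_2)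
  then show ?thesis by (simp only: norm_of_real) simp
qed

lemma grid_norm_lap_h_le:
  assumes N: "N > 0" "even N"
  shows "grid_norm N (lap_h N e) \<le> grid_norm N (opA N e)"
proof -
  note r = rep_dft[OF N, of e]
  have "ip N (lap_h N e) (lap_h N e) = (real N)\<^sup>2 * (\<Sum>k\<in>freq N. (cmod (of_real (symH N (fst k) + symH N (snd k)) * dft N e k))\<^sup>2)"
    unfolding ip_self by (rule parseval[OF N rep_lap_h[OF N(1) r]]) (simp add: dft_def)
  also have "\<dots> \<le> (real N)\<^sup>2 * (\<Sum>k\<in>freq N. (cmod (symA N k * dft N e k))\<^sup>2)"
  proof (intro mult_left_mono sum_mono power_mono)
    fix k assume k: "k \<in> freq N"
    have "cmod (of_real (symH N (fst k) + symH N (snd k))) \<le> cmod (symA N k)"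
      unfolding symA_freq[OF N(2,1) k] norm_of_real
      using symH_bound[OF N(1), of "fst k"] symH_bound[OF N(1), of "snd k"] by linarith
    then show "cmod (of_real (symH N (fst k) + symH N (snd k)) * dft N e k) \<le> cmod (symA N k * dft N e k)"
      unfolding norm_mult by (intro mult_right_mono) auto
  qed auto
  also have "\<dots> = ip N (opA N e) (opA N e)"
    unfolding ip_self by (rule parseval[OF N rep_opA[OF N(1) r], symmetric]) (simp add: dft_def)
  finally show ?thesis
    unfolding grid_norm_ip by (intro mult_left_mono real_sqrt_le_mono) (auto simp: hstep_def)
qed

text \<open>On \<open>freq N\<close> one has
  \<open>jw k powr 2 \<le> 2 * (1 + (cmod (symA N k))\<^sup>2)\<close>, which converts the energy
  into a square sum with exponent \<open>2\<close>; as \<open>2 > 1\<close>, this controls the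
  absolute sum of the discrete coefficients.\<close>

lemma discrete_sobolev:
  obtains C where "0 \<le> C"
    "\<And>N e a b. \<lbrakk>N > 0; even N; a < N; b < N\<rbrakk>
       \<Longrightarrow> \<bar>e a b\<bar> \<le> C * (hstep N * sqrt (ip N e e + ip N (opA N e) (opA N e)))"
proof -
  obtain Z where Z: "0 \<le> Z" "\<And>c K. wl2 2 c K \<Longrightarrow> wl1 0 c (Z * K)"
    using wl2_imp_wl1[of 2 0] by auto
  \<comment> \<open>\<open>sqrt 2\<close> stems from the symbol bound, \<open>2 * pi\<close> from
    \<open>hstep N * real N\<close>.\<close>
  define C where "C = Z * (sqrt 2 / (2 * pi))"
  have C0: "0 \<le> C" using Z by (simp add: C_def)
  have "\<bar>e a b\<bar> \<le> C * (hstep N * sqrt (ip N e e + ip N (opA N e) (opA N e)))"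
    if N: "N > 0" "even N" and ab: "a < N" "b < N" for N e a b
  proof -
    define S where "S = ip N e e + ip N (opA N e) (opA N e)"
    have S: "0 \<le> S" using ip_self_nonneg[of N e] ip_self_nonneg[of N "opA N e"] by (simp add: S_def)
    note r = rep_dft[OF N, of e]
    have 1: "ip N e e = (real N)\<^sup>2 * (\<Sum>k\<in>freq N. (cmod (dft N e k))\<^sup>2)"
      unfolding ip_self by (rule parseval[OF N r]) (simp add: dft_def)
    have 2: "ip N (opA N e) (opA N e) = (real N)\<^sup>2 * (\<Sum>k\<in>freq N. (cmod (symA N k * dft N e k))\<^sup>2)"
      unfolding ip_self by (rule parseval[OF N rep_opA[OF N(1) r]]) (simp add: dft_def)
    have fr: "(\<Sum>k\<in>freq N. jw k powr 2 * (cmod (dft N e k))\<^sup>2) \<le> 2 * S / (real N)\<^sup>2"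
    proof -
      have "(\<Sum>k\<in>freq N. jw k powr 2 * (cmod (dft N e k))\<^sup>2)
         \<le> (\<Sum>k\<in>freq N. 2 * ((cmod (dft N e k))\<^sup>2 + (cmod (symA N k * dft N e k))\<^sup>2))"
      proof (rule sum_mono)
        fix k assume k: "k \<in> freq N"
        let ?n = "(real_of_int (fst k))\<^sup>2 + (real_of_int (snd k))\<^sup>2"
        have "jw k powr 2 = (1 + ?n)\<^sup>2" by (simp add: jw_def add.assoc)
        also have "\<dots> \<le> 2 * (1 + ?n\<^sup>2)"
          using sum_squares_bound[of 1 ?n] by (simp add: power2_sum)
        finally have "jw k powr 2 * (cmod (dft N e k))\<^sup>2 \<le> 2 * (1 + ?n\<^sup>2) * (cmod (dft N e k))\<^sup>2"
          by (rule mult_right_mono) simp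
        then show "jw k powr 2 * (cmod (dft N e k))\<^sup>2 \<le> 2 * ((cmod (dft N e k))\<^sup>2 + (cmod (symA N k * dft N e k))\<^sup>2)"
          unfolding norm_mult symA_freq[OF N(2,1) k] power_mult_distrib by (simp add: algebra_simps)
      qed
      also have "\<dots> = 2 * S / (real N)\<^sup>2"
        unfolding S_def 1 2 using N by (simp add: sum.distrib sum_distrib_left[symmetric] field_simps)
      finally show ?thesis .
    qed
    have "wl2 2 (dft N e) (sqrt 2 * sqrt S / real N)"
      unfolding wl2_def
    proof (intro conjI allI impI)
      fix F :: "(int \<times> int) set" assume F: "finite F"
      have "(\<Sum>k\<in>F. jw k powr 2 * (cmod (dft N e k))\<^sup>2) = (\<Sum>k\<in>F \<inter> freq N. jw k powr 2 * (cmod (dft N e k))\<^sup>2)"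
        by (rule sum.mono_neutral_right) (use F in \<open>auto simp: dft_def\<close>)
      also have "\<dots> \<le> (\<Sum>k\<in>freq N. jw k powr 2 * (cmod (dft N e k))\<^sup>2)"
        by (rule sum_mono2) auto
      also have "\<dots> \<le> 2 * S / (real N)\<^sup>2" by (rule fr)
      also have "\<dots> = (sqrt 2 * sqrt S / real N)\<^sup>2"
        using S by (simp add: power_mult_distrib power_divide)
      finally show "(\<Sum>k\<in>F. jw k powr 2 * (cmod (dft N e k))\<^sup>2) \<le> (sqrt 2 * sqrt S / real N)\<^sup>2" .
    qed (use S in simp)
    then have "\<bar>e a b\<bar> \<le> Z * (sqrt 2 * sqrt S / real N)"
      using rep_bound[OF r Z(2) ab] by blast
    also have "\<dots> = C * (hstep N * sqrt S)"
      using N by (simp add: C_def hstep_def)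
    finally show ?thesis by (simp add: S_def)
  qed
  with C0 that show ?thesis by blast
qed

section \<open>Fourier coefficients along the time variable\<close>

definition cf :: "(real \<Rightarrow> real \<Rightarrow> real) \<Rightarrow> int \<times> int \<Rightarrow> complex" where
  "cf v k = fcoef v (fst k) (snd k)"

lemma wl2_L2: "wl2 r c K \<longleftrightarrow> 0 \<le> K \<and> (\<forall>F. finite F \<longrightarrow> L2_set (\<lambda>k. jw k powr (r / 2) * cmod (c k)) F \<le> K)"
proof -
  have "(\<Sum>k\<in>F. jw k powr r * (cmod (c k))\<^sup>2) \<le> K\<^sup>2 \<longleftrightarrow> L2_set (\<lambda>k. jw k powr (r / 2) * cmod (c k)) F \<le> K"
    if "0 \<le> K" for F
  proof -
    have "L2_set (\<lambda>k. jw k powr (r / 2) * cmod (c k)) F = sqrt (\<Sum>k\<in>F. jw k powr r * (cmod (c k))\<^sup>2)"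
      unfolding L2_set_def power_mult_distrib powr_sq by simp
    then show ?thesis using that by (auto intro: real_le_lsqrt dest: sqrt_le_D)
  qed
  then show ?thesis unfolding wl2_def by blast
qed

lemma wl2_add:
  assumes "wl2 r a K" "wl2 r b L"
  shows "wl2 r (\<lambda>k. a k + b k) (K + L)"
  unfolding wl2_L2
proof (intro conjI allI impI)
  show "0 \<le> K + L" using assms by (simp add: wl2_def)
  fix F :: "(int \<times> int) set" assume F: "finite F"
  have "L2_set (\<lambda>k. jw k powr (r / 2) * cmod (a k + b k)) F
      \<le> L2_set (\<lambda>k. jw k powr (r / 2) * cmod (a k) + jw k powr (r / 2) * cmod (b k)) F"
    unfolding distrib_left[symmetric] by (intro L2_set_mono mult_left_mono norm_triangle_ineq) auto
  also have "\<dots> \<le> L2_set (\<lambda>k. jw k powr (r / 2) * cmod (a k)) F + L2_set (\<lambda>k. jw k powr (r / 2) * cmod (b k)) F"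
    by (rule L2_set_triangle_ineq)
  also have "\<dots> \<le> K + L" using assms F unfolding wl2_L2 by (intro add_mono) auto
  finally show "L2_set (\<lambda>k. jw k powr (r / 2) * cmod (a k + b k)) F \<le> K + L" .
qed

lemma wl2_cmult: "wl2 r c K \<Longrightarrow> wl2 r (\<lambda>k. z * c k) (cmod z * K)"
  using wl2_multiplier[of r 0 c K "\<lambda>_. z" "cmod z"] by simp

lemma wl2_mono: "wl2 r c K \<Longrightarrow> K \<le> L \<Longrightarrow> wl2 r c L"
  unfolding wl2_L2 by force

lemma wl2_summable: "wl2 r c K \<Longrightarrow> (\<lambda>k. jw k powr r * (cmod (c k))\<^sup>2) summable_on UNIV"
  by (rule nonneg_bdd_above_summable_on) (auto simp: wl2_def bdd_above_def)

lemma wl2_coef_le: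
  assumes "wl2 r c K" "0 \<le> r"
  shows "cmod (c k) \<le> K"
proof -
  have "L2_set (\<lambda>k. jw k powr (r / 2) * cmod (c k)) F \<le> K" if "finite F" for F
    using assms(1) that unfolding wl2_L2 by blast
  from this[of "{k}"] have "jw k powr (r / 2) * cmod (c k) \<le> K" by simp
  moreover have "1 * cmod (c k) \<le> jw k powr (r / 2) * cmod (c k)"
    using assms(2) by (intro mult_right_mono ge_one_powr_ge_zero jw_ge_1) auto
  ultimately show ?thesis by simp
qed

section \<open>Coefficients of Sobolev functions and their time derivatives\<close>

lemma hs_weight_eq: "hs_weight r v = (\<lambda>k. jw k powr r * (cmod (cf v k))\<^sup>2)"
  by (auto simp: hs_weight_def jw_def cf_def)

lemma in_Hp_wl2: "in_Hp r v \<Longrightarrow> wl2 r (cf v) (hs_norm r v)"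
  using summable_wl2[of r "cf v"] by (simp add: in_Hp_def hs_norm_def hs_weight_eq)

text \<open>Square integrability yields an integrable majorant on the bounded cell through
  \<open>\<bar>x\<bar> \<le> 1 + x\<^sup>2\<close>. Integrability is what makes the coefficients
  linear in the function.\<close>

lemma in_Hp_integrable:
  assumes "in_Hp r v"
  shows "(\<lambda>z. complex_of_real (v (fst z) (snd z)) * cis (- (of_int k1 * fst z + of_int k2 * snd z))) integrable_on cell"
proof (rule measurable_bounded_by_integrable_imp_integrable)
  have cell: "cell \<in> sets lebesgue" by (simp add: cell_def)
  then show "cell \<in> sets lebesgue" .
  have "(\<lambda>z. v (fst z) (snd z)) \<in> borel_measurable (lebesgue_on cell)"
    using assms measurable_on_iff_borel_measurable[OF cell] by (auto simp: in_Hp_def)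
  moreover have "(\<lambda>z. cis (- (of_int k1 * fst z + of_int k2 * snd z))) \<in> borel_measurable (lebesgue_on cell)"
    by (intro continuous_imp_measurable_on_sets_lebesgue[OF _ cell] continuous_intros)
  ultimately have "(\<lambda>z. v (fst z) (snd z) *\<^sub>R cis (- (of_int k1 * fst z + of_int k2 * snd z))) \<in> borel_measurable (lebesgue_on cell)"
    by (rule borel_measurable_scaleR)
  then show "(\<lambda>z. complex_of_real (v (fst z) (snd z)) * cis (- (of_int k1 * fst z + of_int k2 * snd z))) \<in> borel_measurable (lebesgue_on cell)"
    by (simp add: scaleR_conv_of_real)
  show "(\<lambda>z. 1 + (v (fst z) (snd z))\<^sup>2) integrable_on cell"
    using assms by (intro integrable_add) (auto simp: in_Hp_def cell_def integrable_const)
  show "norm (complex_of_real (v (fst z) (snd z)) * cis (- (of_int k1 * fst z + of_int k2 * snd z))) \<le> 1 + (v (fst z) (snd z))\<^sup>2" for z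
  proof -
    have "\<bar>x\<bar> \<le> 1 + x\<^sup>2" for x :: real
      using sum_squares_bound[of 1 "\<bar>x\<bar>"] by simp
    then show ?thesis by (simp add: norm_mult)
  qed
qed

lemma cf_diff:
  assumes "in_Hp r f" "in_Hp r g"
  shows "cf (\<lambda>x y. f x y - g x y) k = cf f k - cf g k"
  unfolding cf_def fcoef_def of_real_diff left_diff_distrib diff_divide_distrib[symmetric]
  by (subst integral_diff[OF in_Hp_integrable[OF assms(1)] in_Hp_integrable[OF assms(2)]]) simp

lemma cf_quotient:
  assumes "in_Hp r f" "in_Hp r g" "in_Hp r h"
  shows "cf (\<lambda>x y. (f x y - g x y) / d - h x y) k = of_real (1 / d) * (cf f k - cf g k) - cf h k"
proof -
  let ?i = "\<lambda>f z. complex_of_real (f (fst z) (snd z)) * cis (- (real_of_int (fst k) * fst z + real_of_int (snd k) * snd z))"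
  note i = in_Hp_integrable[OF assms(1), THEN integrable_integral] in_Hp_integrable[OF assms(2), THEN integrable_integral]
    in_Hp_integrable[OF assms(3), THEN integrable_integral]
  have "((\<lambda>z. of_real (1 / d) * (?i f z - ?i g z) - ?i h z) has_integral
      of_real (1 / d) * (integral cell (?i f) - integral cell (?i g)) - integral cell (?i h)) cell"
    by (intro has_integral_diff has_integral_mult_right i)
  moreover have "of_real (1 / d) * (?i f z - ?i g z) - ?i h z = ?i (\<lambda>x y. (f x y - g x y) / d - h x y) z" for z
    by (simp add: algebra_simps diff_divide_distrib)
  ultimately have "integral cell (?i (\<lambda>x y. (f x y - g x y) / d - h x y))
     = of_real (1 / d) * (integral cell (?i f) - integral cell (?i g)) - integral cell (?i h)"
    by (simp add: integral_unique)
  then show ?thesis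
    unfolding cf_def fcoef_def by (simp only:) (simp add: diff_divide_distrib right_diff_distrib)
qed

text \<open>An unsummable \<open>infsum\<close> has the default value zero, so
  \<open>hs_norm\<close> bounds the coefficients only once summability is known. The triangle
  inequality supplies it with a crude bound; the sharp bound is then read off.\<close>

lemma wl2_hs_norm_quotient:
  assumes "in_Hp r f" "in_Hp r g" "in_Hp r h"
  shows "wl2 r (\<lambda>k. of_real (1 / d) * (cf f k - cf g k) - cf h k) (hs_norm r (\<lambda>x y. (f x y - g x y) / d - h x y))"
proof -
  have "wl2 r (\<lambda>k. of_real (1 / d) * (cf f k + (- 1) * cf g k) + (- 1) * cf h k)
     (cmod (of_real (1 / d)) * (hs_norm r f + cmod (- 1) * hs_norm r g) + cmod (- 1) * hs_norm r h)"
    by (intro wl2_add wl2_cmult in_Hp_wl2 assms)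
  then have "(\<lambda>k. jw k powr r * (cmod (cf (\<lambda>x y. (f x y - g x y) / d - h x y) k))\<^sup>2) summable_on UNIV"
    using wl2_summable by (simp add: cf_quotient[OF assms])
  from summable_wl2[OF this] show ?thesis
    by (simp add: hs_norm_def hs_weight_eq cf_quotient[OF assms])
qed

lemma wl2_hs_norm_diff:
  assumes "in_Hp r f" "in_Hp r g"
  shows "wl2 r (\<lambda>k. cf f k - cf g k) (hs_norm r (\<lambda>x y. f x y - g x y))"
proof -
  have "wl2 r (\<lambda>k. cf f k + (- 1) * cf g k) (hs_norm r f + cmod (- 1) * hs_norm r g)"
    by (intro wl2_add wl2_cmult in_Hp_wl2 assms)
  then have "(\<lambda>k. jw k powr r * (cmod (cf (\<lambda>x y. f x y - g x y) k))\<^sup>2) summable_on UNIV"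
    using wl2_summable by (simp add: cf_diff[OF assms])
  from summable_wl2[OF this] show ?thesis
    by (simp add: hs_norm_def hs_weight_eq cf_diff[OF assms])
qed

text \<open>A single coefficient is dominated by the norm, so convergence of difference quotients in
  norm differentiates every coefficient. Real and imaginary parts are separated for the scalar mean
  value theorem.\<close>

lemma Hs_deriv_cf:
  assumes r: "0 \<le> r" and H: "Hs_deriv r T f f' t" and t: "t \<in> {0..T}"
    and f: "\<And>t. t \<in> {0..T} \<Longrightarrow> in_Hp r (\<lambda>x y. f x y t)" and f': "in_Hp r (\<lambda>x y. f' x y t)"
  shows "((\<lambda>t. Re (cf (\<lambda>x y. f x y t) k)) has_real_derivative Re (cf (\<lambda>x y. f' x y t) k)) (at t within {0..T})"
    and "((\<lambda>t. Im (cf (\<lambda>x y. f x y t) k)) has_real_derivative Im (cf (\<lambda>x y. f' x y t) k)) (at t within {0..T})"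
proof -
  let ?c = "\<lambda>t. cf (\<lambda>x y. f x y t) k" and ?c' = "cf (\<lambda>x y. f' x y t) k"
  have "((\<lambda>t'. of_real (1 / (t' - t)) * (?c t' - ?c t) - ?c') \<longlongrightarrow> 0) (at t within {0..T})"
  proof (rule Lim_null_comparison[OF _ H[unfolded Hs_deriv_def]])
    show "\<forall>\<^sub>F t' in at t within {0..T}. cmod (of_real (1 / (t' - t)) * (?c t' - ?c t) - ?c')
        \<le> hs_norm r (\<lambda>x y. (f x y t' - f x y t) / (t' - t) - f' x y t)"
      unfolding eventually_at_filter
    proof (rule always_eventually, intro allI impI)
      fix t' assume "t' \<in> {0..T}"
      then show "cmod (of_real (1 / (t' - t)) * (?c t' - ?c t) - ?c')
        \<le> hs_norm r (\<lambda>x y. (f x y t' - f x y t) / (t' - t) - f' x y t)"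
        by (rule wl2_coef_le[OF wl2_hs_norm_quotient[OF f f[OF t] f'] r])
    qed
  qed
  then have lim: "((\<lambda>t'. of_real (1 / (t' - t)) * (?c t' - ?c t)) \<longlongrightarrow> ?c') (at t within {0..T})"
    by (simp add: LIM_zero_iff)
  show "((\<lambda>t. Re (?c t)) has_real_derivative Re ?c') (at t within {0..T})"
    using tendsto_Re[OF lim] by (simp add: has_field_derivative_iff)
  show "((\<lambda>t. Im (?c t)) has_real_derivative Im ?c') (at t within {0..T})"
    using tendsto_Im[OF lim] by (simp add: has_field_derivative_iff)
qed

text \<open>The mean value inequality in the weighted space follows from the scalar mean value theorem
  for the pairing with the increment itself, truncated to finitely many modes.\<close>

lemma wl2_mean_value:
  fixes c c' :: "real \<Rightarrow> int \<times> int \<Rightarrow> complex"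
  assumes \<tau>: "0 < \<tau>" and B: "\<And>t. t \<in> {0..\<tau>} \<Longrightarrow> wl2 r (c' t) B"
    and Re: "\<And>t k. t \<in> {0..\<tau>} \<Longrightarrow> ((\<lambda>t. Re (c t k)) has_real_derivative Re (c' t k)) (at t within {0..\<tau>})"
    and Im: "\<And>t k. t \<in> {0..\<tau>} \<Longrightarrow> ((\<lambda>t. Im (c t k)) has_real_derivative Im (c' t k)) (at t within {0..\<tau>})"
  shows "wl2 r (\<lambda>k. c \<tau> k - c 0 k) (B * \<tau>)"
  unfolding wl2_L2
proof (intro conjI allI impI)
  have B0: "0 \<le> B" using B[of 0] \<tau> by (simp add: wl2_def)
  then show "0 \<le> B * \<tau>" using \<tau> by simp
  fix F :: "(int \<times> int) set" assume F: "finite F"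
  define a where "a k = c \<tau> k - c 0 k" for k
  define g where "g t = (\<Sum>k\<in>F. jw k powr r * (Re (a k) * Re (c t k) + Im (a k) * Im (c t k)))" for t
  define g' where "g' t = (\<Sum>k\<in>F. jw k powr r * (Re (a k) * Re (c' t k) + Im (a k) * Im (c' t k)))" for t
  define A where "A = L2_set (\<lambda>k. jw k powr (r / 2) * cmod (a k)) F"
  have A0: "0 \<le> A" by (simp add: A_def)
  have g: "(g has_real_derivative g' t) (at t within {0..\<tau>})" if "t \<in> {0..\<tau>}" for t
    unfolding g_def g'_def using Re[OF that] Im[OF that]
    by (intro DERIV_sum DERIV_cmult DERIV_add) auto
  have "\<exists>t\<in>{0<..<\<tau>}. g \<tau> - g 0 = g' t * (\<tau> - 0)"
    using g by (intro mvt_simple[OF \<tau>, of g "\<lambda>t. (*) (g' t)"]) (auto simp: has_field_derivative_def)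
  then obtain t where "t \<in> {0<..<\<tau>}" "g \<tau> - g 0 = g' t * (\<tau> - 0)" by blast
  then have t: "t \<in> {0..\<tau>}" "g \<tau> - g 0 = g' t * \<tau>" by auto
  have "g \<tau> - g 0 = (\<Sum>k\<in>F. jw k powr r * (cmod (a k))\<^sup>2)"
    unfolding g_def sum_subtractf[symmetric] cmod_power2
    by (intro sum.cong refl) (simp add: a_def power2_eq_square algebra_simps)
  also have "\<dots> = A\<^sup>2"
    unfolding A_def L2_set_def power_mult_distrib powr_sq by (simp add: sum_nonneg)
  finally have "A\<^sup>2 = g' t * \<tau>" using t by simp
  moreover have "g' t \<le> A * B"
  proof -
    have "g' t \<le> (\<Sum>k\<in>F. \<bar>jw k powr (r / 2) * cmod (a k)\<bar> * \<bar>jw k powr (r / 2) * cmod (c' t k)\<bar>)"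
      unfolding g'_def
    proof (rule sum_mono)
      fix k
      have "Re (a k) * Re (c' t k) + Im (a k) * Im (c' t k) = Re (cnj (a k) * c' t k)" by simp
      also have "\<dots> \<le> cmod (cnj (a k) * c' t k)" by (rule complex_Re_le_cmod)
      also have "\<dots> = cmod (a k) * cmod (c' t k)" by (simp add: norm_mult)
      finally have "jw k powr r * (Re (a k) * Re (c' t k) + Im (a k) * Im (c' t k)) \<le> jw k powr r * (cmod (a k) * cmod (c' t k))"
        by (intro mult_left_mono) auto
      also have "\<dots> = \<bar>jw k powr (r / 2) * cmod (a k)\<bar> * \<bar>jw k powr (r / 2) * cmod (c' t k)\<bar>"
      proof -
        have "jw k powr r = jw k powr (r / 2) * jw k powr (r / 2)" by (simp flip: powr_add)
        then show ?thesis by (simp add: abs_mult)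
      qed
      finally show "jw k powr r * (Re (a k) * Re (c' t k) + Im (a k) * Im (c' t k))
          \<le> \<bar>jw k powr (r / 2) * cmod (a k)\<bar> * \<bar>jw k powr (r / 2) * cmod (c' t k)\<bar>" .
    qed
    also have "\<dots> \<le> A * L2_set (\<lambda>k. jw k powr (r / 2) * cmod (c' t k)) F"
      unfolding A_def by (rule L2_set_mult_ineq)
    also have "\<dots> \<le> A * B"
      using B[OF t(1)] F A0 by (intro mult_left_mono) (auto simp: wl2_L2)
    finally show ?thesis .
  qed
  ultimately have "A * A \<le> (B * \<tau>) * A"
    using \<tau> mult_right_mono[of "g' t" "A * B" \<tau>] by (simp add: power2_eq_square mult_ac)
  then have "A \<le> B * \<tau>"
    using A0 B0 \<tau> by (cases "A = 0") (auto simp: mult_le_cancel_right)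
  then show "L2_set (\<lambda>k. jw k powr (r / 2) * cmod (c \<tau> k - c 0 k)) F \<le> B * \<tau>"
    by (simp add: A_def a_def)
qed

section \<open>Spatial operators at fixed time and their symbols\<close>

definition dX :: "(real \<Rightarrow> real \<Rightarrow> real) \<Rightarrow> real \<Rightarrow> real \<Rightarrow> real" where
  "dX f = (\<lambda>x y. deriv (\<lambda>\<xi>. f \<xi> y) x)"

definition dY :: "(real \<Rightarrow> real \<Rightarrow> real) \<Rightarrow> real \<Rightarrow> real \<Rightarrow> real" where
  "dY f = (\<lambda>x y. deriv (\<lambda>\<eta>. f x \<eta>) y)"

definition lap2 :: "(real \<Rightarrow> real \<Rightarrow> real) \<Rightarrow> real \<Rightarrow> real \<Rightarrow> real" where
  "lap2 f = (\<lambda>x y. dX (dX f) x y + dY (dY f) x y)"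

lemma cmod_freq_le:
  "cmod (\<i> * of_int (fst k)) \<le> 1 * jw k powr (1/2)" "cmod (\<i> * of_int (snd k)) \<le> 1 * jw k powr (1/2)"
  using abs_freq_le[of k] by (simp_all add: norm_mult)

lemma fser_dX: "fser c f \<Longrightarrow> wl1 (1/2) c K \<Longrightarrow> fser (\<lambda>k. \<i> * of_int (fst k) * c k) (dX f)"
  unfolding dX_def by (rule fser_dx(2))

lemma fser_dY: "fser c f \<Longrightarrow> wl1 (1/2) c K \<Longrightarrow> fser (\<lambda>k. \<i> * of_int (snd k) * c k) (dY f)"
  unfolding dY_def by (rule fser_dy(2))

lemma wl1_dX: "wl1 (r + 1/2) c K \<Longrightarrow> wl1 r (\<lambda>k. \<i> * of_int (fst k) * c k) K"
  using wl1_multiplier[of r "1/2" c K "\<lambda>k. \<i> * of_int (fst k)" 1] cmod_freq_le by simp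

lemma wl1_dY: "wl1 (r + 1/2) c K \<Longrightarrow> wl1 r (\<lambda>k. \<i> * of_int (snd k) * c k) K"
  using wl1_multiplier[of r "1/2" c K "\<lambda>k. \<i> * of_int (snd k)" 1] cmod_freq_le by simp

text \<open>The symbol, minus the squared length of the frequency, is written as
  \<open>1 - jw k\<close> so that its size is read off directly against the weight.\<close>

lemma fser_lap2:
  assumes f: "fser c f" and c: "wl1 1 c K"
  shows "fser (\<lambda>k. of_real (1 - jw k) * c k) (lap2 f)"
proof -
  have c1: "wl1 (1/2) c K" by (rule wl1_mono[OF c]) auto
  have c2: "wl1 (1/2 + 1/2) c K" using c by simp
  have "fser (\<lambda>k. \<i> * of_int (fst k) * (\<i> * of_int (fst k) * c k) + \<i> * of_int (snd k) * (\<i> * of_int (snd k) * c k))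
     (\<lambda>x y. dX (dX f) x y + dY (dY f) x y)"
    by (intro fser_add fser_dX[OF fser_dX[OF f c1] wl1_dX[OF c2]] fser_dY[OF fser_dY[OF f c1] wl1_dY[OF c2]])
  moreover have "\<i> * of_int (fst k) * (\<i> * of_int (fst k) * c k) + \<i> * of_int (snd k) * (\<i> * of_int (snd k) * c k)
      = of_real (1 - jw k) * c k" for k
    by (simp add: jw_def power2_eq_square algebra_simps)
  ultimately show ?thesis unfolding lap2_def by simp
qed

lemma wl1_lap2: "wl1 (r + 1) c K \<Longrightarrow> wl1 r (\<lambda>k. of_real (1 - jw k) * c k) K"
  using wl1_multiplier[of r 1 c K "\<lambda>k. of_real (1 - jw k)" 1] jw_ge_1 by (simp flip: of_real_diff add: norm_of_real)

lemma fser_bilap: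
  assumes f: "fser c f" and c: "wl1 2 c K"
  shows "fser (\<lambda>k. of_real ((1 - jw k)\<^sup>2) * c k) (lap2 (lap2 f))"
proof -
  have c1: "wl1 1 c K" by (rule wl1_mono[OF c]) auto
  have c2: "wl1 (1 + 1) c K" using c by simp
  have "fser (\<lambda>k. of_real (1 - jw k) * (of_real (1 - jw k) * c k)) (lap2 (lap2 f))"
    by (rule fser_lap2[OF fser_lap2[OF f c1] wl1_lap2[OF c2]])
  then show ?thesis by (simp add: power2_eq_square mult.assoc)
qed

lemma fser_dX_lap2:
  assumes f: "fser c f" and c: "wl1 2 c K"
  shows "fser (\<lambda>k. \<i> * of_int (fst k) * of_real (1 - jw k) * c k) (dX (lap2 f))"
proof -
  have c1: "wl1 1 c K" and c32: "wl1 (1/2 + 1) c K" by (rule wl1_mono[OF c]; simp)+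
  show ?thesis
    using fser_dX[OF fser_lap2[OF f c1] wl1_lap2[OF c32]] by (simp add: mult.assoc)
qed

lemma has_sum_minus:
  fixes f g :: "'a \<Rightarrow> complex"
  assumes "(f has_sum a) A" "(g has_sum b) A"
  shows "((\<lambda>k. f k - g k) has_sum (a - b)) A"
  using has_sum_add[OF assms(1) has_sum_cmult_right[OF assms(2), of "- 1"]] by simp

lemma fser_diff: "fser a f \<Longrightarrow> fser b g \<Longrightarrow> fser (\<lambda>k. a k - b k) (\<lambda>x y. f x y - g x y)"
  using fser_add[of a f "\<lambda>k. of_real (- 1) * b k" "\<lambda>x y. - 1 * g x y"] fser_cmult[of b g "- 1"] by simp

text \<open>A multiplier of order at most \<open>2\<close> in \<open>jw\<close> covers up to four
  spatial derivatives. The Lipschitz bound on the coefficients becomes a bound \<open>L * t\<close>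
  uniform in the point, so each differentiated term converges as time tends to zero.\<close>

lemma fser_tendsto:
  assumes f: "\<And>t. t \<in> {0..\<delta>} \<Longrightarrow> fser (\<lambda>k. m k * b t k) (f t)"
    and m: "\<And>k. cmod (m k) \<le> 1 * jw k powr 2"
    and b: "\<And>t. t \<in> {0<..\<delta>} \<Longrightarrow> wl1 2 (\<lambda>k. b t k - b 0 k) (L * t)" and \<delta>: "0 < \<delta>"
  shows "((\<lambda>t. f t x y) \<longlongrightarrow> f 0 x y) (at_right 0)"
proof -
  have "((\<lambda>t. f t x y - f 0 x y) \<longlongrightarrow> 0) (at_right 0)"
  proof (rule Lim_null_comparison)
    show "\<forall>\<^sub>F t in at_right 0. norm (f t x y - f 0 x y) \<le> L * t"
      unfolding eventually_at_right[OF \<delta>]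
    proof (intro exI[of _ \<delta>] conjI \<delta> allI impI)
      fix t assume t: "0 < t" "t < \<delta>"
      have "fser (\<lambda>k. m k * b t k - m k * b 0 k) (\<lambda>x y. f t x y - f 0 x y)"
        using t by (intro fser_diff f) auto
      then have "fser (\<lambda>k. m k * (b t k - b 0 k)) (\<lambda>x y. f t x y - f 0 x y)"
        by (simp add: right_diff_distrib)
      moreover have "wl1 0 (\<lambda>k. m k * (b t k - b 0 k)) (1 * (L * t))"
        using t b[of t] by (intro wl1_multiplier[OF _ m]) auto
      ultimately show "norm (f t x y - f 0 x y) \<le> L * t"
        using fser_bound by fastforce
    qed
    show "((\<lambda>t. L * t) \<longlongrightarrow> 0) (at_right 0)" by (auto intro!: tendsto_eq_intros)
  qed
  then show ?thesis by (simp add: LIM_zero_iff)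
qed

lemma symbol_bounds:
  shows "cmod 1 \<le> 1 * jw k powr 2"
    and "cmod (of_real ((1 - jw k)\<^sup>2)) \<le> 1 * jw k powr 2"
    and "cmod (\<i> * of_int (fst k) * of_real (1 - jw k)) \<le> 1 * jw k powr 2"
    and "cmod (\<i> * of_int (fst k)) \<le> 1 * jw k powr 2"
    and "cmod (\<i> * of_int (snd k)) \<le> 1 * jw k powr 2"
proof -
  have le: "jw k powr a \<le> jw k powr 2" if "a \<le> 2" for a
    using that jw_ge_1 by (intro powr_mono) auto
  have j: "\<bar>1 - jw k\<bar> \<le> jw k" using jw_ge_1[of k] by simp
  show "cmod 1 \<le> 1 * jw k powr 2" using le[of 0] by simp
  show "cmod (of_real ((1 - jw k)\<^sup>2)) \<le> 1 * jw k powr 2"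
    using j by (simp add: abs_le_square_iff[symmetric] del: of_real_power)
  show "cmod (\<i> * of_int (fst k)) \<le> 1 * jw k powr 2" "cmod (\<i> * of_int (snd k)) \<le> 1 * jw k powr 2"
    using cmod_freq_le[of k] le[of "1/2"] by auto
  have "cmod (\<i> * of_int (fst k) * of_real (1 - jw k)) \<le> jw k powr (1/2) * jw k powr 1"
    unfolding norm_mult[of "\<i> * of_int (fst k)"] norm_of_real
    using cmod_freq_le(1)[of k] j by (intro mult_mono) auto
  also have "\<dots> = jw k powr (3/2)" unfolding powr_add[symmetric] by simp
  finally show "cmod (\<i> * of_int (fst k) * of_real (1 - jw k)) \<le> 1 * jw k powr 2"
    using le[of "3/2"] by simp
qed

section \<open>Pointwise time derivative and Taylor expansion\<close>

lemma wl2_zero: "0 \<le> K \<Longrightarrow> wl2 r (\<lambda>_. 0) K"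
  by (simp add: wl2_def)

text \<open>\<open>u1\<close> is determined only up to null sets, so its point values carry no
  information. \<open>V\<close> is the sum of its Fourier series; as the weighted norm controls such
  sums uniformly, the difference quotients of \<open>u\<close> converge to \<open>V\<close> at every
  point.\<close>

lemma Hs_time_derivative:
  assumes r: "r > 1" and T: "T > 0" and t: "t \<in> {0..T}" and H: "Hs_deriv r T u u1 t"
    and u: "\<And>t. t \<in> {0..T} \<Longrightarrow> in_Hp r (\<lambda>x y. u x y t)" and u1: "in_Hp r (\<lambda>x y. u1 x y t)"
    and ser: "\<And>t. t \<in> {0..T} \<Longrightarrow> fser (cf (\<lambda>x y. u x y t)) (\<lambda>x y. u x y t)"
  obtains V where "fser (cf (\<lambda>x y. u1 x y t)) V"
    "\<And>x y. ((\<lambda>t. u x y t) has_real_derivative V x y) (at t within {0..T})"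
proof -
  let ?c = "\<lambda>t. cf (\<lambda>x y. u x y t)" and ?c1 = "cf (\<lambda>x y. u1 x y t)"
  obtain Z where Z: "0 \<le> Z" "\<And>c K. wl2 r c K \<Longrightarrow> wl1 0 c (Z * K)"
    using wl2_imp_wl1[of r 0] r by auto
  define S where "S x y = (\<Sum>\<^sub>\<infinity>k. ?c1 k * trig k x y)" for x y
  have S: "((\<lambda>k. ?c1 k * trig k x y) has_sum S x y) UNIV" for x y
    unfolding S_def
    by (rule has_sum_infsum, rule abs_summable_summable)
       (use wl1_abs_summable[OF Z(2)[OF in_Hp_wl2[OF u1]]] in \<open>simp add: norm_mult\<close>)
  let ?q = "\<lambda>x y t'. (u x y t' - u x y t) / (t' - t)"
  have lim: "((\<lambda>t'. complex_of_real (?q x y t')) \<longlongrightarrow> S x y) (at t within {0..T})" for x y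
  proof -
    let ?n = "\<lambda>t'. hs_norm r (\<lambda>x y. ?q x y t' - u1 x y t)"
    have "((\<lambda>t'. complex_of_real (?q x y t') - S x y) \<longlongrightarrow> 0) (at t within {0..T})"
    proof (rule Lim_null_comparison)
      show "((\<lambda>t'. Z * ?n t') \<longlongrightarrow> 0) (at t within {0..T})"
        using tendsto_mult_left[OF H[unfolded Hs_deriv_def], of Z] by simp
      show "\<forall>\<^sub>F t' in at t within {0..T}. cmod (complex_of_real (?q x y t') - S x y) \<le> Z * ?n t'"
        unfolding eventually_at_filter
      proof (rule always_eventually, intro allI impI)
        fix t' assume t': "t' \<in> {0..T}"
        have "((\<lambda>k. of_real (1 / (t' - t)) * (?c t' k * trig k x y - ?c t k * trig k x y) - ?c1 k * trig k x y) has_sum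
           of_real (1 / (t' - t)) * (complex_of_real (u x y t') - complex_of_real (u x y t)) - S x y) UNIV"
          using ser[OF t'] ser[OF t] S[of x y]
          by (intro has_sum_minus has_sum_cmult_right) (simp_all add: fser_def)
        moreover have "of_real (1 / (t' - t)) * (?c t' k * trig k x y - ?c t k * trig k x y) - ?c1 k * trig k x y
            = (of_real (1 / (t' - t)) * (?c t' k - ?c t k) - ?c1 k) * trig k x y" for k
          by (simp only: left_diff_distrib right_diff_distrib mult.assoc)
        moreover have "of_real (1 / (t' - t)) * (complex_of_real (u x y t') - complex_of_real (u x y t)) = complex_of_real (?q x y t')"
          by simp
        ultimately have "((\<lambda>k. (of_real (1 / (t' - t)) * (?c t' k - ?c t k) - ?c1 k) * trig k x y) has_sum (complex_of_real (?q x y t') - S x y)) UNIV"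
          by (simp only:)
        then show "cmod (complex_of_real (?q x y t') - S x y) \<le> Z * ?n t'"
          by (rule wl1_has_sum_bound[OF Z(2)[OF wl2_hs_norm_quotient[OF u[OF t'] u[OF t] u1]]]) simp
      qed
    qed
    then show ?thesis by (simp only: LIM_zero_iff)
  qed
  \<comment> \<open>Every point of the interval, endpoints included, is a limit point. Limits are
    therefore unique, and as a limit of real quotients \<open>S\<close> is real, as
    \<open>fser\<close> requires.\<close>
  have nb: "at t within {0..T} \<noteq> bot"
    using t T by (simp add: trivial_limit_within connected_imp_perfect[of "{0..T}"] islimpt_Icc)
  have "((\<lambda>t'. 0) \<longlongrightarrow> Im (S x y)) (at t within {0..T})" for x y
    using tendsto_Im[OF lim[of x y]] by (simp only: Im_complex_of_real)
  then have "Im (S x y) = 0" for x y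
    using tendsto_unique[OF nb _ tendsto_const] by metis
  then have Re_S: "S x y = complex_of_real (Re (S x y))" for x y by (simp add: complex_eq_iff)
  have "fser ?c1 (\<lambda>x y. Re (S x y))"
    unfolding fser_def Re_S[symmetric] by (intro allI S)
  moreover have "((\<lambda>t. u x y t) has_real_derivative Re (S x y)) (at t within {0..T})" for x y
    using tendsto_Re[OF lim[of x y]] by (simp add: has_field_derivative_iff)
  ultimately show ?thesis using that by blast
qed

text \<open>The mean value inequality is used twice: for the first derivative, and for the remainder
  after subtracting \<open>t\<close> times the initial derivative, whose own derivative is the
  increment just bounded. Continuity of the second derivative at zero bounds it on
  \<open>{0..\<delta>}\<close>.\<close>

lemma C2_Hp_taylor:
  assumes r: "0 \<le> r" and T: "T > 0"
    and H: "\<And>t. t \<in> {0..T} \<Longrightarrow> in_Hp r (\<lambda>x y. u x y t) \<and> in_Hp r (\<lambda>x y. u1 x y t) \<and> in_Hp r (\<lambda>x y. u2 x y t)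
    \<and> Hs_deriv r T u u1 t \<and> Hs_deriv r T u1 u2 t
    \<and> ((\<lambda>t'. hs_norm r (\<lambda>x y. u2 x y t' - u2 x y t)) \<longlongrightarrow> 0) (at t within {0..T})"
  obtains \<delta> K where "0 < \<delta>" "\<delta> \<le> T" "0 \<le> K"
    "\<And>t. t \<in> {0<..\<delta>} \<Longrightarrow> wl2 r (\<lambda>k. cf (\<lambda>x y. u1 x y t) k - cf (\<lambda>x y. u1 x y 0) k) (K * t)"
    "\<And>t. t \<in> {0<..\<delta>} \<Longrightarrow> wl2 r (\<lambda>k. cf (\<lambda>x y. u x y t) k - cf (\<lambda>x y. u x y 0) k - of_real t * cf (\<lambda>x y. u1 x y 0) k) (K * t * t)"
proof -
  let ?c = "\<lambda>t. cf (\<lambda>x y. u x y t)" and ?c1 = "\<lambda>t. cf (\<lambda>x y. u1 x y t)" and ?c2 = "\<lambda>t. cf (\<lambda>x y. u2 x y t)"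
  have "((\<lambda>t'. hs_norm r (\<lambda>x y. u2 x y t' - u2 x y 0)) \<longlongrightarrow> 0) (at 0 within {0..T})"
    using H[of 0] T by simp
  then have "\<forall>\<^sub>F t in at 0 within {0..T}. hs_norm r (\<lambda>x y. u2 x y t - u2 x y 0) < 1"
    by (rule order_tendstoD) simp
  then obtain d where d: "d > 0" "\<And>t. t \<in> {0..T} \<Longrightarrow> t \<noteq> 0 \<Longrightarrow> dist t 0 < d \<Longrightarrow> hs_norm r (\<lambda>x y. u2 x y t - u2 x y 0) < 1"
    unfolding eventually_at by blast
  define \<delta> where "\<delta> = min (d / 2) T"
  have \<delta>: "0 < \<delta>" "\<delta> \<le> T" "\<delta> < d" using d T by (auto simp: \<delta>_def min_def)
  \<comment> \<open>The summand \<open>1\<close> is the deviation of the second derivative from its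
    initial value that the choice of \<open>\<delta>\<close> allows.\<close>
  define K where "K = hs_norm r (\<lambda>x y. u2 x y 0) + 1"
  have w20: "wl2 r (?c2 0) (hs_norm r (\<lambda>x y. u2 x y 0))" using H[of 0] T by (intro in_Hp_wl2) simp
  have K0: "0 \<le> K" using w20 by (simp add: K_def wl2_def)
  have w2: "wl2 r (?c2 t) K" if "t \<in> {0..\<delta>}" for t
  proof (cases "t = 0")
    case True
    then show ?thesis by (auto intro!: wl2_mono[OF w20] simp: K_def)
  next
    case False
    have tT: "t \<in> {0..T}" using that \<delta> by auto
    have "dist t 0 < d" using that \<delta> by (simp add: dist_real_def)
    then have "hs_norm r (\<lambda>x y. u2 x y t - u2 x y 0) \<le> 1" using d(2)[OF tT False] by simp
    moreover have "in_Hp r (\<lambda>x y. u2 x y t)" "in_Hp r (\<lambda>x y. u2 x y 0)"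
      using H[OF tT] H[of 0] T by auto
    ultimately have "wl2 r (\<lambda>k. ?c2 t k - ?c2 0 k) 1"
      using wl2_mono[OF wl2_hs_norm_diff] by blast
    from wl2_add[OF w20 this] show ?thesis by (simp add: K_def)
  qed
  have sub: "(f has_real_derivative f') (at t within {0..\<tau>})" if "(f has_real_derivative f') (at t within {0..T})" "\<tau> \<le> \<delta>" for f f' t \<tau>
    by (rule DERIV_subset[OF that(1)]) (use that \<delta> in auto)
  have D: "((\<lambda>t. Re (?c t k)) has_real_derivative Re (?c1 t k)) (at t within {0..\<tau>})"
    "((\<lambda>t. Im (?c t k)) has_real_derivative Im (?c1 t k)) (at t within {0..\<tau>})"
    "((\<lambda>t. Re (?c1 t k)) has_real_derivative Re (?c2 t k)) (at t within {0..\<tau>})"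
    "((\<lambda>t. Im (?c1 t k)) has_real_derivative Im (?c2 t k)) (at t within {0..\<tau>})"
    if t: "t \<in> {0..\<tau>}" and \<tau>: "\<tau> \<le> \<delta>" for t \<tau> k
  proof -
    have tT: "t \<in> {0..T}" using t \<tau> \<delta> by auto
    have h: "Hs_deriv r T u u1 t" "Hs_deriv r T u1 u2 t" "in_Hp r (\<lambda>x y. u1 x y t)" "in_Hp r (\<lambda>x y. u2 x y t)"
      using H[OF tT] by auto
    have f: "in_Hp r (\<lambda>x y. u x y t)" "in_Hp r (\<lambda>x y. u1 x y t)" if "t \<in> {0..T}" for t
      using H[OF that] by auto
    show "((\<lambda>t. Re (?c t k)) has_real_derivative Re (?c1 t k)) (at t within {0..\<tau>})"
      by (rule sub[OF Hs_deriv_cf(1)[OF r h(1) tT f(1) h(3)] \<tau>])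
    show "((\<lambda>t. Im (?c t k)) has_real_derivative Im (?c1 t k)) (at t within {0..\<tau>})"
      by (rule sub[OF Hs_deriv_cf(2)[OF r h(1) tT f(1) h(3)] \<tau>])
    show "((\<lambda>t. Re (?c1 t k)) has_real_derivative Re (?c2 t k)) (at t within {0..\<tau>})"
      by (rule sub[OF Hs_deriv_cf(1)[OF r h(2) tT f(2) h(4)] \<tau>])
    show "((\<lambda>t. Im (?c1 t k)) has_real_derivative Im (?c2 t k)) (at t within {0..\<tau>})"
      by (rule sub[OF Hs_deriv_cf(2)[OF r h(2) tT f(2) h(4)] \<tau>])
  qed
  have A: "wl2 r (\<lambda>k. ?c1 t k - ?c1 0 k) (K * t)" if t: "t \<in> {0<..\<delta>}" for t
  proof (rule wl2_mean_value[where c' = ?c2])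
    show "0 < t" using t by simp
    show "wl2 r (?c2 t') K" if "t' \<in> {0..t}" for t' using that t by (intro w2) auto
  qed (use t in \<open>auto intro!: D\<close>)
  have B: "wl2 r (\<lambda>k. ?c t k - ?c 0 k - of_real t * ?c1 0 k) (K * t * t)" if t: "t \<in> {0<..\<delta>}" for t
  proof -
    have "wl2 r (\<lambda>k. (?c t k - of_real t * ?c1 0 k) - (?c 0 k - of_real 0 * ?c1 0 k)) (K * t * t)"
    proof (rule wl2_mean_value[where c = "\<lambda>t k. ?c t k - of_real t * ?c1 0 k" and c' = "\<lambda>t k. ?c1 t k - ?c1 0 k"])
      show "0 < t" using t by simp
      show "wl2 r (\<lambda>k. ?c1 t' k - ?c1 0 k) (K * t)" if "t' \<in> {0..t}" for t'
      proof (cases "t' = 0")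
        case True
        then show ?thesis using K0 t by (simp add: wl2_zero)
      next
        case False
        have "wl2 r (\<lambda>k. ?c1 t' k - ?c1 0 k) (K * t')" using False that t by (intro A) auto
        then show ?thesis by (rule wl2_mono) (use that K0 in \<open>auto intro: mult_left_mono\<close>)
      qed
      fix t' k assume "t' \<in> {0..t}"
      then have *: "((\<lambda>t. Re (?c t k)) has_real_derivative Re (?c1 t' k)) (at t' within {0..t})"
        "((\<lambda>t. Im (?c t k)) has_real_derivative Im (?c1 t' k)) (at t' within {0..t})"
        using t by (auto intro!: D)
      show "((\<lambda>t. Re (?c t k - of_real t * ?c1 0 k)) has_real_derivative Re (?c1 t' k - ?c1 0 k)) (at t' within {0..t})"
        using DERIV_diff[OF *(1) DERIV_cmult_right[OF DERIV_ident, of "Re (?c1 0 k)"]] by simp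
      show "((\<lambda>t. Im (?c t k - of_real t * ?c1 0 k)) has_real_derivative Im (?c1 t' k - ?c1 0 k)) (at t' within {0..t})"
        using DERIV_diff[OF *(2) DERIV_cmult_right[OF DERIV_ident, of "Im (?c1 0 k)"]] by simp
    qed
    then show ?thesis by (simp add: algebra_simps)
  qed
  show ?thesis by (rule that[OF \<delta>(1,2) K0 A B])
qed

section \<open>The equation at the initial time\<close>

text \<open>The equation is given at interior times, while the scheme is compared with it at time
  zero, where \<open>V1\<close> is the time derivative. The difference quotient is recorded with the
  full exponent \<open>s + 4\<close> because the scheme applies a fourth-order operator to
  it.\<close>

lemma rosenau_initial_data:
  fixes u :: "real \<Rightarrow> real \<Rightarrow> real \<Rightarrow> real"
  assumes s: "s > 1" and T: "T > 0"
    and per: "\<forall>t\<in>{0..T}. periodic2 (\<lambda>x y. u x y t)"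
    and cont: "\<forall>t\<in>{0..T}. continuous_on UNIV (\<lambda>z :: real \<times> real. u (fst z) (snd z) t)"
    and pde: "rosenau_kdv p T u"
    and C2: "C2_Hp (s + 4) T u"
  obtains c0 c1 V1 K \<delta> where
    "fser c0 (\<lambda>x y. u x y 0)" "wl2 (s + 4) c0 K" "fser c1 V1" "wl2 (s + 4) c1 K"
    "\<And>x y. V1 x y + lap2 (lap2 V1) x y + dX (lap2 (\<lambda>x y. u x y 0)) x y
       + (1 + u x y 0 ^ p) * (dX (\<lambda>x y. u x y 0) x y + dY (\<lambda>x y. u x y 0) x y) = 0"
    "0 < \<delta>" "\<And>\<tau>. 0 < \<tau> \<Longrightarrow> \<tau> \<le> \<delta> \<Longrightarrow>
       \<exists>d. fser d (\<lambda>x y. (u x y \<tau> - u x y 0) / \<tau> - V1 x y) \<and> wl2 (s + 4) d (K * \<tau>)"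
proof -
  let ?r = "s + 4"
  obtain u1 u2 where H: "\<And>t. t \<in> {0..T} \<Longrightarrow>
      in_Hp ?r (\<lambda>x y. u x y t) \<and> in_Hp ?r (\<lambda>x y. u1 x y t) \<and> in_Hp ?r (\<lambda>x y. u2 x y t)
    \<and> Hs_deriv ?r T u u1 t \<and> Hs_deriv ?r T u1 u2 t
    \<and> ((\<lambda>t'. hs_norm ?r (\<lambda>x y. u2 x y t' - u2 x y t)) \<longlongrightarrow> 0) (at t within {0..T})"
    using C2 unfolding C2_Hp_def by blast
  define c where "c t = cf (\<lambda>x y. u x y t)" for t
  define c1 where "c1 t = cf (\<lambda>x y. u1 x y t)" for t
  have r0: "0 \<le> ?r" using s by simp
  obtain \<delta> K0 where \<delta>: "0 < \<delta>" "\<delta> \<le> T" "0 \<le> K0"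
    and A: "\<And>t. t \<in> {0<..\<delta>} \<Longrightarrow> wl2 ?r (\<lambda>k. c1 t k - c1 0 k) (K0 * t)"
    and B: "\<And>t. t \<in> {0<..\<delta>} \<Longrightarrow> wl2 ?r (\<lambda>k. c t k - c 0 k - of_real t * c1 0 k) (K0 * t * t)"
    unfolding c_def c1_def by (rule C2_Hp_taylor[OF r0 T H]) blast+
  obtain Z where Z: "0 \<le> Z" "\<And>c K. wl2 ?r c K \<Longrightarrow> wl1 2 c (Z * K)"
    using wl2_imp_wl1[of ?r 2] s by auto
  have u_Hp: "in_Hp ?r (\<lambda>x y. u x y t)" "in_Hp ?r (\<lambda>x y. u1 x y t)" if "t \<in> {0..T}" for t
    using H[OF that] by auto
  have w1: "wl1 2 (c t) (Z * hs_norm ?r (\<lambda>x y. u x y t))" "wl1 2 (c1 t) (Z * hs_norm ?r (\<lambda>x y. u1 x y t))"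
    if "t \<in> {0..T}" for t
    unfolding c_def c1_def using Z(2)[OF in_Hp_wl2] u_Hp[OF that] by blast+
  have ser: "fser (c t) (\<lambda>x y. u x y t)" if t: "t \<in> {0..T}" for t
  proof -
    have "(\<lambda>k. cmod (c t k)) summable_on UNIV" by (rule wl1_abs_summable[OF w1(1)[OF t]]) simp
    then have "fser (\<lambda>k. fcoef (\<lambda>x y. u x y t) (fst k) (snd k)) (\<lambda>x y. u x y t)"
      using per cont t by (intro fourier_series) (auto simp: c_def cf_def)
    then show ?thesis by (simp add: c_def cf_def[abs_def])
  qed
  have "\<exists>V. fser (c1 t) V \<and> (\<forall>x y. ((\<lambda>t. u x y t) has_real_derivative V x y) (at t within {0..T}))"
    if t: "t \<in> {0..T}" for t
  proof -
    have r1: "?r > 1" using s by simp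
    have h: "Hs_deriv ?r T u u1 t" using H[OF t] by blast
    show ?thesis
      by (rule Hs_time_derivative[OF r1 T t h u_Hp(1) u_Hp(2)[OF t] ser[unfolded c_def]])
         (auto simp: c1_def)
  qed
  then obtain V where V: "\<And>t. t \<in> {0..T} \<Longrightarrow> fser (c1 t) (V t)"
    and V_deriv: "\<And>t x y. t \<in> {0..T} \<Longrightarrow> ((\<lambda>t. u x y t) has_real_derivative V t x y) (at t within {0..T})"
    by metis
  have T0: "0 \<in> {0..T}" using T by simp
  define w where "w t = (\<lambda>x y. u x y t)" for t
  define P where "P t x y = V t x y + lap2 (lap2 (V t)) x y + dX (lap2 (w t)) x y
       + (1 + w t x y ^ p) * (dX (w t) x y + dY (w t) x y)" for t x y
  have P_pos: "P t x y = 0" if "t \<in> {0<..<T}" for t x y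
  proof -
    have "pdt u x y t = V t x y" for x y
    proof -
      \<comment> \<open>\<open>pdt\<close> is a two-sided derivative; at interior times it agrees
        with the derivative within \<open>{0..T}\<close>.\<close>
      have "at t within {0..T} = at t" using that by (intro at_within_Icc_at) auto
      then have "((\<lambda>t. u x y t) has_real_derivative V t x y) (at t)"
        using V_deriv[of t x y] that by simp
      then show ?thesis by (simp add: pdt_def DERIV_imp_deriv)
    qed
    then have "lap (lap (pdt u)) x y t = lap2 (lap2 (V t)) x y"
      by (simp add: lap_def lap2_def pdx_def pdy_def dX_def dY_def)
    moreover have "pdx (lap u) x y t = dX (lap2 (w t)) x y" "pdx u x y t = dX (w t) x y" "pdy u x y t = dY (w t) x y"
      by (simp_all add: lap_def lap2_def pdx_def pdy_def dX_def dY_def w_def)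
    ultimately show ?thesis
      using pde[unfolded rosenau_kdv_def, rule_format, of t x y] that \<open>\<And>x y. pdt u x y t = V t x y\<close>
      by (simp add: P_def w_def)
  qed
  \<comment> \<open>The increment of \<open>c\<close> is the Taylor remainder plus \<open>t\<close>
    times the initial derivative; one factor \<open>t\<close> of the quadratic remainder is bounded
    by \<open>\<delta>\<close>.\<close>
  define L where "L = Z * (K0 * \<delta> + hs_norm ?r (\<lambda>x y. u1 x y 0))"
  have dc1: "wl1 2 (\<lambda>k. c1 t k - c1 0 k) (Z * K0 * t)" if "t \<in> {0<..\<delta>}" for t
    using Z(2)[OF A[OF that]] by (simp add: mult.assoc)
  have dc: "wl1 2 (\<lambda>k. c t k - c 0 k) (L * t)" if t: "t \<in> {0<..\<delta>}" for t
  proof -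
    have "wl2 ?r (\<lambda>k. (c t k - c 0 k - of_real t * c1 0 k) + of_real t * c1 0 k)
       (K0 * t * t + cmod (of_real t) * hs_norm ?r (\<lambda>x y. u1 x y 0))"
      using in_Hp_wl2[OF u_Hp(2)[OF T0]] by (intro wl2_add B t wl2_cmult) (simp add: c1_def)
    then have "wl1 2 (\<lambda>k. c t k - c 0 k) (Z * (K0 * t * t + t * hs_norm ?r (\<lambda>x y. u1 x y 0)))"
      using Z(2) t by fastforce
    moreover have "Z * (K0 * t * t + t * hs_norm ?r (\<lambda>x y. u1 x y 0)) \<le> L * t"
    proof -
      have "K0 * t * t \<le> K0 * \<delta> * t" using t \<delta> by (intro mult_right_mono mult_left_mono) auto
      then have "Z * (K0 * t * t + t * hs_norm ?r (\<lambda>x y. u1 x y 0)) \<le> Z * (K0 * \<delta> * t + t * hs_norm ?r (\<lambda>x y. u1 x y 0))"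
        using Z(1) by (intro mult_left_mono) auto
      then show ?thesis by (simp add: L_def algebra_simps)
    qed
    ultimately show ?thesis using wl1_mono by blast
  qed
  have sub: "t \<in> {0..\<delta>} \<Longrightarrow> t \<in> {0..T}" for t using \<delta> by auto
  have half: "wl1 (1/2) (c t) (Z * hs_norm ?r (\<lambda>x y. u x y t))" if "t \<in> {0..T}" for t
    by (rule wl1_mono[OF w1(1)[OF that]]) auto
  have "((\<lambda>t. P t x y) \<longlongrightarrow> P 0 x y) (at_right 0)" for x y
    unfolding P_def
  proof (intro tendsto_add tendsto_mult tendsto_power tendsto_const)
    show "((\<lambda>t. V t x y) \<longlongrightarrow> V 0 x y) (at_right 0)"
      by (rule fser_tendsto[where m = "\<lambda>_. 1", OF _ symbol_bounds(1) dc1 \<delta>(1)]) (use V sub in auto)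
    show "((\<lambda>t. lap2 (lap2 (V t)) x y) \<longlongrightarrow> lap2 (lap2 (V 0)) x y) (at_right 0)"
      by (rule fser_tendsto[OF fser_bilap[OF V w1(2)] symbol_bounds(2) dc1 \<delta>(1)]) (use \<delta> in auto)
    show "((\<lambda>t. dX (lap2 (w t)) x y) \<longlongrightarrow> dX (lap2 (w 0)) x y) (at_right 0)"
      by (rule fser_tendsto[OF fser_dX_lap2[OF ser[folded w_def] w1(1)] symbol_bounds(3) dc \<delta>(1)]) (use \<delta> in auto)
    show "((\<lambda>t. w t x y) \<longlongrightarrow> w 0 x y) (at_right 0)"
      by (rule fser_tendsto[where m = "\<lambda>_. 1", OF _ symbol_bounds(1) dc \<delta>(1)]) (use ser[folded w_def] sub in auto)
    show "((\<lambda>t. dX (w t) x y) \<longlongrightarrow> dX (w 0) x y) (at_right 0)"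
      by (rule fser_tendsto[OF fser_dX[OF ser[folded w_def] half] symbol_bounds(4) dc \<delta>(1)]) (use \<delta> in auto)
    show "((\<lambda>t. dY (w t) x y) \<longlongrightarrow> dY (w 0) x y) (at_right 0)"
      by (rule fser_tendsto[OF fser_dY[OF ser[folded w_def] half] symbol_bounds(5) dc \<delta>(1)]) (use \<delta> in auto)
  qed
  moreover have "((\<lambda>t. P t x y) \<longlongrightarrow> 0) (at_right 0)" for x y
  proof (rule tendsto_eventually)
    show "\<forall>\<^sub>F t in at_right 0. P t x y = 0"
      unfolding eventually_at_right[OF T] by (rule exI[of _ T]) (auto simp: T P_pos)
  qed
  ultimately have P0: "P 0 x y = 0" for x y
    using tendsto_unique[OF trivial_limit_at_right_real] by blast
  define K where "K = Max {K0, hs_norm ?r (\<lambda>x y. u x y 0), hs_norm ?r (\<lambda>x y. u1 x y 0)}"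
  have K: "K0 \<le> K" "hs_norm ?r (\<lambda>x y. u x y 0) \<le> K" "hs_norm ?r (\<lambda>x y. u1 x y 0) \<le> K"
    by (auto simp: K_def)
  have step: "\<exists>d. fser d (\<lambda>x y. (u x y \<tau> - u x y 0) / \<tau> - V 0 x y) \<and> wl2 ?r d (K * \<tau>)"
    if \<tau>: "0 < \<tau>" "\<tau> \<le> \<delta>" for \<tau>
  proof -
    have \<tau>T: "\<tau> \<in> {0..T}" using \<tau> \<delta> by auto
    let ?d = "\<lambda>k. of_real (1 / \<tau>) * (c \<tau> k - c 0 k) - c1 0 k"
    have "fser ?d (\<lambda>x y. (1 / \<tau>) * (u x y \<tau> - u x y 0) - V 0 x y)"
      by (intro fser_diff fser_cmult ser \<tau>T T0 V)
    moreover have "wl2 ?r ?d (K * \<tau>)"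
    proof -
      have "wl2 ?r (\<lambda>k. of_real (1 / \<tau>) * (c \<tau> k - c 0 k - of_real \<tau> * c1 0 k)) (cmod (of_real (1 / \<tau>)) * (K0 * \<tau> * \<tau>))"
        using \<tau> by (intro wl2_cmult B) auto
      moreover have "of_real (1 / \<tau>) * (c \<tau> k - c 0 k - of_real \<tau> * c1 0 k) = ?d k" for k
        using \<tau> by (simp add: field_simps)
      moreover have "cmod (of_real (1 / \<tau>)) * (K0 * \<tau> * \<tau>) = K0 * \<tau>" using \<tau> by (simp add: norm_divide)
      ultimately have "wl2 ?r ?d (K0 * \<tau>)" by (simp only:)
      then show ?thesis by (rule wl2_mono) (use K \<tau> in \<open>auto intro: mult_right_mono\<close>)
    qed
    ultimately show ?thesis by auto
  qed
  show ?thesis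
  proof (rule that[of "c 0" K "c1 0" "V 0" \<delta>])
    show "fser (c 0) (\<lambda>x y. u x y 0)" by (rule ser[OF T0])
    show "wl2 ?r (c 0) K" unfolding c_def by (rule wl2_mono[OF in_Hp_wl2[OF u_Hp(1)[OF T0]] K(2)])
    show "fser (c1 0) (V 0)" by (rule V[OF T0])
    show "wl2 ?r (c1 0) K" unfolding c1_def by (rule wl2_mono[OF in_Hp_wl2[OF u_Hp(2)[OF T0]] K(3)])
    show "V 0 x y + lap2 (lap2 (V 0)) x y + dX (lap2 (\<lambda>x y. u x y 0)) x y
       + (1 + u x y 0 ^ p) * (dX (\<lambda>x y. u x y 0) x y + dY (\<lambda>x y. u x y 0) x y) = 0" for x y
      using P0[of x y] by (simp add: P_def w_def)
  qed (use \<delta> step in auto)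
qed

section \<open>Residual of the exact solution\<close>

lemma freq_power_le:
  shows "\<bar>real_of_int (fst k)\<bar> ^ n \<le> jw k powr (real n / 2)" "\<bar>real_of_int (snd k)\<bar> ^ n \<le> jw k powr (real n / 2)"
proof -
  have "(jw k powr (1/2)) ^ n = jw k powr (real n / 2)"
    by (simp add: powr_power)
  then show "\<bar>real_of_int (fst k)\<bar> ^ n \<le> jw k powr (real n / 2)" "\<bar>real_of_int (snd k)\<bar> ^ n \<le> jw k powr (real n / 2)"
    using power_mono[OF abs_freq_le(1)[of k], of n] power_mono[OF abs_freq_le(2)[of k], of n] by simp_all
qed

lemma symA_bound:
  assumes "even N" "N > 0"
  shows "cmod (symA N k) \<le> jw k"
proof -
  have "cmod (symA N k) \<le> cmod (lam N 2 (fst k)) + cmod (lam N 2 (snd k))"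
    unfolding symA_def by (rule norm_triangle_ineq)
  also have "\<dots> \<le> \<bar>real_of_int (fst k)\<bar>\<^sup>2 + \<bar>real_of_int (snd k)\<bar>\<^sup>2"
    by (intro add_mono lam_bound assms)
  also have "\<dots> \<le> jw k" by (simp add: jw_def)
  finally show ?thesis .
qed

lemma symA_square_bound:
  assumes "even N" "N > 0"
  shows "cmod (symA N k * symA N k) \<le> 1 * jw k powr 2"
proof -
  have "cmod (symA N k) * cmod (symA N k) \<le> jw k * jw k"
    by (intro mult_mono symA_bound assms) (auto simp: less_imp_le)
  also have "\<dots> = jw k powr 2" using powr_add[of "jw k" 1 1] by simp
  finally show ?thesis by (simp only: norm_mult mult_1)
qed

text \<open>Both terms have order \<open>3/2\<close> in \<open>jw\<close>; raising it to
  \<open>2\<close> lets \<open>opB\<close> share the exponent \<open>s + 4\<close> with the square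
  of \<open>opA\<close>.\<close>

lemma symB_bound:
  assumes "even N" "N > 0"
  shows "cmod (symB N k) \<le> 2 * jw k powr 2"
proof -
  have "cmod (symB N k) \<le> cmod (lam N 3 (fst k)) + cmod (lam N 2 (snd k)) * cmod (lam N 1 (fst k))"
    unfolding symB_def norm_mult[symmetric] by (rule norm_triangle_ineq)
  also have "\<dots> \<le> \<bar>real_of_int (fst k)\<bar> ^ 3 + \<bar>real_of_int (snd k)\<bar>\<^sup>2 * \<bar>real_of_int (fst k)\<bar> ^ 1"
    by (intro add_mono mult_mono lam_bound assms) auto
  also have "\<dots> \<le> jw k powr (3/2) + jw k powr (3/2)"
  proof (rule add_mono)
    show "\<bar>real_of_int (fst k)\<bar> ^ 3 \<le> jw k powr (3/2)" using freq_power_le(1)[of k 3] by simp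
    have "\<bar>real_of_int (snd k)\<bar>\<^sup>2 * \<bar>real_of_int (fst k)\<bar> ^ 1 \<le> jw k powr 1 * jw k powr (1/2)"
      using freq_power_le(2)[of k 2] freq_power_le(1)[of k 1] by (intro mult_mono) auto
    then show "\<bar>real_of_int (snd k)\<bar>\<^sup>2 * \<bar>real_of_int (fst k)\<bar> ^ 1 \<le> jw k powr (3/2)"
      unfolding powr_add[symmetric] by simp
  qed
  also have "\<dots> \<le> 2 * jw k powr 2"
    using powr_mono[of "3/2" 2 "jw k"] jw_ge_1[of k] by simp
  finally show ?thesis .
qed

lemma symL_bound:
  assumes "even N" "N > 0"
  shows "cmod (symL N k) \<le> 2 * jw k powr (1/2)"
proof -
  have "cmod (symL N k) \<le> cmod (lam N 1 (fst k)) + cmod (lam N 1 (snd k))"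
    unfolding symL_def by (rule norm_triangle_ineq)
  also have "\<dots> \<le> \<bar>real_of_int (fst k)\<bar> ^ 1 + \<bar>real_of_int (snd k)\<bar> ^ 1"
    by (intro add_mono lam_bound assms)
  also have "\<dots> \<le> 2 * jw k powr (1/2)" using abs_freq_le[of k] by simp
  finally show ?thesis .
qed

lemma sym_near:
  assumes "even N" "2 * \<bar>fst k\<bar> < int N" "2 * \<bar>snd k\<bar> < int N"
  shows "symA N k = of_real (1 - jw k)" "symB N k = \<i> * of_int (fst k) * of_real (1 - jw k)"
    "symL N k = \<i> * of_int (fst k) + \<i> * of_int (snd k)"
  using assms
  by (simp_all add: symA_def symB_def symL_def lam_exact jw_def power_mult_distrib power3_eq_cube power2_eq_square algebra_simps)

text \<open>The difference of the symbols vanishes on the resolved modes, as \<open>aliasing\<close>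
  demands. On the others it is merely bounded by the sum of the two, whence \<open>2 * M\<close>;
  the decay in \<open>N\<close> comes from the coefficients alone.\<close>

lemma consistency:
  assumes s: "s > 1"
  obtains C where "0 \<le> C"
    "\<And>N m m' c K M a V G. \<lbrakk>N > 0; even N; rep N (\<lambda>k. m k * c k) V; rep N (\<lambda>k. m' k * c k) G; wl2 (s + 2 * a) c K;
       \<And>k. cmod (m k) \<le> M * jw k powr a; \<And>k. cmod (m' k) \<le> M * jw k powr a; 0 \<le> M;
       \<And>k. 2 * \<bar>fst k\<bar> < int N \<Longrightarrow> 2 * \<bar>snd k\<bar> < int N \<Longrightarrow> m k = m' k\<rbrakk>
       \<Longrightarrow> grid_norm N (\<lambda>a b. V a b - G a b) \<le> C * (2 * M * K) * real N powr (- s)"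
proof -
  obtain C where C: "0 \<le> C" and al: "\<And>N d V K. \<lbrakk>N > 0; even N; rep N d V; wl2 s d K;
       \<And>k. 2 * \<bar>fst k\<bar> < int N \<Longrightarrow> 2 * \<bar>snd k\<bar> < int N \<Longrightarrow> d k = 0\<rbrakk>
       \<Longrightarrow> grid_norm N V \<le> C * K * real N powr (- s)"
  proof -
    show ?thesis by (rule aliasing[OF s], fact that)
  qed
  show ?thesis
  proof (rule that[OF C])
    fix N m m' c K M a V G
    assume N: "N > 0" "even N" and V: "rep N (\<lambda>k. m k * c k) V" and G: "rep N (\<lambda>k. m' k * c k) G"
      and c: "wl2 (s + 2 * a) c K"
      and m: "\<And>k. cmod (m k) \<le> M * jw k powr a" and m': "\<And>k. cmod (m' k) \<le> M * jw k powr a" and M: "0 \<le> M"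
      and near: "\<And>k. 2 * \<bar>fst k\<bar> < int N \<Longrightarrow> 2 * \<bar>snd k\<bar> < int N \<Longrightarrow> m k = m' k"
    show "grid_norm N (\<lambda>a b. V a b - G a b) \<le> C * (2 * M * K) * real N powr (- s)"
    proof (rule al[OF N])
      show "rep N (\<lambda>k. (m k - m' k) * c k) (\<lambda>a b. V a b - G a b)"
        using rep_diff[OF V G] by (simp add: left_diff_distrib)
      show "wl2 s (\<lambda>k. (m k - m' k) * c k) (2 * M * K)"
      proof (rule wl2_multiplier[OF c])
        show "cmod (m k - m' k) \<le> 2 * M * jw k powr a" for k
          using norm_triangle_ineq4[of "m k" "m' k"] m[of k] m'[of k] by simp
      qed (use M in simp)
    qed (use near in auto)
  qed
qed

text \<open>The residual is split into \<open>A1\<close>, the error of spatial discretisation at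
  time zero, and \<open>A2\<close>, which is of order \<open>\<tau>\<close>. Only \<open>A1\<close>
  goes through aliasing; \<open>A2\<close> is bounded uniformly on the grid by absolute sums with
  weight \<open>2\<close>.\<close>

lemma residual_estimate:
  fixes u :: "real \<Rightarrow> real \<Rightarrow> real \<Rightarrow> real"
  assumes s: "s > 1" and p: "p \<ge> 1"
    and c0: "fser c0 (\<lambda>x y. u x y 0)" "wl2 (s + 4) c0 K" and c1: "fser c1 V1" "wl2 (s + 4) c1 K"
    and pde: "\<And>x y. V1 x y + lap2 (lap2 V1) x y + dX (lap2 (\<lambda>x y. u x y 0)) x y
       + (1 + u x y 0 ^ p) * (dX (\<lambda>x y. u x y 0) x y + dY (\<lambda>x y. u x y 0) x y) = 0"
    and d: "\<And>\<tau>. 0 < \<tau> \<Longrightarrow> \<tau> \<le> \<delta> \<Longrightarrow>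
       \<exists>d. fser d (\<lambda>x y. (u x y \<tau> - u x y 0) / \<tau> - V1 x y) \<and> wl2 (s + 4) d (K * \<tau>)"
  obtains C where "0 \<le> C"
    "\<And>N \<tau>. \<lbrakk>N > 0; even N; 0 < \<tau>; \<tau> \<le> \<delta>; \<tau> \<le> 1\<rbrakk> \<Longrightarrow>
       grid_norm N (\<lambda>a b. (grid_of N u \<tau> a b - grid_of N u 0 a b
           + opA N (opA N (\<lambda>a b. grid_of N u \<tau> a b - grid_of N u 0 a b)) a b) / \<tau>
         + opD N p (grid_of N u 0) (\<lambda>a b. (grid_of N u \<tau> a b + grid_of N u 0 a b) / 2) a b)
       \<le> C * (real N powr (- s) + \<tau>)"
proof -
  define u0 where "u0 = (\<lambda>x y. u x y 0)"
  have K0: "0 \<le> K" using c0 by (simp add: wl2_def)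
  have c0s: "fser c0 u0" using c0 by (simp add: u0_def)
  obtain Z where Z: "0 \<le> Z" "\<And>c K. wl2 (s + 4) c K \<Longrightarrow> wl1 2 c (Z * K)"
    using wl2_imp_wl1[of "s + 4" 2] s by auto
  \<comment> \<open>The weight is chosen so that square sums recovered after taking powers have
    exponent \<open>s + 1\<close>, one derivative above \<open>s\<close>. The margin in the
    embedding is \<open>(s + 4) - (s + 1) = 3\<close>.\<close>
  obtain Y where Y: "0 \<le> Y" "\<And>c K. wl2 (s + 4) c K \<Longrightarrow> wl1 ((s + 1) / 2) c (Y * K)"
    using wl2_imp_wl1[of "s + 4" "(s + 1) / 2"] s by (auto simp: field_simps)
  have c0_2: "wl1 2 c0 (Z * K)" and c1_2: "wl1 2 c1 (Z * K)" using Z(2) c0(2) c1(2) by auto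
  have c0_h: "wl1 (1/2) c0 (Z * K)" by (rule wl1_mono[OF c0_2]) auto
  obtain n where n: "p = Suc n" using p by (cases p) auto
  have s2: "0 \<le> (s + 1) / 2" using s by simp
  obtain q Q where q: "fser q (\<lambda>x y. u0 x y ^ Suc p)" "wl1 ((s + 1) / 2) q Q"
    by (rule fser_power[OF c0s Y(2)[OF c0(2)] s2, of p])
  obtain g G where g: "fser g (\<lambda>x y. u0 x y ^ Suc n)" "wl1 2 g G"
    by (rule fser_power[OF c0s c0_2, of n]) simp
  have g_p: "fser g (\<lambda>x y. u0 x y ^ p)" using g(1) by (simp add: n)
  have G0: "0 \<le> G" by (rule wl1_nonneg[OF g(2)])
  have Q0: "0 \<le> Q" by (rule wl1_nonneg[OF q(2)])
  have up: "\<bar>u0 x y ^ p\<bar> \<le> G" for x y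
    by (rule fser_bound[OF g_p wl1_mono[OF g(2)]]) auto
  have q_h: "wl1 (1/2) q Q" by (rule wl1_mono[OF q(2)]) (use s in auto)
  have "2 * ((s + 1) / 2) = s + 2 * (1/2)" by (simp add: field_simps)
  with wl1_imp_wl2[OF q(2)] have q_2: "wl2 (s + 2 * (1/2)) q Q" by (simp only:)
  have dq: "dX (\<lambda>x y. u0 x y ^ Suc p) x y = real (Suc p) * u0 x y ^ p * dX u0 x y"
    "dY (\<lambda>x y. u0 x y ^ Suc p) x y = real (Suc p) * u0 x y ^ p * dY u0 x y" for x y
  proof -
    have "((\<lambda>\<xi>. u0 \<xi> y ^ Suc p) has_real_derivative real (Suc p) * u0 x y ^ p * dX u0 x y) (at x)"
      using DERIV_power[OF fser_dx(1)[OF c0s c0_h, of y x], of "Suc p"] by (simp add: dX_def mult_ac)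
    then show "dX (\<lambda>x y. u0 x y ^ Suc p) x y = real (Suc p) * u0 x y ^ p * dX u0 x y"
      unfolding dX_def[of "\<lambda>x y. u0 x y ^ Suc p"] by (rule DERIV_imp_deriv)
    have "((\<lambda>\<eta>. u0 x \<eta> ^ Suc p) has_real_derivative real (Suc p) * u0 x y ^ p * dY u0 x y) (at y)"
      using DERIV_power[OF fser_dy(1)[OF c0s c0_h, of x y], of "Suc p"] by (simp add: dY_def mult_ac)
    then show "dY (\<lambda>x y. u0 x y ^ Suc p) x y = real (Suc p) * u0 x y ^ p * dY u0 x y"
      unfolding dY_def[of "\<lambda>x y. u0 x y ^ Suc p"] by (rule DERIV_imp_deriv)
  qed
  define LC where "LC f = (\<lambda>x y. dX f x y + dY f x y)" for f :: "real \<Rightarrow> real \<Rightarrow> real"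
  \<comment> \<open>With \<open>p + 2 = 1 + (p + 1)\<close> this matches the two nonlinear terms of
    \<open>opD\<close> when both arguments are the initial data; in the second one
    \<open>opL\<close> acts on the grid values of a single smooth function.\<close>
  have nonlin: "u0 x y ^ p * LC u0 x y = (1 / (real p + 2)) * (u0 x y ^ p * LC u0 x y + LC (\<lambda>x y. u0 x y ^ Suc p) x y)" for x y
    unfolding LC_def dq by (simp add: field_simps)
  have fL0: "fser (\<lambda>k. (\<i> * of_int (fst k) + \<i> * of_int (snd k)) * c0 k) (LC u0)"
    unfolding LC_def distrib_right by (intro fser_add fser_dX[OF c0s c0_h] fser_dY[OF c0s c0_h])
  have fLq: "fser (\<lambda>k. (\<i> * of_int (fst k) + \<i> * of_int (snd k)) * q k) (LC (\<lambda>x y. u0 x y ^ Suc p))"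
    unfolding LC_def distrib_right by (intro fser_add fser_dX[OF q(1) q_h] fser_dY[OF q(1) q_h])
  have mL: "cmod (\<i> * of_int (fst k) + \<i> * of_int (snd k)) \<le> 2 * jw k powr (1/2)" for k
    using norm_triangle_ineq[of "\<i> * of_int (fst k)" "\<i> * of_int (snd k)"] cmod_freq_le[of k] by linarith
  have half_le: "2 * jw k powr (1/2) \<le> 2 * jw k powr 2" for k
    using powr_mono[of "1/2" 2 "jw k"] jw_ge_1[of k] by simp
  obtain CC where CC: "0 \<le> CC" and cons: "\<And>N m m' c K M a V G. \<lbrakk>N > 0; even N; rep N (\<lambda>k. m k * c k) V; rep N (\<lambda>k. m' k * c k) G; wl2 (s + 2 * a) c K;
       \<And>k. cmod (m k) \<le> M * jw k powr a; \<And>k. cmod (m' k) \<le> M * jw k powr a; 0 \<le> M;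
       \<And>k. 2 * \<bar>fst k\<bar> < int N \<Longrightarrow> 2 * \<bar>snd k\<bar> < int N \<Longrightarrow> m k = m' k\<rbrakk>
       \<Longrightarrow> grid_norm N (\<lambda>a b. V a b - G a b) \<le> CC * (2 * M * K) * real N powr (- s)"
  proof -
    show ?thesis by (rule consistency[OF s], fact that)
  qed
  \<comment> \<open>Bounds the coefficients of the whole difference quotient: those of
    \<open>V1\<close> and, since \<open>\<tau> \<le> 1\<close>, those of the Taylor remainder
    contribute \<open>Z * K\<close> each.\<close>
  define W where "W = 2 * (Z * K)"
  have W0: "0 \<le> W" using Z K0 by (simp add: W_def)
  \<comment> \<open>In this order: the biharmonic and third-order errors, the first-order error
    together with its multiple by the power of \<open>u0\<close>, and the divergence part; the
    factor \<open>1 / (p + 2)\<close> is bounded by one.\<close>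
  define C1 where "C1 = 2 * (CC * (4 * K)) + (1 + G) * (CC * (4 * K)) + CC * (4 * Q)"
  define C2 where "C2 = 2 * (Z * K) + 2 * W + 2 * W + G * (2 * W) + 2 * (2 powr 2 * G * W)"
  have C1_0: "0 \<le> C1" using CC K0 G0 Q0 by (simp add: C1_def)
  have C2_0: "0 \<le> C2" using Z K0 W0 G0 by (simp add: C2_def)
  define C where "C = max C1 (2 * pi * C2)"
  have C0: "0 \<le> C" using C1_0 by (simp add: C_def)
  show ?thesis
  proof (rule that[OF C0])
    fix N :: nat and \<tau> :: real
    assume N: "N > 0" "even N" and \<tau>: "0 < \<tau>" "\<tau> \<le> \<delta>" "\<tau> \<le> 1"
    define gr where "gr f = (\<lambda>a b. f (real a * hstep N) (real b * hstep N))" for f :: "real \<Rightarrow> real \<Rightarrow> real"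
    have rep: "fser c f \<Longrightarrow> rep N c (gr f)" for c f unfolding gr_def by (rule fser_rep)
    define U0 where "U0 = gr u0"
    have U0: "grid_of N u 0 = U0" by (simp add: grid_of_def U0_def gr_def u0_def)
    obtain d where d: "fser d (\<lambda>x y. (u x y \<tau> - u x y 0) / \<tau> - V1 x y)" "wl2 (s + 4) d (K * \<tau>)"
      using assms(8)[OF \<tau>(1,2)] by blast
    define E where "E = gr (\<lambda>x y. (u x y \<tau> - u x y 0) / \<tau> - V1 x y)"
    define Wg where "Wg = (\<lambda>a b. gr V1 a b + E a b)"
    have rE: "rep N d E" unfolding E_def by (rule rep[OF d(1)])
    have rV: "rep N c1 (gr V1)" by (rule rep[OF c1(1)])
    have rU: "rep N c0 U0" unfolding U0_def by (rule rep[OF c0s])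
    have d2: "wl1 2 d (Z * K * \<tau>)" using Z(2)[OF d(2)] by (simp add: mult.assoc)
    define cw where "cw k = c1 k + d k" for k
    have rW: "rep N cw Wg" unfolding cw_def Wg_def by (rule rep_add[OF rV rE])
    have cw: "wl1 2 cw W"
    proof -
      have "wl1 2 cw (Z * K + Z * K * \<tau>)" unfolding cw_def by (rule wl1_add[OF c1_2 d2])
      moreover have "Z * K * \<tau> \<le> Z * K * 1" using Z K0 \<tau> by (intro mult_left_mono) auto
      then have "Z * K + Z * K * \<tau> \<le> W" by (simp add: W_def mult.commute)
      ultimately show ?thesis by (rule wl1_mono[OF _ order_refl])
    qed
    have Wg: "grid_of N u \<tau> a b - grid_of N u 0 a b = \<tau> * Wg a b" for a b
      using \<tau> by (simp add: Wg_def E_def gr_def grid_of_def)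
    define R1 where "R1 = (\<lambda>a b. opA N (opA N (gr V1)) a b - gr (lap2 (lap2 V1)) a b)"
    define R2 where "R2 = (\<lambda>a b. opB N U0 a b - gr (dX (lap2 u0)) a b)"
    define R3 where "R3 = (\<lambda>a b. opL N U0 a b - gr (LC u0) a b)"
    define R4 where "R4 = (\<lambda>a b. opL N (\<lambda>a b. U0 a b ^ Suc p) a b - gr (LC (\<lambda>x y. u0 x y ^ Suc p)) a b)"
    define h where "h = real N powr (- s)"
    have h0: "0 \<le> h" by (simp add: h_def)
    have R1: "grid_norm N R1 \<le> CC * (4 * K) * h"
    proof -
      have "grid_norm N R1 \<le> CC * (2 * 1 * K) * h" unfolding R1_def h_def
      proof (rule cons[OF N, where c = c1 and a = 2 and m = "\<lambda>k. symA N k * symA N k" and m' = "\<lambda>k. of_real ((1 - jw k)\<^sup>2)"])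
        show "rep N (\<lambda>k. symA N k * symA N k * c1 k) (opA N (opA N (gr V1)))"
          using rep_opA[OF N(1) rep_opA[OF N(1) rV]] by (simp add: mult.assoc)
        show "rep N (\<lambda>k. of_real ((1 - jw k)\<^sup>2) * c1 k) (gr (lap2 (lap2 V1)))"
          by (rule rep[OF fser_bilap[OF c1(1) c1_2]])
        show "wl2 (s + 2 * 2) c1 K" using c1(2) by simp
        show "cmod (symA N k * symA N k) \<le> 1 * jw k powr 2" for k by (rule symA_square_bound[OF N(2,1)])
        show "cmod (of_real ((1 - jw k)\<^sup>2)) \<le> 1 * jw k powr 2" for k by (rule symbol_bounds(2))
        show "symA N k * symA N k = of_real ((1 - jw k)\<^sup>2)" if "2 * \<bar>fst k\<bar> < int N" "2 * \<bar>snd k\<bar> < int N" for k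
          using sym_near(1)[OF N(2) that] by (simp add: power2_eq_square)
      qed simp
      also have "\<dots> \<le> CC * (4 * K) * h" using CC K0 h0 by (intro mult_right_mono mult_left_mono) auto
      finally show ?thesis .
    qed
    have R2: "grid_norm N R2 \<le> CC * (4 * K) * h"
    proof -
      have "grid_norm N R2 \<le> CC * (2 * 2 * K) * h" unfolding R2_def h_def
      proof (rule cons[OF N, where c = c0 and a = 2 and m = "symB N" and m' = "\<lambda>k. \<i> * of_int (fst k) * of_real (1 - jw k)"])
        show "rep N (\<lambda>k. symB N k * c0 k) (opB N U0)" by (rule rep_opB[OF N(1) rU])
        show "rep N (\<lambda>k. \<i> * of_int (fst k) * of_real (1 - jw k) * c0 k) (gr (dX (lap2 u0)))"
          by (rule rep[OF fser_dX_lap2[OF c0s c0_2]])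
        show "wl2 (s + 2 * 2) c0 K" using c0(2) by simp
        show "cmod (symB N k) \<le> 2 * jw k powr 2" for k by (rule symB_bound[OF N(2,1)])
        show "cmod (\<i> * of_int (fst k) * of_real (1 - jw k)) \<le> 2 * jw k powr 2" for k
          using symbol_bounds(3)[of k] powr_ge_zero[of "jw k" 2] by linarith
        show "symB N k = \<i> * of_int (fst k) * of_real (1 - jw k)" if "2 * \<bar>fst k\<bar> < int N" "2 * \<bar>snd k\<bar> < int N" for k
          by (rule sym_near(2)[OF N(2) that])
      qed simp
      then show ?thesis by simp
    qed
    have R3: "grid_norm N R3 \<le> CC * (4 * K) * h"
    proof -
      have "grid_norm N R3 \<le> CC * (2 * 2 * K) * h" unfolding R3_def h_def
      proof (rule cons[OF N, where c = c0 and a = 2 and m = "symL N" and m' = "\<lambda>k. \<i> * of_int (fst k) + \<i> * of_int (snd k)"])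
        show "rep N (\<lambda>k. symL N k * c0 k) (opL N U0)" by (rule rep_opL[OF N(1) rU])
        show "rep N (\<lambda>k. (\<i> * of_int (fst k) + \<i> * of_int (snd k)) * c0 k) (gr (LC u0))" by (rule rep[OF fL0])
        show "wl2 (s + 2 * 2) c0 K" using c0(2) by simp
        show "cmod (symL N k) \<le> 2 * jw k powr 2" for k using symL_bound[OF N(2,1), of k] half_le[of k] by linarith
        show "cmod (\<i> * of_int (fst k) + \<i> * of_int (snd k)) \<le> 2 * jw k powr 2" for k
          using mL[of k] half_le[of k] by linarith
        show "symL N k = \<i> * of_int (fst k) + \<i> * of_int (snd k)" if "2 * \<bar>fst k\<bar> < int N" "2 * \<bar>snd k\<bar> < int N" for k
          by (rule sym_near(3)[OF N(2) that])
      qed simp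
      then show ?thesis by simp
    qed
    have R4: "grid_norm N R4 \<le> CC * (4 * Q) * h"
    proof -
      have "grid_norm N R4 \<le> CC * (2 * 2 * Q) * h" unfolding R4_def h_def
      \<comment> \<open>Exponent \<open>1/2\<close> and not \<open>2\<close>: only one derivative
        falls on the power, whose square sums are available with exponent
        \<open>s + 1\<close>.\<close>
      proof (rule cons[OF N, where c = q and a = "1/2" and m = "symL N" and m' = "\<lambda>k. \<i> * of_int (fst k) + \<i> * of_int (snd k)"])
        show "rep N (\<lambda>k. symL N k * q k) (opL N (\<lambda>a b. U0 a b ^ Suc p))"
          using rep_opL[OF N(1) rep[OF q(1)]] by (simp add: gr_def U0_def)
        show "rep N (\<lambda>k. (\<i> * of_int (fst k) + \<i> * of_int (snd k)) * q k) (gr (LC (\<lambda>x y. u0 x y ^ Suc p)))" by (rule rep[OF fLq])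
        show "cmod (symL N k) \<le> 2 * jw k powr (1/2)" for k by (rule symL_bound[OF N(2,1)])
        show "symL N k = \<i> * of_int (fst k) + \<i> * of_int (snd k)" if "2 * \<bar>fst k\<bar> < int N" "2 * \<bar>snd k\<bar> < int N" for k
          by (rule sym_near(3)[OF N(2) that])
      qed (use mL q_2 in auto)
      then show ?thesis by simp
    qed
    define A1 where "A1 = (\<lambda>a b. R1 a b + R2 a b + (R3 a b + (1 / (real p + 2)) * (U0 a b ^ p * R3 a b + R4 a b)))"
    \<comment> \<open>The average of the two time levels is \<open>U0\<close> plus
      \<open>\<tau> / 2\<close> times the difference quotient \<open>Wg\<close>, which produces the
      last term.\<close>
    define A2 where "A2 = (\<lambda>a b. E a b + opA N (opA N E) a b + (\<tau> / 2) * opD N p U0 Wg a b)"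
    have U0p: "\<bar>U0 a b ^ p\<bar> \<le> G" for a b unfolding U0_def gr_def by (rule up)
    have A1: "grid_norm N A1 \<le> C1 * h"
    proof -
      have t1: "grid_norm N A1 \<le> grid_norm N R1 + grid_norm N R2 + (grid_norm N R3 + grid_norm N (\<lambda>a b. (1 / (real p + 2)) * (U0 a b ^ p * R3 a b + R4 a b)))"
        unfolding A1_def by (intro order_trans[OF grid_norm_triangle] add_mono grid_norm_triangle order_refl)
      have "grid_norm N (\<lambda>a b. (1 / (real p + 2)) * (U0 a b ^ p * R3 a b + R4 a b)) = (1 / (real p + 2)) * grid_norm N (\<lambda>a b. U0 a b ^ p * R3 a b + R4 a b)"
        unfolding grid_norm_cmult by simp
      also have "\<dots> \<le> 1 * grid_norm N (\<lambda>a b. U0 a b ^ p * R3 a b + R4 a b)"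
        by (rule mult_right_mono) (auto simp: grid_norm_nonneg)
      also have "\<dots> \<le> G * grid_norm N R3 + grid_norm N R4"
        using grid_norm_triangle[of N "\<lambda>a b. U0 a b ^ p * R3 a b" R4] grid_norm_bounded_mult[where g = "\<lambda>a b. U0 a b ^ p" and N = N and U = R3, OF G0 U0p] by simp
      also have "\<dots> \<le> G * (CC * (4 * K) * h) + CC * (4 * Q) * h"
        using R3 R4 G0 by (intro add_mono mult_left_mono) auto
      finally have "grid_norm N A1 \<le> CC * (4 * K) * h + CC * (4 * K) * h + (CC * (4 * K) * h + (G * (CC * (4 * K) * h) + CC * (4 * Q) * h))"
        using t1 R1 R2 R3 by linarith
      also have "\<dots> = C1 * h" by (simp add: C1_def algebra_simps)
      finally show ?thesis .
    qed
    have A2: "\<bar>A2 a b\<bar> \<le> C2 * \<tau>" if ab: "a < N" "b < N" for a b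
    proof -
      have zero: "wl1 0 (\<lambda>k. m k * c k) (M * J)" if "wl1 2 c J" "\<And>k. cmod (m k) \<le> M * jw k powr 2" "0 \<le> M" for m c M J
        using wl1_multiplier[of 0 2 c J m M] that by simp
      have e1: "\<bar>E a b\<bar> \<le> Z * K * \<tau>" by (rule rep_bound[OF rE wl1_mono[OF d2] ab]) auto
      have e2: "\<bar>opA N (opA N E) a b\<bar> \<le> 1 * (Z * K * \<tau>)"
      proof (rule rep_bound[OF _ zero[OF d2] ab])
        show "rep N (\<lambda>k. (symA N k * symA N k) * d k) (opA N (opA N E))"
          using rep_opA[OF N(1) rep_opA[OF N(1) rE]] by (simp add: mult.assoc)
        show "cmod (symA N k * symA N k) \<le> 1 * jw k powr 2" for k by (rule symA_square_bound[OF N(2,1)])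
      qed simp
      have b: "\<bar>opB N Wg a b\<bar> \<le> 2 * W"
        by (rule rep_bound[OF rep_opB[OF N(1) rW] zero[OF cw symB_bound[OF N(2,1)]] ab]) simp
      have symL2: "cmod (symL N k) \<le> 2 * jw k powr 2" for k using symL_bound[OF N(2,1), of k] half_le[of k] by linarith
      have l: "\<bar>opL N Wg a b\<bar> \<le> 2 * W"
        by (rule rep_bound[OF rep_opL[OF N(1) rW] zero[OF cw symL2] ab]) simp
      have fw: "fser cw (\<lambda>x y. V1 x y + ((u x y \<tau> - u x y 0) / \<tau> - V1 x y))"
        unfolding cw_def by (rule fser_add[OF c1(1) d(1)])
      \<comment> \<open>\<open>opL\<close> acts on the product, so the product itself is expanded,
        with the weight \<open>2\<close> of both factors preserved by convolution.\<close>
      obtain b' where b': "fser b' (\<lambda>x y. u0 x y ^ p * (V1 x y + ((u x y \<tau> - u x y 0) / \<tau> - V1 x y)))" "wl1 2 b' (2 powr 2 * G * W)"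
        by (rule fser_mult[OF g_p g(2) fw cw]) simp
      have l': "\<bar>opL N (\<lambda>a b. U0 a b ^ p * Wg a b) a b\<bar> \<le> 2 * (2 powr 2 * G * W)"
      proof (rule rep_bound[OF rep_opL[OF N(1)] zero[OF b'(2) symL2] ab])
        show "rep N b' (\<lambda>a b. U0 a b ^ p * Wg a b)"
          using rep[OF b'(1)] by (simp add: gr_def U0_def Wg_def E_def)
      qed simp
      have ul: "\<bar>U0 a b ^ p * opL N Wg a b\<bar> \<le> G * (2 * W)"
        unfolding abs_mult by (intro mult_mono U0p l G0) auto
      let ?X = "U0 a b ^ p * opL N Wg a b + opL N (\<lambda>a b. U0 a b ^ p * Wg a b) a b"
      have tri: "\<bar>x + y + z\<bar> \<le> X + Y + Z" if "\<bar>x\<bar> \<le> X" "\<bar>y\<bar> \<le> Y" "\<bar>z\<bar> \<le> Z" for x y z X Y Z :: real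
        using that by linarith
      have "\<bar>(1 / (real p + 2)) * ?X\<bar> \<le> 1 * \<bar>?X\<bar>"
        unfolding abs_mult by (intro mult_right_mono) auto
      also have "\<dots> \<le> G * (2 * W) + 2 * (2 powr 2 * G * W)"
        unfolding mult_1 by (rule order_trans[OF abs_triangle_ineq add_mono[OF ul l']])
      finally have "\<bar>opD N p U0 Wg a b\<bar> \<le> 2 * W + 2 * W + (G * (2 * W) + 2 * (2 powr 2 * G * W))"
        unfolding opD_def by (rule tri[OF b l])
      then have "(\<tau> / 2) * \<bar>opD N p U0 Wg a b\<bar> \<le> \<tau> * (2 * W + 2 * W + (G * (2 * W) + 2 * (2 powr 2 * G * W)))"
        using \<tau> W0 G0 by (intro mult_mono) auto
      then have "\<bar>(\<tau> / 2) * opD N p U0 Wg a b\<bar> \<le> \<tau> * (2 * W + 2 * W + (G * (2 * W) + 2 * (2 powr 2 * G * W)))"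
        using \<tau> by (simp add: abs_mult)
      then have "\<bar>A2 a b\<bar> \<le> Z * K * \<tau> + 1 * (Z * K * \<tau>) + \<tau> * (2 * W + 2 * W + (G * (2 * W) + 2 * (2 powr 2 * G * W)))"
        unfolding A2_def by (rule tri[OF e1 e2])
      also have "\<dots> = C2 * \<tau>" by (simp add: C2_def algebra_simps)
      finally show ?thesis .
    qed
    let ?r = "\<lambda>a b. (grid_of N u \<tau> a b - grid_of N u 0 a b
           + opA N (opA N (\<lambda>a b. grid_of N u \<tau> a b - grid_of N u 0 a b)) a b) / \<tau>
         + opD N p (grid_of N u 0) (\<lambda>a b. (grid_of N u \<tau> a b + grid_of N u 0 a b) / 2) a b"
    have r_eq: "?r a b = A1 a b + A2 a b" for a b
    proof -
      have AA: "opA N (opA N Wg) a b = opA N (opA N (gr V1)) a b + opA N (opA N E) a b"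
      proof -
        have "gr V1 = (\<lambda>a b. Wg a b - E a b)" by (simp add: Wg_def)
        then have "opA N (opA N (gr V1)) = (\<lambda>a b. opA N (opA N Wg) a b - opA N (opA N E) a b)"
          by (simp add: opA_diff)
        then show ?thesis by simp
      qed
      have 1: "(grid_of N u \<tau> a b - grid_of N u 0 a b
           + opA N (opA N (\<lambda>a b. grid_of N u \<tau> a b - grid_of N u 0 a b)) a b) / \<tau> = Wg a b + opA N (opA N Wg) a b"
        unfolding Wg opA_cmult using \<tau> by (simp add: field_simps)
      have "(grid_of N u \<tau> a b + grid_of N u 0 a b) / 2 = U0 a b - (- (\<tau> / 2)) * Wg a b" for a b
        using Wg[of a b] unfolding U0 by (simp add: field_simps)
      then have 2: "opD N p (grid_of N u 0) (\<lambda>a b. (grid_of N u \<tau> a b + grid_of N u 0 a b) / 2) a b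
          = opD N p U0 U0 a b + (\<tau> / 2) * opD N p U0 Wg a b"
        unfolding U0[symmetric] by (simp only: opD_diff opD_cmult U0)
      have 3: "opD N p U0 U0 a b = opB N U0 a b + opL N U0 a b
          + (1 / (real p + 2)) * (U0 a b ^ p * opL N U0 a b + opL N (\<lambda>a b. U0 a b ^ Suc p) a b)"
        unfolding opD_def by (simp add: mult.commute)
      \<comment> \<open>The equation at time zero in split form; subtracting it leaves only
        discretisation errors.\<close>
      have 4: "gr V1 a b + gr (lap2 (lap2 V1)) a b + gr (dX (lap2 u0)) a b + gr (LC u0) a b
          + (1 / (real p + 2)) * (U0 a b ^ p * gr (LC u0) a b + gr (LC (\<lambda>x y. u0 x y ^ Suc p)) a b) = 0"
        using pde[of "real a * hstep N" "real b * hstep N"] nonlin[of "real a * hstep N" "real b * hstep N"]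
        unfolding gr_def U0_def u0_def[symmetric] by (simp add: LC_def distrib_right u0_def)
      show ?thesis
        unfolding 1 2 3 AA A1_def A2_def R1_def R2_def R3_def R4_def
        using 4 by (simp add: Wg_def right_diff_distrib distrib_left)
    qed
    have "grid_norm N ?r \<le> grid_norm N A1 + grid_norm N A2"
      unfolding r_eq by (rule grid_norm_triangle)
    also have "\<dots> \<le> C1 * h + 2 * pi * (C2 * \<tau>)"
      using A1 C2_0 \<tau> by (intro add_mono grid_norm_le[OF N(1)] A2) auto
    also have "\<dots> \<le> C * h + C * \<tau>"
      using h0 \<tau> by (intro add_mono) (auto simp: C_def mult.assoc[symmetric] intro!: mult_right_mono)
    finally show "grid_norm N ?r \<le> C * (real N powr (- s) + \<tau>)"
      by (simp add: h_def distrib_left)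
  qed
qed

section \<open>Subtraction of the scheme and final error bound\<close>

theorem theorem4p1:
  fixes u :: "real \<Rightarrow> real \<Rightarrow> real \<Rightarrow> real" and p :: nat and s T :: real
  assumes "p \<ge> 1" and "s > 1" and "T > 0"
    and "\<forall>t\<in>{0..T}. periodic2 (\<lambda>x y. u x y t)"
    and "\<forall>t\<in>{0..T}. continuous_on UNIV (\<lambda>z :: real \<times> real. u (fst z) (snd z) t)"
    and "rosenau_kdv p T u"
    and "C2_Hp (s + 4) T u"
  shows "\<exists>\<tau>0 > 0. \<exists>C > 0. \<forall>N \<tau> U1.
           N > 0 \<and> even N \<and> 0 < \<tau> \<and> \<tau> \<le> \<tau>0 \<and> (\<exists>M::nat. M \<ge> 1 \<and> \<tau> = T / real M)
           \<and> lcnmp_step1 N \<tau> p (grid_of N u 0) U1 \<longrightarrow>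
             (let E = (\<lambda>j1 j2. grid_of N u \<tau> j1 j2 - U1 j1 j2) in
                grid_norm N E + grid_norm N (lap_h N E) \<le> C * (real N powr (- s) + \<tau>\<^sup>2)
              \<and> grid_max N E \<le> C * (real N powr (- s) + \<tau>\<^sup>2))"
proof -
  obtain c0 c1 V1 K \<delta> where c0: "fser c0 (\<lambda>x y. u x y 0)" "wl2 (s + 4) c0 K"
    and c1: "fser c1 V1" "wl2 (s + 4) c1 K"
    and pde: "\<And>x y. V1 x y + lap2 (lap2 V1) x y + dX (lap2 (\<lambda>x y. u x y 0)) x y
       + (1 + u x y 0 ^ p) * (dX (\<lambda>x y. u x y 0) x y + dY (\<lambda>x y. u x y 0) x y) = 0"
    and \<delta>: "0 < \<delta>" and d: "\<And>\<tau>. 0 < \<tau> \<Longrightarrow> \<tau> \<le> \<delta> \<Longrightarrow>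
       \<exists>d. fser d (\<lambda>x y. (u x y \<tau> - u x y 0) / \<tau> - V1 x y) \<and> wl2 (s + 4) d (K * \<tau>)"
    by (rule rosenau_initial_data[OF assms(2-7)]) blast
  obtain C where C: "0 \<le> C" and res: "\<And>N \<tau>. \<lbrakk>N > 0; even N; 0 < \<tau>; \<tau> \<le> \<delta>; \<tau> \<le> 1\<rbrakk> \<Longrightarrow>
       grid_norm N (\<lambda>a b. (grid_of N u \<tau> a b - grid_of N u 0 a b
           + opA N (opA N (\<lambda>a b. grid_of N u \<tau> a b - grid_of N u 0 a b)) a b) / \<tau>
         + opD N p (grid_of N u 0) (\<lambda>a b. (grid_of N u \<tau> a b + grid_of N u 0 a b) / 2) a b)
       \<le> C * (real N powr (- s) + \<tau>)"
  proof -
    show ?thesis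
    proof (rule residual_estimate[where u = u and \<delta> = \<delta> and K = K, OF assms(2,1) c0 c1 pde])
      show "\<exists>d. fser d (\<lambda>x y. (u x y \<tau> - u x y 0) / \<tau> - V1 x y) \<and> wl2 (s + 4) d (K * \<tau>)"
        if "0 < \<tau>" "\<tau> \<le> \<delta>" for \<tau>
        by (rule d[OF that])
    qed (fact that)
  qed
  obtain S where S: "0 \<le> S" and sob: "\<And>N e a b. \<lbrakk>N > 0; even N; a < N; b < N\<rbrakk>
       \<Longrightarrow> \<bar>e a b\<bar> \<le> S * (hstep N * sqrt (ip N e e + ip N (opA N e) (opA N e)))"
    by (rule discrete_sobolev) blast
  \<comment> \<open>\<open>2\<close> serves the sum of two norms, \<open>S\<close> the maximum norm;
    the summand \<open>1\<close> provides strict positivity even if \<open>C = 0\<close>.\<close>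
  define C' where "C' = (2 + S) * C + 1"
  have C'0: "0 < C'" using S C by (simp add: C'_def add_nonneg_pos)
  show ?thesis
  \<comment> \<open>\<open>\<delta>\<close> is the range of the Taylor estimate; the bound
    \<open>1\<close> also allows the factor \<open>\<tau>\<close> in front of
    \<open>real N powr (- s)\<close> to be discarded.\<close>
  proof (rule exI[of _ "min \<delta> 1"], rule conjI, simp add: \<delta>, rule exI[of _ C'], rule conjI, rule C'0, intro allI impI)
    fix N :: nat and \<tau> :: real and U1 :: grid
    assume A: "N > 0 \<and> even N \<and> 0 < \<tau> \<and> \<tau> \<le> min \<delta> 1 \<and> (\<exists>M::nat. M \<ge> 1 \<and> \<tau> = T / real M)
           \<and> lcnmp_step1 N \<tau> p (grid_of N u 0) U1"
    then have N: "N > 0" "even N" and \<tau>: "0 < \<tau>" "\<tau> \<le> \<delta>" "\<tau> \<le> 1"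
      and step: "lcnmp_step1 N \<tau> p (grid_of N u 0) U1" by auto
    define U0 where "U0 = grid_of N u 0"
    define UT where "UT = grid_of N u \<tau>"
    define e where "e = (\<lambda>a b. UT a b - U1 a b)"
    define r where "r = (\<lambda>a b. (UT a b - U0 a b + opA N (opA N (\<lambda>a b. UT a b - U0 a b)) a b) / \<tau>
         + opD N p U0 (\<lambda>a b. (UT a b + U0 a b) / 2) a b)"
    \<comment> \<open>The scheme starts from the exact grid values, so both equations carry the same
      coefficient \<open>U0\<close> in \<open>opD\<close>; the error equation is linear and contains
      no difference of nonlinear terms.\<close>
    have eq: "(e a b + opA N (opA N e) a b) / \<tau> + opD N p U0 (\<lambda>a b. e a b / 2) a b = r a b" if "a < N" "b < N" for a b
    proof -
      have sch: "(U1 a b - U0 a b + opA N (opA N (\<lambda>a b. U1 a b - U0 a b)) a b) / \<tau>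
          + opD N p U0 (\<lambda>a b. (U1 a b + U0 a b) / 2) a b = 0"
        using step that by (simp add: lcnmp_step1_def U0_def Let_def)
      have "e = (\<lambda>a b. (UT a b - U0 a b) - (U1 a b - U0 a b))" by (simp add: e_def)
      then have "opA N (opA N e) = (\<lambda>a b. opA N (opA N (\<lambda>a b. UT a b - U0 a b)) a b - opA N (opA N (\<lambda>a b. U1 a b - U0 a b)) a b)"
        by (simp only: opA_diff)
      moreover have "(\<lambda>a b. e a b / 2) = (\<lambda>a b. (UT a b + U0 a b) / 2 - (U1 a b + U0 a b) / 2)"
        by (simp add: e_def diff_divide_distrib add_divide_distrib)
      then have "opD N p U0 (\<lambda>a b. e a b / 2) = (\<lambda>a b. opD N p U0 (\<lambda>a b. (UT a b + U0 a b) / 2) a b - opD N p U0 (\<lambda>a b. (U1 a b + U0 a b) / 2) a b)"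
        by (simp only: opD_diff)
      ultimately have "(e a b + opA N (opA N e) a b) / \<tau> + opD N p U0 (\<lambda>a b. e a b / 2) a b
         = r a b - ((U1 a b - U0 a b + opA N (opA N (\<lambda>a b. U1 a b - U0 a b)) a b) / \<tau>
          + opD N p U0 (\<lambda>a b. (U1 a b + U0 a b) / 2) a b)"
        by (simp add: e_def r_def diff_divide_distrib add_divide_distrib)
      then show ?thesis using sch by simp
    qed
    define X where "X = hstep N * sqrt (ip N e e + ip N (opA N e) (opA N e))"
    have h0: "0 \<le> hstep N" by (simp add: hstep_def)
    have "X \<le> hstep N * (\<tau> * sqrt (ip N r r))"
      unfolding X_def by (intro mult_left_mono energy_estimate[OF \<tau>(1) eq] h0)
    also have "\<dots> = \<tau> * grid_norm N r" by (simp add: grid_norm_ip mult_ac)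
    also have "\<dots> \<le> \<tau> * (C * (real N powr (- s) + \<tau>))"
      using res[OF N \<tau>] \<tau> unfolding r_def UT_def U0_def by (intro mult_left_mono) auto
    also have "\<dots> = C * (\<tau> * real N powr (- s) + \<tau>\<^sup>2)" by (simp add: algebra_simps power2_eq_square)
    also have "\<dots> \<le> C * (1 * real N powr (- s) + \<tau>\<^sup>2)"
      using C \<tau> by (intro mult_left_mono add_right_mono mult_right_mono) auto
    finally have X: "X \<le> C * (real N powr (- s) + \<tau>\<^sup>2)" by simp
    have n1: "grid_norm N e \<le> X"
      unfolding X_def grid_norm_ip using ip_self_nonneg h0 by (intro mult_left_mono real_sqrt_le_mono) auto
    have "grid_norm N (lap_h N e) \<le> grid_norm N (opA N e)" by (rule grid_norm_lap_h_le[OF N])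
    also have "\<dots> \<le> X"
      unfolding X_def grid_norm_ip using ip_self_nonneg h0 by (intro mult_left_mono real_sqrt_le_mono) auto
    finally have n2: "grid_norm N (lap_h N e) \<le> X" .
    have n3: "grid_max N e \<le> S * X"
    proof -
      let ?A = "{\<bar>e j1 j2\<bar> | j1 j2. j1 < N \<and> j2 < N}"
      have "?A = (\<lambda>z. \<bar>e (fst z) (snd z)\<bar>) ` ({..<N} \<times> {..<N})" by force
      then have "finite ?A" by simp
      moreover have "?A \<noteq> {}" using N by auto
      ultimately show ?thesis
        unfolding grid_max_def using sob[OF N, of _ _ e] by (auto simp: X_def)
    qed
    define B where "B = real N powr (- s) + \<tau>\<^sup>2"
    have B0: "0 \<le> B" by (simp add: B_def)
    have "2 * X \<le> C' * B" "S * X \<le> C' * B"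
    proof -
      have "2 * X \<le> 2 * (C * B)" using X by (simp add: B_def)
      also have "\<dots> \<le> C' * B" using S C B0 by (simp add: C'_def algebra_simps)
      finally show "2 * X \<le> C' * B" .
      have "S * X \<le> S * (C * B)" using X S by (intro mult_left_mono) (simp_all add: B_def)
      also have "\<dots> \<le> C' * B" using C B0 by (simp add: C'_def algebra_simps)
      finally show "S * X \<le> C' * B" .
    qed
    then have "grid_norm N e + grid_norm N (lap_h N e) \<le> C' * B \<and> grid_max N e \<le> C' * B"
      using n1 n2 n3 by linarith
    then show "let E = (\<lambda>j1 j2. grid_of N u \<tau> j1 j2 - U1 j1 j2) in
                grid_norm N E + grid_norm N (lap_h N E) \<le> C' * (real N powr (- s) + \<tau>\<^sup>2)
              \<and> grid_max N E \<le> C' * (real N powr (- s) + \<tau>\<^sup>2)"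
      by (simp add: Let_def e_def UT_def B_def)
  qed
qed

end
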